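(* For every $n\geq1$, there is a bijective correspondence between the group of welded Gauss diagrams $wG_n$ and the welded braid group $WB_n$.
   Context: Welded braid group $WB_n$. A strand diagram on $n$ strings is a set of oriented arcs in $\mathbb{R}^2$, monotone with respect to the first coordinate, from the points $(0,1),\dots,(0,n)$ to $(1,1),\dots,(1,n)$, whose double points (taken at different $x$-coordinates) are of three kinds: classical positive, classical negative (with over/under information), and welded (no over/under information). It determines a word (read left to right) in the elementary diagrams $\sigma_i^{\pm1},\rho_i$ ($1\le i\le n-1$), where $\sigma_i$ is the classical crossing in which the $(i+1)$-th strand passes over the $i$-th strand and $\rho_i$ is the welded crossing of the strands $i$ and $i+1$. A welded braid is an equivalence class of strand diagrams under planar isotopy and the local moves: (R2) $\sigma_i\sigma_i^{-1}=\sigma_i^{-1}\sigma_i=1$; (R3) $\sigma_i\sigma_{i+1}\sigma_i=\sigma_{i+1}\sigma_i\sigma_{i+1}$; (V2) $\rho_i^2=1$; (V3) $\rho_i\rho_{i+1}\rho_i=\rho_{i+1}\rho_i\rho_{i+1}$; (M) $\rho_{i+1}\rho_i\sigma_{i+1}=\sigma_i\rho_{i+1}\rho_i$; (F1) $\sigma_{i+1}\sigma_i\rho_{i+1}=\rho_i\sigma_{i+1}\sigma_i$. $WB_n$ is the group of these classes under stacking and rescaling. Gauss diagrams. A Gauss diagram is a set of signed and oriented arrows on $n$ ordered and oriented horizontal intervals, together with a permutation $\sigma\in S_n$; the right extremity of the $i$-th interval is labelled $\sigma(i)$. Endpoints of arrows are heads or tails according to the orientation of the arrow. A braid Gauss diagram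 is a Gauss diagram whose arrows are pairwise distinct, each connecting different intervals, and such that, after reparametrizing the intervals, all arrows can be drawn vertical and at different horizontal coordinates. Let $bGD_n$ be the set of braid Gauss diagrams. Moves on braid Gauss diagrams, performed inside a diagram (with no condition on the relative vertical positions of the intervals involved): $(\Omega_2)$ two arrows with opposite signs joining the same two intervals, in the same direction and with both pairs of endpoints adjacent, may be deleted or inserted; $(\Omega_3)$ for three different intervals $a,b,c$, three consecutive arrows of the same sign $\varepsilon$, from $a$ to $b$, from $a$ to $c$, from $b$ to $c$, occurring in this order and with endpoints adjacent on each interval, may be replaced by the same arrows in the opposite order (and conversely); $(TC)$ two adjacent tails, on an interval $a$, of arrows with arbitrary signs with heads on two other, different intervals, may be exchanged. Two braid Gauss diagrams are wReidemeister equivalent if they are related by a finite sequence of moves $(\Omega_2),(\Omega_3),(TC)$. The group of welded Gauss diagrams $wG_n$ is the group of equivalence classes of $bGD_n$ under wReidemeister equivalence. *)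

theory Defs
  imports "HOL-Analysis.Analysis" "HOL-Combinatorics.Permutations" "HOL-Algebra.Group"
begin

section \<open>Strand diagrams\<close>

datatype crossing = Positive | Negative | Welded

text \<open>
  An arc in the plane that runs from the line \<open>x = 0\<close> to the line \<open>x = 1\<close> and is monotone with
  respect to the first coordinate is the graph of a continuous function on \<open>{0..1}\<close>.  The arc
  with label \<open>k\<close> is the one that starts at \<open>(0, k)\<close>; \<open>height D k x\<close> is its second coordinate above
  \<open>x\<close>.  The field \<open>kind\<close> is only relevant at double points.
\<close>

record strand_diagram =
  height :: "nat \<Rightarrow> real \<Rightarrow> real"
  kind :: "real \<times> real \<Rightarrow> crossing"

definition arc_points :: "strand_diagram \<Rightarrow> nat \<Rightarrow> (real \<times> real) set" where
  "arc_points D k = {(x, height D k x) | x. x \<in> {0..1}}"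

definition double_points :: "nat \<Rightarrow> strand_diagram \<Rightarrow> (real \<times> real) set" where
  "double_points n D = {p. \<exists>k\<in>{1..n}. \<exists>l\<in>{1..n}. k \<noteq> l \<and> p \<in> arc_points D k \<and> p \<in> arc_points D l}"

text \<open>
  \<open>above_before D k l x\<close> and \<open>above_after D k l x\<close>: immediately to the left (right) of \<open>x\<close>, the arc
  \<open>k\<close> lies above the arc \<open>l\<close> in the plane.  (This is not the over/under information.)
\<close>

definition above_before :: "strand_diagram \<Rightarrow> nat \<Rightarrow> nat \<Rightarrow> real \<Rightarrow> bool" where
  "above_before D k l x \<longleftrightarrow> (\<forall>\<^sub>F s in at_left x. height D l s < height D k s)"

definition above_after :: "strand_diagram \<Rightarrow> nat \<Rightarrow> nat \<Rightarrow> real \<Rightarrow> bool" where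
  "above_after D k l x \<longleftrightarrow> (\<forall>\<^sub>F s in at_right x. height D l s < height D k s)"

text \<open>
  The last three conditions: no triple points, double points have different abscissas, and two arcs
  that meet actually cross there (they exchange their relative positions).
\<close>

definition strand_diagrams :: "nat \<Rightarrow> strand_diagram set" where
  "strand_diagrams n = {D.
     (\<forall>k\<in>{1..n}. continuous_on {0..1} (height D k) \<and> height D k 0 = real k) \<and>
     bij_betw (\<lambda>k. height D k 1) {1..n} (real ` {1..n}) \<and>
     finite (double_points n D) \<and>
     (\<forall>p\<in>double_points n D. card {k\<in>{1..n}. p \<in> arc_points D k} = 2) \<and>
     inj_on fst (double_points n D) \<and>
     (\<forall>x\<in>{0..1}. \<forall>k\<in>{1..n}. \<forall>l\<in>{1..n}. k \<noteq> l \<and> height D k x = height D l x \<longrightarrow>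
        (above_before D k l x \<and> above_after D l k x) \<or>
        (above_before D l k x \<and> above_after D k l x))}"

datatype letter = Sigma nat | Sigma_inv nat | Rho nat

text \<open>
  Strands are numbered from bottom to top, so a crossing with exactly \<open>i - 1\<close> arcs below it is a
  crossing of the \<open>i\<close>-th and the \<open>(i+1)\<close>-th strand.
\<close>

definition letter_at :: "nat \<Rightarrow> strand_diagram \<Rightarrow> real \<times> real \<Rightarrow> letter" where
  "letter_at n D p =
     (let i = card {k\<in>{1..n}. height D k (fst p) < snd p} + 1 in
      case kind D p of Positive \<Rightarrow> Sigma i | Negative \<Rightarrow> Sigma_inv i | Welded \<Rightarrow> Rho i)"

definition diagram_word :: "nat \<Rightarrow> strand_diagram \<Rightarrow> letter list" where
  "diagram_word n D =
     map (\<lambda>x. letter_at n D (x, THE y. (x, y) \<in> double_points n D))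
       (sorted_list_of_set (fst ` double_points n D))"


section \<open>The welded braid group\<close>

text \<open>
  Planar isotopy: an ambient isotopy \<open>H\<close> of the strip \<open>[0,1] \<times> \<real>\<close> relative to its boundary which
  carries the arcs of \<open>D\<close> to those of \<open>D'\<close> and respects the kinds of the double points.  It may
  exchange the order of the abscissas of double points; this is what makes distant letters commute.
\<close>

abbreviation strip :: "(real \<times> real) set" where
  "strip \<equiv> {0..1} \<times> UNIV"

definition planar_isotopic :: "nat \<Rightarrow> strand_diagram \<Rightarrow> strand_diagram \<Rightarrow> bool" where
  "planar_isotopic n D D' \<longleftrightarrow> (\<exists>H :: real \<Rightarrow> real \<times> real \<Rightarrow> real \<times> real.
     continuous_on ({0..1} \<times> strip) (\<lambda>(t, p). H t p) \<and>
     (\<forall>t\<in>{0..1}. \<exists>G. homeomorphism strip strip (H t) G) \<and>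
     (\<forall>p\<in>strip. H 0 p = p) \<and>
     (\<forall>t\<in>{0..1}. \<forall>p\<in>{0, 1} \<times> UNIV. H t p = p) \<and>
     (\<forall>k\<in>{1..n}. H 1 ` arc_points D k = arc_points D' k) \<and>
     (\<forall>p\<in>double_points n D. kind D' (H 1 p) = kind D p))"

inductive local_move :: "nat \<Rightarrow> letter list \<Rightarrow> letter list \<Rightarrow> bool" for n :: nat where
  R2_left: "1 \<le> i \<Longrightarrow> i < n \<Longrightarrow> local_move n [Sigma i, Sigma_inv i] []"
| R2_right: "1 \<le> i \<Longrightarrow> i < n \<Longrightarrow> local_move n [Sigma_inv i, Sigma i] []"
| R3: "1 \<le> i \<Longrightarrow> i + 1 < n \<Longrightarrow>
    local_move n [Sigma i, Sigma (i + 1), Sigma i] [Sigma (i + 1), Sigma i, Sigma (i + 1)]"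
| V2: "1 \<le> i \<Longrightarrow> i < n \<Longrightarrow> local_move n [Rho i, Rho i] []"
| V3: "1 \<le> i \<Longrightarrow> i + 1 < n \<Longrightarrow>
    local_move n [Rho i, Rho (i + 1), Rho i] [Rho (i + 1), Rho i, Rho (i + 1)]"
| M: "1 \<le> i \<Longrightarrow> i + 1 < n \<Longrightarrow>
    local_move n [Rho (i + 1), Rho i, Sigma (i + 1)] [Sigma i, Rho (i + 1), Rho i]"
| F1: "1 \<le> i \<Longrightarrow> i + 1 < n \<Longrightarrow>
    local_move n [Sigma (i + 1), Sigma i, Rho (i + 1)] [Rho i, Sigma (i + 1), Sigma i]"

definition welded_move :: "nat \<Rightarrow> strand_diagram \<Rightarrow> strand_diagram \<Rightarrow> bool" where
  "welded_move n D D' \<longleftrightarrow> (\<exists>u v l r. local_move n l r \<and>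
     diagram_word n D = u @ l @ v \<and> diagram_word n D' = u @ r @ v)"

definition welded_step :: "nat \<Rightarrow> strand_diagram rel" where
  "welded_step n = {(D, D') \<in> strand_diagrams n \<times> strand_diagrams n.
     planar_isotopic n D D' \<or> welded_move n D D'}"

definition welded_eq :: "nat \<Rightarrow> strand_diagram rel" where
  "welded_eq n = (welded_step n \<union> (welded_step n)\<inverse>)\<^sup>*"

definition welded_braid :: "nat \<Rightarrow> strand_diagram \<Rightarrow> strand_diagram set" where
  "welded_braid n D = welded_eq n `` {D}"

definition strand_end :: "strand_diagram \<Rightarrow> nat \<Rightarrow> nat" where
  "strand_end D k = (THE j. height D k 1 = real j)"

definition trivial_strands :: strand_diagram where
  "trivial_strands = \<lparr>height = (\<lambda>k x. real k), kind = (\<lambda>p. Welded)\<rparr>"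

definition stack :: "strand_diagram \<Rightarrow> strand_diagram \<Rightarrow> strand_diagram" where
  "stack D E = \<lparr>
     height = (\<lambda>k x. if x \<le> 1/2 then height D k (2 * x) else height E (strand_end D k) (2 * x - 1)),
     kind = (\<lambda>(x, y). if x \<le> 1/2 then kind D (2 * x, y) else kind E (2 * x - 1, y))\<rparr>"

definition welded_braid_group :: "nat \<Rightarrow> strand_diagram set monoid" where
  "welded_braid_group n = \<lparr>
     carrier = strand_diagrams n // welded_eq n,
     mult = (\<lambda>A B. welded_eq n `` {stack D E | D E. D \<in> A \<and> E \<in> B}),
     one = welded_braid n trivial_strands\<rparr>"


section \<open>Braid Gauss diagrams\<close>

text \<open>
  The \<open>i\<close>-th interval is \<open>{i} \<times> {0..1}\<close>.
\<close>

record arrow =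
  tail :: "nat \<times> real"
  head :: "nat \<times> real"
  arrow_sign :: int

record gauss_diagram =
  arrows :: "arrow set"
  label :: "nat \<Rightarrow> nat"

definition gauss_diagrams :: "nat \<Rightarrow> gauss_diagram set" where
  "gauss_diagrams n = {G.
     finite (arrows G) \<and> label G permutes {1..n} \<and>
     (\<forall>\<alpha>\<in>arrows G. tail \<alpha> \<in> {1..n} \<times> {0<..<1} \<and> head \<alpha> \<in> {1..n} \<times> {0<..<1} \<and>
        tail \<alpha> \<noteq> head \<alpha> \<and> arrow_sign \<alpha> \<in> {1, -1}) \<and>
     (\<forall>\<alpha>\<in>arrows G. \<forall>\<beta>\<in>arrows G. \<alpha> \<noteq> \<beta> \<longrightarrow> {tail \<alpha>, head \<alpha>} \<inter> {tail \<beta>, head \<beta>} = {})}"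

text \<open>
  A reparametrization consists of an orientation preserving homeomorphism of every interval.
\<close>

definition reparametrization :: "(nat \<Rightarrow> real \<Rightarrow> real) \<Rightarrow> bool" where
  "reparametrization \<phi> \<longleftrightarrow> (\<forall>i. continuous_on {0..1} (\<phi> i) \<and> strict_mono_on {0..1} (\<phi> i) \<and>
     \<phi> i 0 = 0 \<and> \<phi> i 1 = 1)"

definition map_arrow :: "(nat \<times> real \<Rightarrow> nat \<times> real) \<Rightarrow> arrow \<Rightarrow> arrow" where
  "map_arrow f \<alpha> = \<lparr>tail = f (tail \<alpha>), head = f (head \<alpha>), arrow_sign = arrow_sign \<alpha>\<rparr>"

definition reparametrize :: "(nat \<Rightarrow> real \<Rightarrow> real) \<Rightarrow> gauss_diagram \<Rightarrow> gauss_diagram" where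
  "reparametrize \<phi> G = G\<lparr>arrows := map_arrow (\<lambda>(i, x). (i, \<phi> i x)) ` arrows G\<rparr>"

definition vertical :: "gauss_diagram \<Rightarrow> bool" where
  "vertical G \<longleftrightarrow> (\<forall>\<alpha>\<in>arrows G. snd (tail \<alpha>) = snd (head \<alpha>)) \<and>
     inj_on (\<lambda>\<alpha>. snd (tail \<alpha>)) (arrows G)"

definition bGD :: "nat \<Rightarrow> gauss_diagram set" where
  "bGD n = {G \<in> gauss_diagrams n.
     (\<forall>\<alpha>\<in>arrows G. fst (tail \<alpha>) \<noteq> fst (head \<alpha>)) \<and>
     (\<exists>\<phi>. reparametrization \<phi> \<and> vertical (reparametrize \<phi> G))}"


section \<open>The group of welded Gauss diagrams\<close>

text \<open>
  On the \<open>i\<close>-th interval there is no endpoint of an arrow strictly between \<open>x\<close> and \<open>y\<close>.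
\<close>

definition adjacent :: "gauss_diagram \<Rightarrow> nat \<Rightarrow> real \<Rightarrow> real \<Rightarrow> bool" where
  "adjacent G i x y \<longleftrightarrow>
     (\<forall>\<alpha>\<in>arrows G. \<forall>z. min x y < z \<and> z < max x y \<longrightarrow> tail \<alpha> \<noteq> (i, z) \<and> head \<alpha> \<noteq> (i, z))"

text \<open>
  Each rule splits the arrows into those involved in the move and the remaining set \<open>R\<close>.
\<close>

inductive gauss_move :: "gauss_diagram \<Rightarrow> gauss_diagram \<Rightarrow> bool" where
  Omega2:
    "arrows G = R \<union> {\<lparr>tail = (a, x), head = (b, y), arrow_sign = \<epsilon>\<rparr>,
                    \<lparr>tail = (a, x'), head = (b, y'), arrow_sign = - \<epsilon>\<rparr>} \<Longrightarrow>
     arrows G' = R \<Longrightarrow> label G' = label G \<Longrightarrow>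
     \<lparr>tail = (a, x), head = (b, y), arrow_sign = \<epsilon>\<rparr> \<notin> R \<Longrightarrow>
     \<lparr>tail = (a, x'), head = (b, y'), arrow_sign = - \<epsilon>\<rparr> \<notin> R \<Longrightarrow>
     a \<noteq> b \<Longrightarrow> adjacent G a x x' \<Longrightarrow> adjacent G b y y' \<Longrightarrow>
     gauss_move G G'"
| Omega3:
    "arrows G = R \<union> {\<lparr>tail = (a, x), head = (b, y), arrow_sign = \<epsilon>\<rparr>,
                    \<lparr>tail = (a, x'), head = (c, z), arrow_sign = \<epsilon>\<rparr>,
                    \<lparr>tail = (b, y'), head = (c, z'), arrow_sign = \<epsilon>\<rparr>} \<Longrightarrow>
     arrows G' = R \<union> {\<lparr>tail = (b, y), head = (c, z), arrow_sign = \<epsilon>\<rparr>,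
                     \<lparr>tail = (a, x), head = (c, z'), arrow_sign = \<epsilon>\<rparr>,
                     \<lparr>tail = (a, x'), head = (b, y'), arrow_sign = \<epsilon>\<rparr>} \<Longrightarrow>
     label G' = label G \<Longrightarrow>
     \<lparr>tail = (a, x), head = (b, y), arrow_sign = \<epsilon>\<rparr> \<notin> R \<Longrightarrow>
     \<lparr>tail = (a, x'), head = (c, z), arrow_sign = \<epsilon>\<rparr> \<notin> R \<Longrightarrow>
     \<lparr>tail = (b, y'), head = (c, z'), arrow_sign = \<epsilon>\<rparr> \<notin> R \<Longrightarrow>
     distinct [a, b, c] \<Longrightarrow> x < x' \<Longrightarrow> y < y' \<Longrightarrow> z < z' \<Longrightarrow>
     adjacent G a x x' \<Longrightarrow> adjacent G b y y' \<Longrightarrow> adjacent G c z z' \<Longrightarrow>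
     gauss_move G G'"
| TC:
    "arrows G = R \<union> {\<lparr>tail = (a, x), head = h, arrow_sign = \<epsilon>\<rparr>,
                    \<lparr>tail = (a, x'), head = h', arrow_sign = \<epsilon>'\<rparr>} \<Longrightarrow>
     arrows G' = R \<union> {\<lparr>tail = (a, x'), head = h, arrow_sign = \<epsilon>\<rparr>,
                     \<lparr>tail = (a, x), head = h', arrow_sign = \<epsilon>'\<rparr>} \<Longrightarrow>
     label G' = label G \<Longrightarrow>
     \<lparr>tail = (a, x), head = h, arrow_sign = \<epsilon>\<rparr> \<notin> R \<Longrightarrow>
     \<lparr>tail = (a, x'), head = h', arrow_sign = \<epsilon>'\<rparr> \<notin> R \<Longrightarrow>
     distinct [a, fst h, fst h'] \<Longrightarrow> adjacent G a x x' \<Longrightarrow>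
     gauss_move G G'"

text \<open>
  Gauss diagrams are regarded up to reparametrization of the intervals.  All diagrams in a sequence
  of moves have to be braid Gauss diagrams.
\<close>

definition wReidemeister_step :: "nat \<Rightarrow> gauss_diagram rel" where
  "wReidemeister_step n = {(G, G') \<in> bGD n \<times> bGD n.
     (\<exists>\<phi>. reparametrization \<phi> \<and> G' = reparametrize \<phi> G) \<or> gauss_move G G'}"

definition wReidemeister_eq :: "nat \<Rightarrow> gauss_diagram rel" where
  "wReidemeister_eq n = (wReidemeister_step n \<union> (wReidemeister_step n)\<inverse>)\<^sup>*"

definition welded_gauss_class :: "nat \<Rightarrow> gauss_diagram \<Rightarrow> gauss_diagram set" where
  "welded_gauss_class n G = wReidemeister_eq n `` {G}"

text \<open>
  Concatenation glues the right extremity of the \<open>i\<close>-th interval of \<open>G\<close> to the left extremity of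
  the interval \<open>label G i\<close> of \<open>G'\<close>; the resulting intervals are rescaled to length one.
\<close>

definition concat_gauss :: "gauss_diagram \<Rightarrow> gauss_diagram \<Rightarrow> gauss_diagram" where
  "concat_gauss G G' = \<lparr>
     arrows = map_arrow (\<lambda>(i, x). (i, x / 2)) ` arrows G \<union>
              map_arrow (\<lambda>(j, x). (inv_into UNIV (label G) j, (1 + x) / 2)) ` arrows G',
     label = label G' \<circ> label G\<rparr>"

definition trivial_gauss :: gauss_diagram where
  "trivial_gauss = \<lparr>arrows = {}, label = id\<rparr>"

definition welded_gauss_group :: "nat \<Rightarrow> gauss_diagram set monoid" where
  "welded_gauss_group n = \<lparr>
     carrier = bGD n // wReidemeister_eq n,
     mult = (\<lambda>A B. wReidemeister_eq n `` {concat_gauss G G' | G G'. G \<in> A \<and> G' \<in> B}),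
     one = welded_gauss_class n trivial_gauss\<rparr>"


section \<open>The Gauss diagram of a strand diagram\<close>

text \<open>
  \<open>passes_over D k l x\<close>: at their common point above \<open>x\<close>, the strand \<open>k\<close> passes over the strand \<open>l\<close>.
  At a positive crossing \<open>\<sigma>\<^sub>i\<close> the strand arriving in position \<open>i + 1\<close> is the over strand, at a
  negative crossing it is the one arriving in position \<open>i\<close>.
\<close>

definition passes_over :: "strand_diagram \<Rightarrow> nat \<Rightarrow> nat \<Rightarrow> real \<Rightarrow> bool" where
  "passes_over D k l x \<longleftrightarrow> (case kind D (x, height D k x) of
     Positive \<Rightarrow> above_before D k l x | Negative \<Rightarrow> above_before D l k x | Welded \<Rightarrow> False)"

text \<open>
  The intervals are the strands, parametrized by the first coordinate; every classical crossing
  gives an arrow from the over strand to the under strand, welded crossings give no arrow.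
\<close>

definition gauss_of :: "nat \<Rightarrow> strand_diagram \<Rightarrow> gauss_diagram" where
  "gauss_of n D = \<lparr>
     arrows = {\<lparr>tail = (k, x), head = (l, x),
                 arrow_sign = (if kind D (x, height D k x) = Positive then 1 else -1)\<rparr> | k l x.
                 k \<in> {1..n} \<and> l \<in> {1..n} \<and> k \<noteq> l \<and> x \<in> {0..1} \<and>
                 height D k x = height D l x \<and> passes_over D k l x},
     label = (\<lambda>k. if k \<in> {1..n} then strand_end D k else k)\<rparr>"

end

(* Both groups embed into one group. Let W be the group presented by the letters, the local moves
   and the commutation of distant letters; Cayley's theorem turns it into an instance of the class
   group_add. By a Coxeter normal form, permutations embed into W through the letters Rho, and the
   conjugates of sigma_1 rho_1 by these permutations give one element of W for every ordered pair of
   strands. Hence a braid Gauss diagram has a value in W: multiply the elements of its arrows in an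
   order in which they can be drawn vertically, then the element of its permutation. The value does
   not depend on that order, and F1, R3 and the distant commutations, evaluated in W, are exactly
   the relations which make it invariant under TC, Omega3 and commutation of disjoint arrows.

   For a strand diagram the value of its Gauss diagram is the class of its word. A planar isotopy
   changes the Gauss diagram only by a reparametrization, since the arcs are monotone and two arcs
   exchange their relative position at each of their common points. Conversely, words with the
   same class come from equivalent strand diagrams and have equivalent Gauss diagrams. *)
theory Submission
  imports Defs
begin

section \<open>Words, their Gauss diagrams, and the value of a word\<close>

text \<open>Passing from strand diagrams to Gauss diagrams involves no choices, whereas the way back
  needs a vertical order of the arrows and a word for every arrow, none of them canonical.
  Evaluation in W turns independence of these choices into identities in a group. The element
  sigma_1 rho_1 has trivial permutation, so an arrow can be inserted without disturbing the strands,
  and it commutes with every permutation fixing 1 and 2, so its conjugates depend only on the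
  ordered pair of strands. M identifies sigma_i rho_i with the conjugate for the pair (i+1, i);
  therefore every word can be rewritten as arrow elements followed by a permutation. The delicate
  move is TC: arrows drawn between the two exchanged ones may meet the intervals of their heads, so
  a vertical order before the move does not simply become one after it. On the topological side only
  the final homeomorphism of an isotopy is examined. The effect of an isotopy on the word is never
  analysed, but the commutation of distant letters has to be produced by an explicit
  isotopy.\<close>

primrec letter_index :: "letter \<Rightarrow> nat" where
  "letter_index (Sigma i) = i"
| "letter_index (Sigma_inv i) = i"
| "letter_index (Rho i) = i"

definition valid_word :: "nat \<Rightarrow> letter list \<Rightarrow> bool" where
  "valid_word n w \<longleftrightarrow> (\<forall>l\<in>set w. 1 \<le> letter_index l \<and> letter_index l < n)"

lemma valid_word_simps [simp]:
  "valid_word n []"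
  "valid_word n (l # w) \<longleftrightarrow> 1 \<le> letter_index l \<and> letter_index l < n \<and> valid_word n w"
  "valid_word n (u @ v) \<longleftrightarrow> valid_word n u \<and> valid_word n v"
  by (auto simp: valid_word_def)

definition adj :: "nat \<Rightarrow> nat \<Rightarrow> nat" where
  "adj i = Transposition.transpose i (Suc i)"

lemma adj_apply: "adj i x = (if x = i then Suc i else if x = Suc i then i else x)"
  by (simp add: adj_def transpose_def)

lemma adj_adj [simp]: "adj i (adj i x) = x" "adj i \<circ> adj i = id"
  by (auto simp: adj_apply)

lemma bij_adj [simp]: "bij (adj i)"
  by (simp add: adj_def)

lemma inv_adj [simp]: "inv_into UNIV (adj i) = adj i"
  by (simp add: adj_def)

lemma adj_permutes: "1 \<le> i \<Longrightarrow> i < n \<Longrightarrow> adj i permutes {1..n}"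
  by (auto simp: adj_def intro!: permutes_swap_id)

text \<open>The strand in position \<open>k\<close> on the left ends in position \<open>end_pos w k\<close>.  Words are read from left to
  right, so \<open>end_pos\<close> reverses products.\<close>

primrec end_pos :: "letter list \<Rightarrow> nat \<Rightarrow> nat" where
  "end_pos [] = id"
| "end_pos (l # w) = end_pos w \<circ> adj (letter_index l)"

lemma end_pos_append [simp]: "end_pos (u @ v) = end_pos v \<circ> end_pos u"
  by (induction u) (auto simp: o_assoc)

lemma bij_end_pos [simp]: "bij (end_pos w)"
  by (induction w) (simp_all only: end_pos.simps bij_id bij_adj bij_comp)

lemma end_pos_permutes: "valid_word n w \<Longrightarrow> end_pos w permutes {1..n}"
proof (induction w)
  case (Cons l w)
  then show ?case
    by (simp only: end_pos.simps valid_word_simps permutes_compose adj_permutes)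
qed simp

definition relabel :: "(nat \<Rightarrow> nat) \<Rightarrow> (nat \<times> nat \<times> int) list \<Rightarrow> (nat \<times> nat \<times> int) list" where
  "relabel f = map (\<lambda>(a, b, e). (f a, f b, e))"

lemma relabel_simps [simp]:
  "relabel f [] = []"
  "relabel f ((a, b, e) # A) = (f a, f b, e) # relabel f A"
  "relabel f (A @ B) = relabel f A @ relabel f B"
  "relabel id A = A"
  "relabel (\<lambda>a. a) A = A"
  "relabel f (relabel g A) = relabel (f \<circ> g) A"
  by (auto simp: relabel_def)

text \<open>Triples (tail, head, sign) in terms of the positions just left of the crossing. The tail
  is the over strand: the upper one at a positive crossing, the lower one at a negative crossing, as
  in \<open>passes_over\<close>.\<close>

primrec letter_arrows :: "letter \<Rightarrow> (nat \<times> nat \<times> int) list" where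
  "letter_arrows (Sigma i) = [(Suc i, i, 1)]"
| "letter_arrows (Sigma_inv i) = [(i, Suc i, -1)]"
| "letter_arrows (Rho i) = []"

primrec word_arrows :: "letter list \<Rightarrow> (nat \<times> nat \<times> int) list" where
  "word_arrows [] = []"
| "word_arrows (l # w) = letter_arrows l @ relabel (adj (letter_index l)) (word_arrows w)"

text \<open>A cocycle rule: the arrows of \<open>v\<close> are named by positions at the left end of
  \<open>v\<close>, so each of them is traced back through the strands of \<open>u\<close> to its
  starting position.\<close>

lemma word_arrows_append:
  "word_arrows (u @ v) = word_arrows u @ relabel (inv_into UNIV (end_pos u)) (word_arrows v)"
proof (induction u)
  case Nil
  then show ?case by simp
next
  case (Cons l u)
  have "inv_into UNIV (end_pos (l # u)) = adj (letter_index l) \<circ> inv_into UNIV (end_pos u)"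
    by (simp add: o_inv_distrib)
  with Cons show ?case
    by (simp only: append_Cons word_arrows.simps relabel_simps append_assoc)
qed

definition arrow_types :: "nat \<Rightarrow> (nat \<times> nat \<times> int) set" where
  "arrow_types n = {(a, b, e). a \<in> {1..n} \<and> b \<in> {1..n} \<and> a \<noteq> b \<and> e \<in> {1, -1}}"

lemma relabel_arrow_types:
  "f permutes {1..n} \<Longrightarrow> set A \<subseteq> arrow_types n \<Longrightarrow> set (relabel f A) \<subseteq> arrow_types n"
  by (auto simp: relabel_def arrow_types_def permutes_in_image dest: permutes_inj[THEN injD]
       simp del: atLeastAtMost_iff)

lemma word_arrows_types: "valid_word n w \<Longrightarrow> set (word_arrows w) \<subseteq> arrow_types n"
proof (induction w)
  case (Cons l w)
  then have "set (relabel (adj (letter_index l)) (word_arrows w)) \<subseteq> arrow_types n"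
    by (intro relabel_arrow_types adj_permutes) auto
  with Cons.prems show ?case
    by (cases l) (auto simp: arrow_types_def)
qed simp

text \<open>These are not among the local moves: on diagrams the commutation comes from planar
  isotopy, which words cannot express. One order of the indices suffices, since the equivalence
  generated later contains the reversed steps.\<close>

inductive far_move :: "nat \<Rightarrow> letter list \<Rightarrow> letter list \<Rightarrow> bool" for n where
  "valid_word n [l, m] \<Longrightarrow> letter_index l + 2 \<le> letter_index m \<Longrightarrow> far_move n [l, m] [m, l]"

section \<open>Permutations as words in the letters \<open>Rho\<close>\<close>

abbreviation rho_pos :: "nat list \<Rightarrow> nat \<Rightarrow> nat" where
  "rho_pos is \<equiv> end_pos (map Rho is)"

text \<open>The strand in position \<open>j\<close> is carried up past its neighbours, each of which
  drops by one. These cycles are the coset representatives of the Coxeter normal form.\<close>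

lemma rho_pos_chain:
  "j \<le> k \<Longrightarrow> rho_pos [j..<k] x = (if x = j then k else if j < x \<and> x \<le> k then x - 1 else x)"
proof (induction k rule: dec_induct)
  case (step k)
  then show ?case by (auto simp: adj_apply)
qed auto

lemma rho_pos_rev: "rho_pos (rev is) \<circ> rho_pos is = id" "rho_pos is \<circ> rho_pos (rev is) = id"
proof -
  show *: "rho_pos (rev is) \<circ> rho_pos is = id" for "is"
  proof (induction "is")
    case (Cons i "is")
    then show ?case by (simp add: fun_eq_iff)
  qed simp
  from *[of "rev is"] show "rho_pos is \<circ> rho_pos (rev is) = id" by simp
qed

lemma rho_pos_permutes: "set is \<subseteq> {j..<n} \<Longrightarrow> rho_pos is permutes {j..n}"
proof (induction "is")
  case (Cons i "is")
  then have "adj i permutes {j..n}" by (auto simp: adj_def intro!: permutes_swap_id)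
  moreover have "rho_pos is permutes {j..n}" using Cons by simp
  ultimately show ?case
    by (simp only: list.map end_pos.simps letter_index.simps permutes_compose)
qed simp

text \<open>The chain \<open>j, \<dots>, p j - 1\<close> moves \<open>j\<close> to \<open>p j\<close>, so what remains of \<open>p\<close> fixes \<open>j\<close>.\<close>

lemma permutes_rho_pos:
  "p permutes {j..n} \<Longrightarrow> \<exists>is. set is \<subseteq> {j..<n} \<and> rho_pos is = p"
proof (induction "n - j" arbitrary: j p)
  case 0
  then have "{j..n} = {} \<or> {j..n} = {j}" by auto
  then have "p = id" using 0 permutes_sing[of p j] permutes_empty[of p] by metis
  then show ?case by (intro exI[of _ "[]"]) simp
next
  case (Suc d)
  let ?k = "p j"
  have k: "j \<le> ?k" "?k \<le> n"
    using permutes_in_image[OF Suc.prems, of j] Suc.hyps(2) by auto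
  let ?c = "rho_pos [j..<?k]"
  define q where "q = inv_into UNIV ?c \<circ> p"
  have c: "?c permutes {j..n}" using k by (intro rho_pos_permutes) auto
  have q: "q permutes {j..n}"
    unfolding q_def by (intro permutes_compose Suc.prems permutes_inv c)
  have qj: "q j = j"
    unfolding q_def using k rho_pos_chain[of j ?k j]
    by (metis c comp_apply permutes_inv_eq)
  have "q permutes {Suc j..n}"
  proof (rule permutes_superset[OF q])
    fix x assume "x \<in> {j..n} - {Suc j..n}"
    then have "x = j" by auto
    with qj show "q x = x" by simp
  qed
  moreover have "d = n - Suc j" using Suc.hyps(2) by simp
  ultimately obtain "is" where "is": "set is \<subseteq> {Suc j..<n}" "rho_pos is = q"
    using Suc.hyps(1) by blast
  have "rho_pos (is @ [j..<?k]) = ?c \<circ> q" using "is" by simp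
  also have "\<dots> = p" unfolding q_def using permutes_inv_o(1)[OF c] by (simp add: o_assoc)
  finally show ?case using "is" k by (intro exI[of _ "is @ [j..<?k]"]) auto
qed

text \<open>The Gauss moves seen on a list of arrows in vertical order: \<open>cancel\<close> is
  Omega2, \<open>tails\<close> is TC, \<open>triangle\<close> is Omega3. In contrast,
  \<open>comm\<close> leaves the Gauss diagram alone and only changes the order in which its arrows
  are drawn.\<close>

inductive arrow_move ::
  "nat \<Rightarrow> (nat \<times> nat \<times> int) list \<Rightarrow> (nat \<times> nat \<times> int) list \<Rightarrow> bool" for n where
  cancel: "(a, b, e) \<in> arrow_types n \<Longrightarrow> arrow_move n [(a, b, e), (a, b, - e)] []"
| comm: "(a, b, e) \<in> arrow_types n \<Longrightarrow> (c, d, f) \<in> arrow_types n \<Longrightarrow> {a, b} \<inter> {c, d} = {} \<Longrightarrow>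
    arrow_move n [(a, b, e), (c, d, f)] [(c, d, f), (a, b, e)]"
| tails: "(a, b, e) \<in> arrow_types n \<Longrightarrow> (a, c, f) \<in> arrow_types n \<Longrightarrow> b \<noteq> c \<Longrightarrow>
    arrow_move n [(a, b, e), (a, c, f)] [(a, c, f), (a, b, e)]"
| triangle: "(a, b, e) \<in> arrow_types n \<Longrightarrow> (a, c, e) \<in> arrow_types n \<Longrightarrow> b \<noteq> c \<Longrightarrow>
    arrow_move n [(a, b, e), (a, c, e), (b, c, e)] [(b, c, e), (a, c, e), (a, b, e)]"

text \<open>By induction: a permutation that is right on the earlier entries is followed by the
  transposition of \<open>p x\<close> and \<open>y\<close>, which leaves the earlier values alone
  because they avoid both.\<close>

lemma ex_permutes_map:
  assumes "length xs = length ys" "distinct xs" "distinct ys" "set xs \<subseteq> S" "set ys \<subseteq> S"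
  shows "\<exists>p. p permutes S \<and> map p xs = ys"
  using assms
proof (induction xs ys rule: rev_induct2)
  case (4 x xs y ys)
  then obtain p where p: "p permutes S" "map p xs = ys" by auto
  define q where "q = Transposition.transpose (p x) y \<circ> p"
  have "p x \<notin> set ys"
    using p 4 by (auto simp: permutes_inj[THEN inj_eq])
  then have "map (Transposition.transpose (p x) y) ys = ys"
    using 4 by (intro map_idI transpose_apply_other) auto
  then have "map q xs = ys"
    unfolding q_def using p(2) by (simp flip: map_map)
  moreover have "q x = y" by (simp add: q_def)
  moreover have "q permutes S"
    unfolding q_def using 4 p by (intro permutes_compose permutes_swap_id) (auto simp: permutes_in_image)
  ultimately show ?case by (intro exI[of _ q]) simp
qed (auto intro: permutes_id)

text \<open>Additive notation because \<open>group_add\<close> is a type class of groups that need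
  not be commutative. Only the relations are assumed here; that nothing else collapses is added in
  \<open>faithful_representation\<close>.\<close>

locale welded_representation =
  fixes n :: nat and gen :: "letter \<Rightarrow> 'g::group_add"
  assumes local_move_val: "local_move n u v \<Longrightarrow> sum_list (map gen u) = sum_list (map gen v)"
    and far_move_val: "far_move n u v \<Longrightarrow> sum_list (map gen u) = sum_list (map gen v)"
begin

abbreviation val :: "letter list \<Rightarrow> 'g" where
  "val w \<equiv> sum_list (map gen w)"

abbreviation r :: "nat \<Rightarrow> 'g" where
  "r i \<equiv> gen (Rho i)"

abbreviation rho_val :: "nat list \<Rightarrow> 'g" where
  "rho_val is \<equiv> sum_list (map r is)"

section \<open>Coxeter normal form for the letters \<open>Rho\<close>\<close>

lemma r_r: "1 \<le> i \<Longrightarrow> i < n \<Longrightarrow> r i + r i = 0"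
  using local_move_val[OF V2] by simp

lemma minus_r: "1 \<le> i \<Longrightarrow> i < n \<Longrightarrow> - r i = r i"
  using r_r minus_unique by blast

lemma r_braid: "1 \<le> i \<Longrightarrow> Suc i < n \<Longrightarrow> r i + (r (Suc i) + r i) = r (Suc i) + (r i + r (Suc i))"
  using local_move_val[OF V3] by simp

lemma gen_far: 
  assumes "1 \<le> letter_index l" "letter_index l < n" "1 \<le> letter_index m" "letter_index m < n"
    "letter_index l + 2 \<le> letter_index m \<or> letter_index m + 2 \<le> letter_index l"
  shows "gen l + gen m = gen m + gen l"
  using assms far_move_val[OF far_move.intros, of l m] far_move_val[OF far_move.intros, of m l] by auto

lemma gen_Sigma_inv: "1 \<le> i \<Longrightarrow> i < n \<Longrightarrow> gen (Sigma_inv i) = - gen (Sigma i)"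
  using local_move_val[OF R2_left, of i] by (simp add: minus_unique)

lemma commute_sum_list:
  assumes "\<And>y. y \<in> set ys \<Longrightarrow> x + y = y + (x::'g)"
  shows "x + sum_list ys = sum_list ys + x"
  using assms
proof (induction ys)
  case (Cons y ys)
  then have "x + sum_list ys = sum_list ys + x" "x + y = y + x" by auto
  then show ?case by (simp flip: add.assoc) (simp add: add.assoc)
qed simp

text \<open>The letter \<open>r i\<close> commutes with the end of the chain beyond
  \<open>Suc i\<close>, the braid relation with the pair \<open>i\<close>, \<open>Suc i\<close>
  turns it into \<open>r (Suc i)\<close>, and this commutes with the part of the chain before
  \<open>i\<close>.\<close>

lemma chain_right:
  assumes "1 \<le> j" "j \<le> i" "Suc i < k" "k \<le> n"
  shows "rho_val [j..<k] + r i = r (Suc i) + rho_val [j..<k]"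
proof -
  have split: "[j..<k] = [j..<i] @ [i, Suc i] @ [Suc (Suc i)..<k]"
    using assms upt_add_eq_append[of j i "k - i"] by (simp add: upt_conv_Cons)
  have a: "r i + rho_val [Suc (Suc i)..<k] = rho_val [Suc (Suc i)..<k] + r i"
    using assms by (intro commute_sum_list) (auto intro!: gen_far)
  have b: "r (Suc i) + rho_val [j..<i] = rho_val [j..<i] + r (Suc i)"
    using assms by (intro commute_sum_list) (auto intro!: gen_far)
  have "rho_val [j..<k] + r i = rho_val [j..<i] + (r i + (r (Suc i) + (rho_val [Suc (Suc i)..<k] + r i)))"
    unfolding split by (simp add: add.assoc)
  also have "\<dots> = rho_val [j..<i] + ((r i + (r (Suc i) + r i)) + rho_val [Suc (Suc i)..<k])"
    unfolding a[symmetric] by (simp add: add.assoc)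
  also have "\<dots> = (rho_val [j..<i] + r (Suc i)) + (r i + (r (Suc i) + rho_val [Suc (Suc i)..<k]))"
    using assms by (subst r_braid) (auto simp: add.assoc)
  also have "\<dots> = r (Suc i) + rho_val [j..<k]"
    unfolding split b[symmetric] by (simp add: add.assoc)
  finally show ?thesis .
qed

text \<open>Induction on the word. A further letter \<open>r i\<close> lengthens the chain
  (\<open>i = k\<close>), cancels its last letter (\<open>Suc i = k\<close>), commutes with it
  (\<open>k < i\<close>), or passes through it as \<open>r (Suc i)\<close>; in the last two cases it
  joins \<open>js\<close>. Positions are followed in parallel, so the same \<open>js\<close> and
  \<open>k\<close> describe both the value and the permutation.\<close>

lemma rho_normal_form:
  assumes "1 \<le> j" "j < n" "set is \<subseteq> {j..<n}"
  shows "\<exists>js k. set js \<subseteq> {Suc j..<n} \<and> j \<le> k \<and> k \<le> n \<and>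
    rho_val is = rho_val js + rho_val [j..<k] \<and> rho_pos is = rho_pos (js @ [j..<k])"
  using assms(3)
proof (induction "is" rule: rev_induct)
  case Nil
  show ?case using assms by (intro exI[of _ "[]"] exI[of _ j]) auto
next
  case (snoc i "is")
  then obtain js k where IH: "set js \<subseteq> {Suc j..<n}" "j \<le> k" "k \<le> n"
    "rho_val is = rho_val js + rho_val [j..<k]" "rho_pos is = rho_pos (js @ [j..<k])"
    by (auto simp del: end_pos_append map_append)
  have i: "j \<le> i" "i < n" using snoc.prems by auto
  consider "i = k" | "Suc i = k" | "k < i" | "Suc i < k" by linarith
  then show ?case
  proof cases
    case 1
    then show ?thesis using IH i
      by (intro exI[of _ js] exI[of _ "Suc k"]) (auto simp: o_assoc add.assoc)
  next
    case 2
    then have k: "[j..<k] = [j..<i] @ [i]" using i by auto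
    show ?thesis
      by (intro exI[of _ js] exI[of _ i]) (use IH i k assms in \<open>auto simp: add.assoc r_r o_assoc\<close>)
  next
    case 3
    have "r i + rho_val [j..<k] = rho_val [j..<k] + r i"
      using assms i 3 by (intro commute_sum_list) (auto intro!: gen_far)
    moreover have "adj i \<circ> rho_pos [j..<k] = rho_pos [j..<k] \<circ> adj i"
      using 3 IH(2) i by (auto simp: fun_eq_iff rho_pos_chain adj_apply)
    ultimately show ?thesis using IH i 3
      by (intro exI[of _ "js @ [i]"] exI[of _ k]) (auto simp: add.assoc o_assoc)
  next
    case 4
    have "rho_val [j..<k] + r i = r (Suc i) + rho_val [j..<k]"
      using assms i 4 IH by (intro chain_right) auto
    moreover have "adj i \<circ> rho_pos [j..<k] = rho_pos [j..<k] \<circ> adj (Suc i)"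
      using 4 IH(2) i by (auto simp: fun_eq_iff rho_pos_chain adj_apply)
    ultimately show ?thesis using IH i 4
      by (intro exI[of _ "js @ [Suc i]"] exI[of _ k]) (auto simp: add.assoc o_assoc)
  qed
qed

text \<open>The letters of \<open>js\<close> only move positions above \<open>j\<close>, so the
  chain alone decides where \<open>j\<close> goes; if \<open>j\<close> stays, the chain is
  empty.\<close>

lemma rho_peel:
  assumes "1 \<le> j" "set is \<subseteq> {j..<n}" "rho_pos is j = j"
  obtains js where "set js \<subseteq> {Suc j..<n}" "rho_val is = rho_val js" "rho_pos is = rho_pos js"
proof (cases "j < n")
  case True
  from rho_normal_form[OF assms(1) True assms(2)] obtain js k where
    js: "set js \<subseteq> {Suc j..<n}" "j \<le> k" "rho_val is = rho_val js + rho_val [j..<k]"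
     "rho_pos is = rho_pos (js @ [j..<k])" by auto
  have "rho_pos js j = j" by (rule permutes_not_in[OF rho_pos_permutes[OF js(1)]]) simp
  with js assms(3) have "k = j" by (auto simp: rho_pos_chain)
  with js that show ?thesis by simp
next
  case False
  with assms have "is = []" by (cases "is") auto
  with that[of "[]"] show ?thesis by simp
qed

text \<open>Peeling off the lowest strand again and again leaves the empty word. Thus V2, V3 and
  distant commutation already account for all relations between words of letters \<open>Rho\<close>,
  which makes \<open>perm_val\<close> well defined.\<close>

lemma rho_pos_id_imp:
  assumes "1 \<le> j" "set is \<subseteq> {j..<n}" "rho_pos is = id"
  shows "rho_val is = 0"
  using assms
proof (induction "n - j" arbitrary: j "is")
  case 0
  then have "is = []" by (cases "is") auto
  then show ?case by simp
next
  case (Suc d)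
  then have "rho_pos is j = j" by simp
  then obtain js where "set js \<subseteq> {Suc j..<n}" "rho_val is = rho_val js" "rho_pos is = rho_pos js"
    by (rule rho_peel[OF Suc.prems(1,2)])
  with Suc.hyps(1)[of "Suc j" js] Suc.hyps(2) Suc.prems show ?case by auto
qed

lemma rho_val_rev: "set is \<subseteq> {1..<n} \<Longrightarrow> rho_val (rev is) = - rho_val is"
  by (induction "is") (auto simp: minus_add minus_r)

lemma rho_pos_eq_imp:
  assumes "set is \<subseteq> {1..<n}" "set js \<subseteq> {1..<n}" "rho_pos is = rho_pos js"
  shows "rho_val is = rho_val js"
proof -
  have "rho_val (is @ rev js) = 0"
    using assms by (intro rho_pos_id_imp[of 1]) (auto simp: rho_pos_rev)
  then show ?thesis using assms rho_val_rev[of js] by simp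
qed

definition perm_val :: "(nat \<Rightarrow> nat) \<Rightarrow> 'g" where
  "perm_val p = rho_val (SOME is. set is \<subseteq> {1..<n} \<and> rho_pos is = p)"

lemma perm_val_rho_pos: "set is \<subseteq> {1..<n} \<Longrightarrow> perm_val (rho_pos is) = rho_val is"
  unfolding perm_val_def by (rule someI2[of _ "is"]) (auto intro!: rho_pos_eq_imp simp del: One_nat_def)

text \<open>An antihomomorphism in appearance only: words are read from left to right, while
  \<open>q \<circ> p\<close> applies \<open>p\<close> first.\<close>

lemma perm_val_comp:
  assumes "p permutes {1..n}" "q permutes {1..n}"
  shows "perm_val (q \<circ> p) = perm_val p + perm_val q"
proof -
  obtain "is" js where "is": "set is \<subseteq> {1..<n}" "rho_pos is = p" "set js \<subseteq> {1..<n}" "rho_pos js = q"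
    using permutes_rho_pos assms by meson
  have "perm_val (rho_pos (is @ js)) = rho_val (is @ js)"
    using "is" by (intro perm_val_rho_pos) auto
  then show ?thesis using "is" perm_val_rho_pos by auto
qed

lemma perm_val_id [simp]: "perm_val id = 0"
  using perm_val_rho_pos[of "[]"] by simp

lemma perm_val_inv: 
  assumes "p permutes {1..n}" shows "perm_val (inv_into UNIV p) = - perm_val p"
proof -
  have "perm_val (inv_into UNIV p \<circ> p) = perm_val p + perm_val (inv_into UNIV p)"
    by (intro perm_val_comp permutes_inv assms)
  then have "perm_val p + perm_val (inv_into UNIV p) = 0"
    using permutes_inv_o(2)[OF assms] by (simp only: perm_val_id)
  then show ?thesis by (simp add: minus_unique)
qed

lemma perm_val_adj: "1 \<le> i \<Longrightarrow> i < n \<Longrightarrow> perm_val (adj i) = r i"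
  using perm_val_rho_pos[of "[i]"] by simp


section \<open>One group element for every ordered pair of strands\<close>

lemma conj_add: "(p + q) + x - (p + q) = p + (q + x - q) - (p :: 'g)"
  by (simp add: diff_conv_add_uminus minus_add add.assoc del: add_uminus_conv_diff)

text \<open>A conjugate of a pure element, as both letters exchange the two lowest strands. The tail
  \<open>a\<close> goes to position 2 because in \<open>Sigma 1\<close> the strand in position 2
  passes over the one in position 1.\<close>

definition arrow_gen :: "nat \<Rightarrow> nat \<Rightarrow> 'g" where
  "arrow_gen a b = (let p = SOME p. p permutes {1..n} \<and> p a = 2 \<and> p b = 1 in
     perm_val p + (gen (Sigma 1) + r 1) - perm_val p)"

text \<open>A permutation fixing 1 and 2 is a word in letters \<open>Rho i\<close> with
  \<open>i \<ge> 3\<close>, and all of these are distant from \<open>Sigma 1\<close> and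
  \<open>Rho 1\<close>.\<close>

lemma perm_val_commute:
  assumes q: "q permutes {1..n}" and fix12: "q 1 = 1" "q 2 = 2"
  shows "(gen (Sigma 1) + r 1) + perm_val q = perm_val q + (gen (Sigma 1) + r 1)"
proof -
  have "q permutes {3..n}"
  proof (rule permutes_superset[OF q])
    fix x assume "x \<in> {1..n} - {3..n}"
    then have "x = 1 \<or> x = 2" by auto
    with fix12 show "q x = x" by auto
  qed
  then obtain "is" where "is": "set is \<subseteq> {3..<n}" "rho_pos is = q"
    using permutes_rho_pos by blast
  have "(gen (Sigma 1) + r 1) + rho_val is = rho_val is + (gen (Sigma 1) + r 1)"
  proof (rule commute_sum_list, clarsimp)
    fix i assume "i \<in> set is"
    with "is" have i: "3 \<le> i" "i < n" by auto
    have "gen (Sigma 1) + r i = r i + gen (Sigma 1)" "r 1 + r i = r i + r 1"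
      using i by (auto intro!: gen_far)
    then show "gen (Sigma (Suc 0)) + r (Suc 0) + r i = r i + (gen (Sigma (Suc 0)) + r (Suc 0))"
      by (metis One_nat_def add.assoc)
  qed
  moreover have "perm_val q = rho_val is"
    using perm_val_rho_pos[of "is"] "is" by fastforce
  ultimately show ?thesis by simp
qed

text \<open>Two admissible permutations differ by \<open>q\<close>, which fixes 1 and 2 and so
  commutes with the element being conjugated. Hence any convenient \<open>p\<close> computes
  \<open>arrow_gen a b\<close>.\<close>

lemma arrow_gen_eq:
  assumes p: "p permutes {1..n}" "p a = 2" "p b = 1"
  shows "arrow_gen a b = perm_val p + (gen (Sigma 1) + r 1) - perm_val p"
proof -
  let ?x = "gen (Sigma 1) + r 1"
  define p' where "p' = (SOME p. p permutes {1..n} \<and> p a = 2 \<and> p b = 1)"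
  have p': "p' permutes {1..n}" "p' a = 2" "p' b = 1"
    unfolding p'_def using someI[of "\<lambda>p. p permutes {1..n} \<and> p a = 2 \<and> p b = 1" p] p by auto
  define q where "q = p' \<circ> inv_into UNIV p"
  have q: "q permutes {1..n}"
    unfolding q_def by (intro permutes_compose permutes_inv p p')
  have inv: "inv_into UNIV p 1 = b" "inv_into UNIV p 2 = a"
    using p permutes_inv_eq[OF p(1)] by metis+
  have "?x + perm_val q = perm_val q + ?x"
    by (rule perm_val_commute[OF q]) (simp_all only: q_def comp_apply inv p')
  then have "perm_val q + ?x - perm_val q = ?x"
    by (metis add_diff_cancel)
  moreover have "perm_val p' = perm_val p + perm_val q"
    unfolding q_def by (simp only: perm_val_comp permutes_inv perm_val_inv p p' add_minus_cancel)
  ultimately show ?thesis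
    unfolding arrow_gen_def Let_def p'_def[symmetric]
    by (simp only: conj_add)
qed

text \<open>If \<open>q\<close> brings \<open>p a\<close>, \<open>p b\<close> to the positions 2, 1,
  then \<open>q \<circ> p\<close> does the same for \<open>a\<close>, \<open>b\<close>, and the two
  conjugations compose.\<close>

lemma arrow_gen_conj:
  assumes p: "p permutes {1..n}" and ab: "a \<in> {1..n}" "b \<in> {1..n}" "a \<noteq> b"
  shows "perm_val p + arrow_gen (p a) (p b) - perm_val p = arrow_gen a b"
proof -
  have "p a \<noteq> p b" using ab p by (metis permutes_inverses(2))
  have "2 \<le> n" using ab by auto
  have "p a \<in> {1..n}" "p b \<in> {1..n}" using ab p permutes_in_image by metis+
  then obtain q where q: "q permutes {1..n}" "map q [p a, p b] = [2, 1]"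
    using ex_permutes_map[of "[p a, p b]" "[2, 1]" "{1..n}"] \<open>p a \<noteq> p b\<close> \<open>2 \<le> n\<close> by auto
  have "arrow_gen a b = perm_val (q \<circ> p) + (gen (Sigma 1) + r 1) - perm_val (q \<circ> p)"
    using q by (intro arrow_gen_eq permutes_compose p) auto
  moreover have "arrow_gen (p a) (p b) = perm_val q + (gen (Sigma 1) + r 1) - perm_val q"
    using q by (intro arrow_gen_eq) auto
  moreover have "perm_val (q \<circ> p) = perm_val p + perm_val q"
    using p q by (intro perm_val_comp) auto
  ultimately show ?thesis by (simp only: conj_add)
qed

text \<open>Induction along the strands: M conjugates \<open>Sigma (Suc i)\<close> into
  \<open>Sigma i\<close> by \<open>Rho (Suc i)\<close>, \<open>Rho i\<close>, and V3 does the same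
  for the accompanying letter \<open>Rho\<close>.\<close>

lemma arrow_gen_Suc: "1 \<le> i \<Longrightarrow> i < n \<Longrightarrow> arrow_gen (Suc i) i = gen (Sigma i) + r i"
proof (induction i rule: dec_induct)
  case base
  show ?case using arrow_gen_eq[of id "Suc 1" 1] by (simp add: numeral_2_eq_2)
next
  case (step i)
  let ?s = "r (Suc i)" and ?t = "r i"
  have i: "1 \<le> i" "i < n" "Suc i < n" using step by auto
  have p: "rho_pos [Suc i, i] permutes {1..n}"
    using i by (intro end_pos_permutes) auto
  have c: "perm_val (rho_pos [Suc i, i]) = ?s + ?t"
    using i by (subst perm_val_rho_pos) auto
  have "(?s + ?t) + arrow_gen (Suc (Suc i)) (Suc i) - (?s + ?t) = arrow_gen (Suc i) i"
    using arrow_gen_conj[OF p, of "Suc i" i] i c by (simp add: adj_apply)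
  also have "\<dots> = gen (Sigma i) + ?t" using step by simp
  also have "gen (Sigma i) + ?t = (?s + ?t) + (gen (Sigma (Suc i)) + ?s) - (?s + ?t)"
  proof -
    have m: "?s + (?t + gen (Sigma (Suc i))) = gen (Sigma i) + (?s + ?t)"
      using local_move_val[OF M, of i] i by simp
    have "(?s + ?t) + (gen (Sigma (Suc i)) + ?s) = (gen (Sigma i) + (?s + ?t)) + ?s"
      unfolding m[symmetric] by (simp add: add.assoc)
    also have "\<dots> = gen (Sigma i) + (?s + (?t + ?s))" by (simp add: add.assoc)
    also have "\<dots> = (gen (Sigma i) + ?t) + (?s + ?t)"
      using r_braid[of i] i by (simp add: add.assoc)
    finally show ?thesis by simp
  qed
  finally show ?case by (metis diff_add_cancel add_left_cancel)
qed

section \<open>The value of a list of arrows, and the relations between arrow elements\<close>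

definition arrow_val :: "nat \<times> nat \<times> int \<Rightarrow> 'g" where
  "arrow_val = (\<lambda>(a, b, e). if e = 1 then arrow_gen a b else - arrow_gen a b)"

abbreviation arrows_val :: "(nat \<times> nat \<times> int) list \<Rightarrow> 'g" where
  "arrows_val A \<equiv> sum_list (map arrow_val A)"

text \<open>Conjugation by the value of a permutation permutes the arrow elements and their
  inverses, as in a semidirect product.\<close>

lemma arrows_val_relabel:
  assumes "p permutes {1..n}" "set A \<subseteq> arrow_types n"
  shows "perm_val p + arrows_val (relabel p A) = arrows_val A + perm_val p"
  using assms(2)
proof (induction A)
  case (Cons t A)
  obtain a b e where t: "t = (a, b, e)" by (cases t)
  with Cons.prems have ab: "a \<in> {1..n}" "b \<in> {1..n}" "a \<noteq> b" by (auto simp: arrow_types_def)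
  have g: "perm_val p + arrow_gen (p a) (p b) = arrow_gen a b + perm_val p"
    using arrow_gen_conj[OF assms(1) ab] by (simp add: diff_eq_eq)
  have "perm_val p + arrow_val (p a, p b, e) = arrow_val (a, b, e) + perm_val p"
  proof (cases "e = 1")
    case True
    with g show ?thesis by (simp add: arrow_val_def)
  next
    case False
    have "perm_val p - arrow_gen (p a) (p b) = - arrow_gen a b + perm_val p"
      using g by (metis (no_types) add.assoc add_diff_cancel minus_add_cancel)
    with False show ?thesis by (simp add: arrow_val_def)
  qed
  with Cons t show ?case by (simp flip: add.assoc) (simp add: add.assoc)
qed (simp add: arrow_val_def)

text \<open>Every letter is the value of its arrows followed by \<open>r i\<close>; the permutation
  parts are then pushed to the right with \<open>arrows_val_relabel\<close>.\<close>

lemma val_eq: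
  "valid_word n w \<Longrightarrow> val w = arrows_val (word_arrows w) + perm_val (end_pos w)"
proof (induction w)
  case (Cons l w)
  let ?i = "letter_index l"
  have i: "1 \<le> ?i" "?i < n" and w: "valid_word n w" using Cons.prems by auto
  have pl: "adj ?i permutes {1..n}" using i by (rule adj_permutes)
  have l: "gen l = arrows_val (letter_arrows l) + r ?i"
  proof (cases l)
    case (Sigma i)
    with i show ?thesis by (simp add: arrow_val_def arrow_gen_Suc add.assoc r_r)
  next
    case (Sigma_inv j)
    \<comment> \<open>A negative crossing has its tail in the lower position, whose element is
      \<open>r j + gen (Sigma j)\<close> instead of \<open>gen (Sigma j) + r j\<close>. The inverse
      of the former, followed by \<open>r j\<close>, is the inverse of
      \<open>gen (Sigma j)\<close>.\<close>
    have "r j + arrow_gen (Suc j) j = arrow_gen j (Suc j) + r j"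
      using arrow_gen_conj[OF pl, of j "Suc j"] i Sigma_inv
      by (simp add: perm_val_adj adj_apply diff_eq_eq)
    then have "arrow_gen j (Suc j) = r j + gen (Sigma j)"
      using i Sigma_inv arrow_gen_Suc[of j] by (metis add.assoc add_right_cancel letter_index.simps(2))
    with i Sigma_inv show ?thesis
      by (simp add: arrow_val_def gen_Sigma_inv minus_add minus_r add.assoc r_r)
  qed simp
  have "set (word_arrows w) \<subseteq> arrow_types n" by (rule word_arrows_types[OF w])
  from relabel_arrow_types[OF pl this] have
    "perm_val (adj ?i) + arrows_val (relabel (adj ?i) (relabel (adj ?i) (word_arrows w))) =
      arrows_val (relabel (adj ?i) (word_arrows w)) + perm_val (adj ?i)"
    by (intro arrows_val_relabel[OF pl])
  then have rel: "r ?i + arrows_val (word_arrows w) = arrows_val (relabel (adj ?i) (word_arrows w)) + r ?i"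
    using i by (simp add: perm_val_adj)
  have "val (l # w) = arrows_val (letter_arrows l) + (r ?i + arrows_val (word_arrows w)) + perm_val (end_pos w)"
    using Cons w l by (simp add: add.assoc)
  also have "\<dots> = arrows_val (word_arrows (l # w)) + (perm_val (adj ?i) + perm_val (end_pos w))"
    unfolding rel using i by (simp add: add.assoc perm_val_adj)
  also have "perm_val (adj ?i) + perm_val (end_pos w) = perm_val (end_pos (l # w))"
    using perm_val_comp[OF pl end_pos_permutes[OF w]] by simp
  finally show ?case .
qed simp

text \<open>Both words have the same value and the same permutation part; cancelling the latter in
  \<open>val_eq\<close> leaves a relation between arrow elements.\<close>

lemma arrows_val_word:
  assumes "local_move n u v \<or> far_move n u v" "valid_word n u" "valid_word n v" "end_pos u = end_pos v"
  shows "arrows_val (word_arrows u) = arrows_val (word_arrows v)"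
  using assms val_eq[of u] val_eq[of v] local_move_val far_move_val by (metis add_right_cancel)

text \<open>Relabelling is conjugation, so a relation checked on the lowest strands holds for all
  strands that can be carried there.\<close>

lemma arrows_val_transfer:
  assumes "p permutes {1..n}" "set A \<subseteq> arrow_types n" "set B \<subseteq> arrow_types n"
    "arrows_val (relabel p A) = arrows_val (relabel p B)"
  shows "arrows_val A = arrows_val B"
  using assms arrows_val_relabel by (metis add_right_cancel)

lemma arrow_gen_commute:
  assumes "distinct [a, b, c, d]" "{a, b, c, d} \<subseteq> {1..n}"
  shows "arrow_gen a b + arrow_gen c d = arrow_gen c d + arrow_gen a b"
proof -
  have n: "4 \<le> n" using card_mono[OF _ assms(2)] assms(1) by simp
  then obtain p where p: "p permutes {1..n}" "map p [a, b, c, d] = [2, 1, 4, 3]"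
    using ex_permutes_map[of "[a, b, c, d]" "[2, 1, 4, 3]" "{1..n}"] assms by auto
  have "far_move n [Sigma 1, Sigma 3] [Sigma 3, Sigma 1]"
    using n by (intro far_move.intros) auto
  then have "arrows_val (word_arrows [Sigma 1, Sigma 3]) = arrows_val (word_arrows [Sigma 3, Sigma 1])"
    using n by (intro arrows_val_word) (auto simp: fun_eq_iff adj_apply)
  then have "arrows_val (relabel p [(a, b, 1), (c, d, 1)]) = arrows_val (relabel p [(c, d, 1), (a, b, 1)])"
    using p(2) by (simp add: adj_apply eval_nat_numeral)
  from arrows_val_transfer[OF p(1) _ _ this] assms show ?thesis
    by (auto simp: arrow_types_def arrow_val_def)
qed

text \<open>In both words of F1 the strand starting in position 3 passes over those starting in
  positions 2 and 1: in this order in one word, in the opposite order in the other.\<close>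

lemma arrow_gen_TC:
  assumes "distinct [a, b, c]" "{a, b, c} \<subseteq> {1..n}"
  shows "arrow_gen a b + arrow_gen a c = arrow_gen a c + arrow_gen a b"
proof -
  have n: "3 \<le> n" using card_mono[OF _ assms(2)] assms(1) by simp
  then obtain p where p: "p permutes {1..n}" "map p [a, b, c] = [3, 2, 1]"
    using ex_permutes_map[of "[a, b, c]" "[3, 2, 1]" "{1..n}"] assms by auto
  have "local_move n [Sigma (1 + 1), Sigma 1, Rho (1 + 1)] [Rho 1, Sigma (1 + 1), Sigma 1]"
    using n by (intro local_move.F1) auto
  then have "arrows_val (word_arrows [Sigma 2, Sigma 1, Rho 2]) = arrows_val (word_arrows [Rho 1, Sigma 2, Sigma 1])"
    unfolding one_add_one using n by (intro arrows_val_word) (auto simp: fun_eq_iff adj_apply)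
  then have "arrows_val (relabel p [(a, b, 1), (a, c, 1)]) = arrows_val (relabel p [(a, c, 1), (a, b, 1)])"
    using p(2) by (simp add: adj_apply eval_nat_numeral)
  from arrows_val_transfer[OF p(1) _ _ this] assms show ?thesis
    by (auto simp: arrow_types_def arrow_val_def)
qed

text \<open>With \<open>a\<close>, \<open>b\<close>, \<open>c\<close> carried to positions 3, 2, 1,
  the left word of R3 has the arrows \<open>(b, c)\<close>, \<open>(a, c)\<close>,
  \<open>(a, b)\<close> and the right word has them in reverse.\<close>

lemma arrow_gen_Omega3:
  assumes "distinct [a, b, c]" "{a, b, c} \<subseteq> {1..n}"
  shows "arrow_gen a b + (arrow_gen a c + arrow_gen b c) = arrow_gen b c + (arrow_gen a c + arrow_gen a b)"
proof -
  have n: "3 \<le> n" using card_mono[OF _ assms(2)] assms(1) by simp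
  then obtain p where p: "p permutes {1..n}" "map p [a, b, c] = [3, 2, 1]"
    using ex_permutes_map[of "[a, b, c]" "[3, 2, 1]" "{1..n}"] assms by auto
  have "local_move n [Sigma 1, Sigma (1 + 1), Sigma 1] [Sigma (1 + 1), Sigma 1, Sigma (1 + 1)]"
    using n by (intro local_move.R3) auto
  then have "arrows_val (word_arrows [Sigma 1, Sigma 2, Sigma 1]) = arrows_val (word_arrows [Sigma 2, Sigma 1, Sigma 2])"
    unfolding one_add_one using n by (intro arrows_val_word) (auto simp: fun_eq_iff adj_apply)
  then have "arrows_val (relabel p [(b, c, 1), (a, c, 1), (a, b, 1)]) = 
     arrows_val (relabel p [(a, b, 1), (a, c, 1), (b, c, 1)])"
    using p(2) by (simp add: adj_apply eval_nat_numeral)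
  from arrows_val_transfer[OF p(1) _ _ this] assms show ?thesis
    by (auto simp: arrow_types_def arrow_val_def)
qed

lemma commute_uminus: "x + y = y + x \<Longrightarrow> - x + y = y + - (x :: 'g)"
  by (metis add.assoc add_0 add.right_neutral left_minus right_minus)

lemma arrow_val_commute:
  assumes "arrow_gen a b + arrow_gen c d = arrow_gen c d + arrow_gen a b"
  shows "arrow_val (a, b, e) + arrow_val (c, d, f) = arrow_val (c, d, f) + arrow_val (a, b, e)"
proof -
  have *: "x + - y = - y + x" if "x + y = y + x" for x y :: 'g
    using commute_uminus[of y x] that by simp
  show ?thesis
    unfolding arrow_val_def prod.case
    using assms commute_uminus * by (simp split: if_splits del: add_uminus_conv_diff)
qed

lemma arrow_move_val: "arrow_move n A B \<Longrightarrow> arrows_val A = arrows_val B"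
proof (induction rule: arrow_move.induct)
  case (cancel a b e)
  then show ?case by (auto simp: arrow_val_def arrow_types_def)
next
  case (comm a b e c d f)
  then have "arrow_gen a b + arrow_gen c d = arrow_gen c d + arrow_gen a b"
    by (intro arrow_gen_commute) (auto simp: arrow_types_def)
  from arrow_val_commute[OF this] show ?case by simp
next
  case (tails a b e c f)
  then have "arrow_gen a b + arrow_gen a c = arrow_gen a c + arrow_gen a b"
    by (intro arrow_gen_TC) (auto simp: arrow_types_def)
  from arrow_val_commute[OF this] show ?case by simp
next
  case (triangle a b e c)
  then have *: "arrow_gen a b + (arrow_gen a c + arrow_gen b c) = arrow_gen b c + (arrow_gen a c + arrow_gen a b)"
    by (intro arrow_gen_Omega3) (auto simp: arrow_types_def)
  \<comment> \<open>Inversion reverses both sides of the relation and thereby exchanges them, so the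
    relation holds for negative arrows too.\<close>
  have "- arrow_gen a b - arrow_gen a c - arrow_gen b c = - (arrow_gen b c + (arrow_gen a c + arrow_gen a b))"
    by (simp add: minus_add diff_conv_add_uminus add.assoc del: add_uminus_conv_diff)
  also have "\<dots> = - arrow_gen b c - arrow_gen a c - arrow_gen a b"
    by (simp add: *[symmetric] minus_add diff_conv_add_uminus add.assoc del: add_uminus_conv_diff)
  finally show ?case using * by (simp add: arrow_val_def diff_conv_add_uminus add.assoc del: add_uminus_conv_diff)
qed

end

lemma arrow_move_relabel:
  assumes "arrow_move n A B" "p permutes {1..n}"
  shows "arrow_move n (relabel p A) (relabel p B)"
proof -
  have inj: "p x = p y \<longleftrightarrow> x = y" for x y by (rule inj_eq[OF permutes_inj[OF assms(2)]])
  have "set (relabel p C) \<subseteq> arrow_types n" if "set C \<subseteq> arrow_types n" for C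
    by (rule relabel_arrow_types[OF assms(2) that])
  then have mem: "(p a, p b, e) \<in> arrow_types n" if "(a, b, e) \<in> arrow_types n" for a b e
    using that relabel_arrow_types[OF assms(2), of "[(a, b, e)]"] by simp
  show ?thesis using assms(1)
    by cases (auto intro!: arrow_move.intros mem simp: inj)
qed

text \<open>V2, V3 and M leave the list unchanged, R2 is a cancellation and F1 an exchange of tails.
  The last alternative serves R3, whose left word lists the triangle in the reversed order.\<close>

lemma local_move_arrows:
  assumes "local_move n u v"
  shows "word_arrows u = word_arrows v \<or> arrow_move n (word_arrows u) (word_arrows v) \<or>
    arrow_move n (word_arrows v) (word_arrows u)"
  using assms
proof cases
  case (R2_right i)
  then show ?thesis
    using arrow_move.cancel[of i "Suc i" "-1" n] by (auto simp: adj_apply arrow_types_def)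
qed (auto simp: adj_apply arrow_types_def intro!: arrow_move.intros)

lemma local_move_end_pos: "local_move n u v \<Longrightarrow> end_pos u = end_pos v"
  by (cases rule: local_move.cases) (auto simp: fun_eq_iff adj_apply)

lemma local_move_valid: "local_move n u v \<Longrightarrow> valid_word n u \<and> valid_word n v"
  by (cases rule: local_move.cases) auto

lemma far_move_arrows:
  assumes "far_move n u v"
  shows "word_arrows u = word_arrows v \<or> arrow_move n (word_arrows u) (word_arrows v)"
  using assms
proof cases
  case (1 l m)
  then show ?thesis
    by (cases l; cases m) (auto simp: adj_apply arrow_types_def intro!: arrow_move.intros)
qed

lemma far_move_end_pos: "far_move n u v \<Longrightarrow> end_pos u = end_pos v"
  by (cases rule: far_move.cases) (auto simp: fun_eq_iff adj_apply)

lemma far_move_valid: "far_move n u v \<Longrightarrow> valid_word n u \<and> valid_word n v"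
  by (cases rule: far_move.cases) auto


section \<open>Linearizations of Gauss diagrams\<close>

definition arrow_ends :: "arrow \<Rightarrow> (nat \<times> real) set" where
  "arrow_ends \<alpha> = {tail \<alpha>, head \<alpha>}"

definition arrow_type :: "arrow \<Rightarrow> nat \<times> nat \<times> int" where
  "arrow_type \<alpha> = (fst (tail \<alpha>), fst (head \<alpha>), arrow_sign \<alpha>)"

text \<open>Not an order: arrows without a common interval precede each other in both directions.\<close>

definition precedes :: "arrow \<Rightarrow> arrow \<Rightarrow> bool" where
  "precedes \<alpha> \<beta> \<longleftrightarrow> (\<forall>i u v. (i, u) \<in> arrow_ends \<alpha> \<and> (i, v) \<in> arrow_ends \<beta> \<longrightarrow> u < v)"

text \<open>An order in which the arrows can be drawn vertically from left to right.
  \<open>sorted_wrt\<close> demands \<open>precedes\<close> of all pairs and not only of neighbours,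
  which matters since \<open>precedes\<close> is not transitive.\<close>

definition linearization :: "gauss_diagram \<Rightarrow> arrow list \<Rightarrow> bool" where
  "linearization G L \<longleftrightarrow> set L = arrows G \<and> sorted_wrt precedes L"

definition proper_arrow :: "nat \<Rightarrow> arrow \<Rightarrow> bool" where
  "proper_arrow n \<alpha> \<longleftrightarrow> arrow_ends \<alpha> \<subseteq> {1..n} \<times> {0<..<1} \<and> arrow_type \<alpha> \<in> arrow_types n"

lemma not_precedes_self: "\<not> precedes \<alpha> \<alpha>"
  by (cases "tail \<alpha>") (auto simp: precedes_def arrow_ends_def)

lemma precedes_disjoint: "precedes \<alpha> \<beta> \<Longrightarrow> arrow_ends \<alpha> \<inter> arrow_ends \<beta> = {}"
  by (auto simp: precedes_def)

lemma sorted_wrt_precedes_distinct: "sorted_wrt precedes L \<Longrightarrow> distinct L"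
  by (induction L) (auto simp: not_precedes_self)

lemma both_precedes_disjoint:
  "precedes \<alpha> \<beta> \<Longrightarrow> precedes \<beta> \<alpha> \<Longrightarrow> fst ` arrow_ends \<alpha> \<inter> fst ` arrow_ends \<beta> = {}"
  by (auto simp: precedes_def) (metis less_asym prod.collapse)

lemma two_elements_split:
  assumes "\<alpha> \<in> set L" "\<beta> \<in> set L" "\<alpha> \<noteq> \<beta>"
  shows "(\<exists>L1 M L2. L = L1 @ \<alpha> # M @ \<beta> # L2) \<or> (\<exists>L1 M L2. L = L1 @ \<beta> # M @ \<alpha> # L2)"
proof -
  obtain L1 L2 where L: "L = L1 @ \<alpha> # L2" using assms(1) split_list by metis
  then have "\<beta> \<in> set L1 \<or> \<beta> \<in> set L2" using assms by auto
  then show ?thesis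
  proof
    assume "\<beta> \<in> set L1"
    then obtain K1 K2 where "L1 = K1 @ \<beta> # K2" using split_list by metis
    with L have "L = K1 @ \<beta> # K2 @ \<alpha> # L2" by simp
    then show ?thesis by blast
  next
    assume "\<beta> \<in> set L2"
    then obtain K1 K2 where "L2 = K1 @ \<beta> # K2" using split_list by metis
    with L have "L = L1 @ \<alpha> # K1 @ \<beta> # K2" by simp
    then show ?thesis by blast
  qed
qed

text \<open>Induction on the largest prescribed point \<open>m\<close>: the function found on
  \<open>{a..m}\<close> is continued affinely up to \<open>b\<close>.\<close>

lemma ex_increasing_interpolation:
  fixes a b c d :: real
  assumes "finite S" "S \<subseteq> {a<..<b}" "strict_mono_on S f" "f ` S \<subseteq> {c<..<d}" "a < b" "c < d"
  shows "\<exists>\<phi>. continuous_on {a..b} \<phi> \<and> strict_mono_on {a..b} \<phi> \<and> \<phi> a = c \<and> \<phi> b = d \<and> (\<forall>s\<in>S. \<phi> s = f s)"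
  using assms
proof (induction S arbitrary: b d rule: finite_linorder_max_induct)
  case empty
  define \<phi> where "\<phi> x = c + (x - a) * ((d - c) / (b - a))" for x
  have "continuous_on {a..b} \<phi>" unfolding \<phi>_def by (intro continuous_intros)
  moreover have "strict_mono_on {a..b} \<phi>"
  proof (rule strict_mono_onI)
    fix x y :: real assume "x < y"
    moreover have "0 < (d - c) / (b - a)" using empty by simp
    ultimately have "(x - a) * ((d - c) / (b - a)) < (y - a) * ((d - c) / (b - a))"
      by (intro mult_strict_right_mono) auto
    then show "\<phi> x < \<phi> y" by (simp only: \<phi>_def add_less_cancel_left)
  qed
  moreover have "\<phi> a = c" "\<phi> b = d" unfolding \<phi>_def using empty by auto
  ultimately show ?case by auto
next
  case (insert m S)
  have m: "a < m" "m < b" "c < f m" "f m < d" using insert.prems by auto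
  have "f s < f m" if "s \<in> S" for s
    using insert.prems(2) insert.hyps that by (auto simp: strict_mono_on_def)
  then have "S \<subseteq> {a<..<m}" "f ` S \<subseteq> {c<..<f m}" "strict_mono_on S f"
    using insert.prems insert.hyps by (auto simp: strict_mono_on_def)
  then obtain \<phi> where \<phi>: "continuous_on {a..m} \<phi>" "strict_mono_on {a..m} \<phi>" "\<phi> a = c" "\<phi> m = f m"
      "\<forall>s\<in>S. \<phi> s = f s"
    using insert.IH[of m "f m"] m by blast
  define \<psi> where "\<psi> x = (if x \<le> m then \<phi> x else f m + (x - m) * ((d - f m) / (b - m)))" for x
  have "continuous_on ({a..m} \<union> {m..b}) (\<lambda>x. if x \<le> m then \<phi> x else f m + (x - m) * ((d - f m) / (b - m)))"
    using \<phi> m by (intro continuous_on_If continuous_intros) auto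
  moreover have "{a..m} \<union> {m..b} = {a..b}" using m by auto
  ultimately have "continuous_on {a..b} \<psi>" unfolding \<psi>_def by simp
  moreover have "strict_mono_on {a..b} \<psi>"
  proof (rule strict_mono_onI)
    fix x y assume xy: "x \<in> {a..b}" "y \<in> {a..b}" "x < y"
    have pos: "0 < (d - f m) / (b - m)" using m by simp
    consider "y \<le> m" | "x \<le> m" "m < y" | "m < x" by linarith
    then show "\<psi> x < \<psi> y"
    proof cases
      case 1 then show ?thesis using \<phi>(2) xy by (auto simp: \<psi>_def strict_mono_on_def)
    next
      case 2
      have "\<phi> x \<le> \<phi> m"
        using \<phi>(2) xy 2 m by (cases "x = m") (auto simp: strict_mono_on_def less_imp_le)
      moreover have "0 < (y - m) * ((d - f m) / (b - m))" using 2 pos by (intro mult_pos_pos) auto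
      ultimately show ?thesis using 2 \<phi>(4) by (simp add: \<psi>_def)
    next
      case 3
      then have "(x - m) * ((d - f m) / (b - m)) < (y - m) * ((d - f m) / (b - m))"
        using xy pos by (intro mult_strict_right_mono) auto
      then show ?thesis using 3 xy by (simp add: \<psi>_def)
    qed
  qed
  moreover have "\<psi> a = c" "\<psi> b = d" "\<forall>s\<in>insert m S. \<psi> s = f s"
    using \<phi> m insert.hyps by (auto simp: \<psi>_def)
  ultimately show ?case by blast
qed

lemma ex_sorted_by_key:
  fixes f :: "'a \<Rightarrow> 'b::linorder"
  assumes "finite A" "inj_on f A"
  shows "\<exists>L. set L = A \<and> sorted_wrt (\<lambda>x y. f x < f y) L"
proof (intro exI conjI)
  let ?L = "map (the_inv_into A f) (sorted_list_of_set (f ` A))"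
  show "set ?L = A" using assms by (simp add: the_inv_into_onto)
  show "sorted_wrt (\<lambda>x y. f x < f y) ?L"
    unfolding sorted_wrt_map using assms
    by (intro sorted_wrt_mono_rel[OF _ strict_sorted_list_of_set]) (auto simp: the_inv_into_f_f)
qed

lemma bGD_properties:
  assumes "G \<in> bGD n"
  shows "finite (arrows G)" "label G permutes {1..n}" "\<And>\<alpha>. \<alpha> \<in> arrows G \<Longrightarrow> proper_arrow n \<alpha>"
  using assms by (auto simp: bGD_def gauss_diagrams_def proper_arrow_def arrow_ends_def arrow_type_def
    arrow_types_def mem_Times_iff)

lemma reparametrization_less_iff:
  assumes "reparametrization \<phi>" "u \<in> {0..1}" "v \<in> {0..1}"
  shows "\<phi> i u < \<phi> i v \<longleftrightarrow> u < v"
  using assms strict_mono_on_less[of "{0..1}" "\<phi> i" u v] by (auto simp: reparametrization_def)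

text \<open>A reparametrization that makes the diagram vertical gives every arrow an abscissa
  \<open>f\<close>, by which the arrows are sorted. It is increasing on each interval, so the order
  by \<open>f\<close> is also the order of the original ends.\<close>

lemma bGD_linearization:
  assumes "G \<in> bGD n"
  shows "\<exists>L. linearization G L"
proof -
  obtain \<phi> where \<phi>: "reparametrization \<phi>" "vertical (reparametrize \<phi> G)"
    using assms by (auto simp: bGD_def)
  define f where "f (\<alpha> :: arrow) = \<phi> (fst (tail \<alpha>)) (snd (tail \<alpha>))" for \<alpha>
  have ends: "\<phi> i u = f \<alpha>" "u \<in> {0..1}" if "\<alpha> \<in> arrows G" "(i, u) \<in> arrow_ends \<alpha>" for \<alpha> i u
    using \<phi>(2) that bGD_properties(3)[OF assms, of \<alpha>]
    by (auto simp: vertical_def reparametrize_def map_arrow_def f_def arrow_ends_def proper_arrow_def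
      split: prod.splits)
  \<comment> \<open>\<open>vertical\<close> separates only the images of arrows. Equal images have
    equal tails before the reparametrization, and two arrows with a common end coincide.\<close>
  have "inj_on f (arrows G)"
  proof (rule inj_onI)
    fix \<alpha> \<beta> assume *: "\<alpha> \<in> arrows G" "\<beta> \<in> arrows G" "f \<alpha> = f \<beta>"
    let ?m = "map_arrow (\<lambda>(i, x). (i, \<phi> i x))"
    have "inj_on (\<lambda>\<alpha>. snd (tail \<alpha>)) (?m ` arrows G)"
      using \<phi>(2) by (simp add: vertical_def reparametrize_def)
    moreover have "snd (tail (?m \<alpha>)) = snd (tail (?m \<beta>))"
      using *(3) by (simp add: f_def map_arrow_def split_beta)
    ultimately have "?m \<alpha> = ?m \<beta>"
      using *(1,2) by (auto dest: inj_onD)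
    then have "fst (tail \<alpha>) = fst (tail \<beta>)"
      by (auto simp: map_arrow_def split: prod.splits)
    moreover have "snd (tail \<alpha>) = snd (tail \<beta>)"
      using ends[OF *(1), of "fst (tail \<alpha>)" "snd (tail \<alpha>)"] ends[OF *(2), of "fst (tail \<beta>)" "snd (tail \<beta>)"]
        reparametrization_less_iff[OF \<phi>(1)] *(3) calculation
      by (metis arrow_ends_def insertI1 linorder_less_linear order_less_irrefl prod.collapse)
    ultimately have "tail \<alpha> = tail \<beta>" by (simp add: prod_eq_iff)
    then show "\<alpha> = \<beta>" using assms *(1,2) by (auto simp: bGD_def gauss_diagrams_def)
  qed
  then obtain L where L: "set L = arrows G" "sorted_wrt (\<lambda>x y. f x < f y) L"
    using ex_sorted_by_key bGD_properties(1)[OF assms] by blast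
  have "sorted_wrt precedes L"
    by (rule sorted_wrt_mono_rel[OF _ L(2)])
      (metis L(1) ends precedes_def reparametrization_less_iff[OF \<phi>(1)])
  with L(1) show ?thesis by (auto simp: linearization_def)
qed

text \<open>The fractions \<open>(c + 1) / (N + 1)\<close> with \<open>c < N\<close> are equally
  spaced and avoid 0 and 1, where no arrow may end.\<close>

definition std_arrow :: "nat \<Rightarrow> nat \<Rightarrow> nat \<times> nat \<times> int \<Rightarrow> arrow" where
  "std_arrow N c = (\<lambda>(a, b, e). \<lparr>tail = (a, real (Suc c) / real (Suc N)),
     head = (b, real (Suc c) / real (Suc N)), arrow_sign = e\<rparr>)"

definition std_list :: "(nat \<times> nat \<times> int) list \<Rightarrow> arrow list" where
  "std_list A = map (\<lambda>c. std_arrow (length A) c (A ! c)) [0..<length A]"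

definition std_gauss :: "(nat \<times> nat \<times> int) list \<Rightarrow> (nat \<Rightarrow> nat) \<Rightarrow> gauss_diagram" where
  "std_gauss A p = \<lparr>arrows = set (std_list A), label = p\<rparr>"

lemma std_arrow_simps [simp]:
  "arrow_type (std_arrow N c t) = t"
  "snd (tail (std_arrow N c t)) = real (Suc c) / real (Suc N)"
  "snd (head (std_arrow N c t)) = real (Suc c) / real (Suc N)"
  by (cases t; simp add: arrow_type_def std_arrow_def)+

lemma map_arrow_type_std_list [simp]: "map arrow_type (std_list A) = A"
  by (simp add: std_list_def o_def map_nth)

lemma std_list_sorted: "sorted_wrt precedes (std_list A)"
proof -
  have "precedes (std_arrow N c s) (std_arrow N d t)" if "c < d" for N c d s t
    using that by (cases s; cases t) (auto simp: precedes_def arrow_ends_def std_arrow_def divide_strict_right_mono)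
  then show ?thesis by (auto simp: std_list_def sorted_wrt_iff_nth_less)
qed

lemma linearization_std: "linearization (std_gauss A p) (std_list A)"
  by (simp add: linearization_def std_gauss_def std_list_sorted)

lemma std_proper:
  assumes "set A \<subseteq> arrow_types n" "\<alpha> \<in> set (std_list A)"
  shows "proper_arrow n \<alpha>"
proof -
  obtain c where c: "c < length A" "\<alpha> = std_arrow (length A) c (A ! c)"
    using assms(2) by (auto simp: std_list_def)
  then have "A ! c \<in> arrow_types n" using assms(1) by auto
  with c show ?thesis
    by (cases "A ! c") (auto simp: proper_arrow_def arrow_ends_def std_arrow_def arrow_types_def arrow_type_def)
qed

lemma vertical_std: "vertical (std_gauss A p)"
  by (auto simp: vertical_def std_gauss_def std_list_def inj_on_def)

text \<open>Both ends of the \<open>c\<close>-th arrow are sent to the same abscissa. On one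
  interval this prescription is strictly increasing, because ends of different arrows are ordered
  there by \<open>precedes\<close> and no arrow ends twice on an interval; interpolation does the
  rest.\<close>

lemma reparametrize_std:
  assumes "linearization G L" "\<And>\<alpha>. \<alpha> \<in> set L \<Longrightarrow> proper_arrow n \<alpha>"
  shows "\<exists>\<phi>. reparametrization \<phi> \<and> reparametrize \<phi> G = std_gauss (map arrow_type L) (label G)"
proof -
  let ?N = "length L"
  have sorted: "sorted_wrt precedes L" and set: "set L = arrows G"
    using assms(1) by (auto simp: linearization_def)
  define S where "S i = {u. \<exists>\<alpha>\<in>set L. (i, u) \<in> arrow_ends \<alpha>}" for i
  have uniq: "c = d" if "c < ?N" "d < ?N" "(i, u) \<in> arrow_ends (L ! c)" "(i, u) \<in> arrow_ends (L ! d)" for c d i u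
    using sorted_wrt_nth_less[OF sorted, of c d] sorted_wrt_nth_less[OF sorted, of d c] that
    by (metis less_irrefl linorder_neqE_nat precedes_def)
  \<comment> \<open>The description is unique by \<open>uniq\<close>: a point is an end of at most
    one arrow of the list.\<close>
  define f where "f i u = real (Suc (THE c. c < ?N \<and> (i, u) \<in> arrow_ends (L ! c))) / real (Suc ?N)" for i u
  have f: "f i u = real (Suc c) / real (Suc ?N)" if "c < ?N" "(i, u) \<in> arrow_ends (L ! c)" for c i u
  proof -
    have "(THE c. c < ?N \<and> (i, u) \<in> arrow_ends (L ! c)) = c"
      using that uniq by (intro the_equality) auto
    then show ?thesis by (simp add: f_def)
  qed
  have "\<exists>\<phi>. continuous_on {0..1} \<phi> \<and> strict_mono_on {0..1} \<phi> \<and> \<phi> 0 = 0 \<and> \<phi> 1 = 1 \<and> (\<forall>u\<in>S i. \<phi> u = f i u)" for i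
  proof (rule ex_increasing_interpolation)
    have "S i \<subseteq> snd ` (\<Union>\<alpha>\<in>set L. arrow_ends \<alpha>)" by (force simp: S_def)
    moreover have "finite \<dots>" by (auto simp: arrow_ends_def)
    ultimately show "finite (S i)" by (rule finite_subset)
    show "S i \<subseteq> {0<..<1}" using assms(2) by (force simp: S_def proper_arrow_def)
    show "f i ` S i \<subseteq> {0<..<1}"
      by (auto simp: S_def in_set_conv_nth f)
    show "strict_mono_on (S i) (f i)"
    proof (rule strict_mono_onI)
      fix u v assume "u \<in> S i" "v \<in> S i" "u < v"
      then obtain c d where cd: "c < ?N" "(i, u) \<in> arrow_ends (L ! c)" "d < ?N" "(i, v) \<in> arrow_ends (L ! d)"
        by (auto simp: S_def in_set_conv_nth)
      have "\<not> d < c"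
        using sorted_wrt_nth_less[OF sorted, of d c] cd \<open>u < v\<close> by (metis less_asym precedes_def)
      show "f i u < f i v"
      proof (cases "c = d")
        case False
        with \<open>\<not> d < c\<close> show ?thesis
          using f[OF cd(1,2)] f[OF cd(3,4)] cd by (simp add: divide_strict_right_mono)
      next
        case True
        have "proper_arrow n (L ! c)" using assms(2) cd by auto
        with True cd \<open>u < v\<close> show ?thesis
          by (auto simp: proper_arrow_def arrow_ends_def arrow_type_def arrow_types_def)
      qed
    qed
  qed auto
  then obtain \<phi> where \<phi>: "\<And>i. continuous_on {0..1} (\<phi> i) \<and> strict_mono_on {0..1} (\<phi> i) \<and>
      \<phi> i 0 = 0 \<and> \<phi> i 1 = 1 \<and> (\<forall>u\<in>S i. \<phi> i u = f i u)" by metis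
  let ?m = "map_arrow (\<lambda>(i, x). (i, \<phi> i x))"
  have "?m (L ! c) = std_arrow ?N c (arrow_type (L ! c))" if "c < ?N" for c
  proof -
    obtain i u j v e where a: "L ! c = \<lparr>tail = (i, u), head = (j, v), arrow_sign = e\<rparr>"
      by (metis arrow.cases surj_pair)
    then have "(i, u) \<in> arrow_ends (L ! c)" "(j, v) \<in> arrow_ends (L ! c)" by (auto simp: arrow_ends_def)
    moreover from this have "u \<in> S i" "v \<in> S j" using that by (auto simp: S_def)
    ultimately show ?thesis using \<phi> f that a
      by (simp add: map_arrow_def std_arrow_def arrow_type_def)
  qed
  then have "map ?m L = std_list (map arrow_type L)"
    by (intro nth_equalityI) (auto simp: std_list_def)
  then have "?m ` arrows G = set (std_list (map arrow_type L))"
    by (metis set set_map)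
  then have "reparametrize \<phi> G = std_gauss (map arrow_type L) (label G)"
    by (simp add: reparametrize_def std_gauss_def)
  with \<phi> show ?thesis by (auto simp: reparametrization_def)
qed

text \<open>The standardizing reparametrization makes the diagram vertical. Together with
  \<open>bGD_linearization\<close> this replaces the existential reparametrization in
  \<open>bGD\<close> by a list of arrows.\<close>

lemma bGD_I:
  assumes "linearization G L" "\<And>\<alpha>. \<alpha> \<in> set L \<Longrightarrow> proper_arrow n \<alpha>" "label G permutes {1..n}"
  shows "G \<in> bGD n"
proof -
  have set: "set L = arrows G" and sorted: "sorted_wrt precedes L"
    using assms(1) by (auto simp: linearization_def)
  have "arrow_ends \<alpha> \<inter> arrow_ends \<beta> = {}" if "\<alpha> \<in> set L" "\<beta> \<in> set L" "\<alpha> \<noteq> \<beta>" for \<alpha> \<beta>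
    using two_elements_split[OF that] sorted precedes_disjoint by (fastforce simp: sorted_wrt_append)
  moreover have "tail \<alpha> \<in> {1..n} \<times> {0<..<1} \<and> head \<alpha> \<in> {1..n} \<times> {0<..<1} \<and> fst (tail \<alpha>) \<noteq> fst (head \<alpha>)
      \<and> tail \<alpha> \<noteq> head \<alpha> \<and> arrow_sign \<alpha> \<in> {1, -1}" if "\<alpha> \<in> set L" for \<alpha>
    using assms(2)[OF that] by (auto simp: proper_arrow_def arrow_ends_def arrow_type_def arrow_types_def)
  moreover have "finite (arrows G)" using set by (metis finite_set)
  ultimately have "G \<in> gauss_diagrams n" "\<forall>\<alpha>\<in>arrows G. fst (tail \<alpha>) \<noteq> fst (head \<alpha>)"
    unfolding gauss_diagrams_def arrow_ends_def set using assms(3) by auto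
  moreover obtain \<phi> where "reparametrization \<phi>" "reparametrize \<phi> G = std_gauss (map arrow_type L) (label G)"
    using reparametrize_std[OF assms(1,2)] by blast
  ultimately show ?thesis unfolding bGD_def using vertical_std by auto
qed


lemma bGD_proper: "G \<in> bGD n \<Longrightarrow> linearization G L \<Longrightarrow> \<alpha> \<in> set L \<Longrightarrow> proper_arrow n \<alpha>"
  by (auto simp: linearization_def bGD_properties)

lemma bGD_types:
  "G \<in> bGD n \<Longrightarrow> linearization G L \<Longrightarrow> set (map arrow_type L) \<subseteq> arrow_types n"
  using bGD_proper by (auto simp: proper_arrow_def)

lemma std_bGD:
  "set A \<subseteq> arrow_types n \<Longrightarrow> p permutes {1..n} \<Longrightarrow> std_gauss A p \<in> bGD n"
  by (rule bGD_I[OF linearization_std std_proper]) (auto simp: std_gauss_def)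

lemma equivclp_rel:
  fixes r :: "'a rel"
  defines "E \<equiv> (r \<union> r\<inverse>)\<^sup>*"
  shows "(x, y) \<in> r \<Longrightarrow> (x, y) \<in> E" "(x, x) \<in> E" "(x, y) \<in> E \<Longrightarrow> (y, x) \<in> E"
    "(x, y) \<in> E \<Longrightarrow> (y, z) \<in> E \<Longrightarrow> (x, z) \<in> E"
proof -
  show "(x, y) \<in> E \<Longrightarrow> (y, x) \<in> E"
    unfolding E_def by (metis converse_Un converse_converse rtrancl_converseD sup_commute)
qed (auto simp: E_def)

lemmas wReidemeister_eq_rules = equivclp_rel[where r = "wReidemeister_step n" for n, folded wReidemeister_eq_def]

text \<open>Up to equivalence only the list of arrow types and the permutation matter, so moves may
  be performed on equally spaced diagrams.\<close>

lemma wReidemeister_eq_std: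
  assumes "G \<in> bGD n" "linearization G L"
  shows "(G, std_gauss (map arrow_type L) (label G)) \<in> wReidemeister_eq n"
proof -
  obtain \<phi> where "reparametrization \<phi>" "reparametrize \<phi> G = std_gauss (map arrow_type L) (label G)"
    using reparametrize_std[OF assms(2) bGD_proper[OF assms]] by blast
  moreover have "std_gauss (map arrow_type L) (label G) \<in> bGD n"
    by (rule std_bGD[OF bGD_types[OF assms] bGD_properties(2)[OF assms(1)]])
  ultimately show ?thesis
    using assms(1) by (intro wReidemeister_eq_rules(1)) (auto simp: wReidemeister_step_def)
qed

section \<open>Realizing relations between arrow lists by Gauss moves\<close>

lemma precedes_arrow:
  "precedes \<gamma> \<lparr>tail = s, head = t, arrow_sign = e\<rparr> \<longleftrightarrow>
     (\<forall>i u. (i, u) \<in> arrow_ends \<gamma> \<longrightarrow> (fst s = i \<longrightarrow> u < snd s) \<and> (fst t = i \<longrightarrow> u < snd t))"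
  "precedes \<lparr>tail = s, head = t, arrow_sign = e\<rparr> \<gamma> \<longleftrightarrow>
     (\<forall>i u. (i, u) \<in> arrow_ends \<gamma> \<longrightarrow> (fst s = i \<longrightarrow> snd s < u) \<and> (fst t = i \<longrightarrow> snd t < u))"
  by (cases s; cases t; auto simp: precedes_def arrow_ends_def)+

lemma arrow_ends_simp [simp]: "arrow_ends \<lparr>tail = s, head = t, arrow_sign = e\<rparr> = {s, t}"
  by (simp add: arrow_ends_def)

lemma arrow_type_simp [simp]: "arrow_type \<lparr>tail = s, head = t, arrow_sign = e\<rparr> = (fst s, fst t, e)"
  by (simp add: arrow_type_def)

lemma adjacent_arrow_ends:
  "adjacent G i x y \<longleftrightarrow>
    (\<forall>\<alpha>\<in>arrows G. \<forall>z. (i, z) \<in> arrow_ends \<alpha> \<longrightarrow> \<not> (min x y < z \<and> z < max x y))"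
  by (auto simp: adjacent_def arrow_ends_def) (metis+)

lemma arrow_of_type:
  assumes "arrow_type \<alpha> = (a, b, e)"
  obtains x y where "\<alpha> = \<lparr>tail = (a, x), head = (b, y), arrow_sign = e\<rparr>"
  using assms by (cases \<alpha>) (auto simp: arrow_type_def)

text \<open>Consecutive arrows of a linearization have adjacent ends on every interval that they
  share, so the relations become Gauss moves; \<open>comm\<close> needs no move, as it lists the
  same diagram in another order.\<close>

lemma std_arrow_move:
  assumes move: "arrow_move n A B"
    and types: "set X \<subseteq> arrow_types n" "set Y \<subseteq> arrow_types n" and p: "p permutes {1..n}"
  shows "(std_gauss (X @ A @ Y) p, std_gauss (X @ B @ Y) p) \<in> wReidemeister_eq n"
proof -
  have AB: "set A \<subseteq> arrow_types n" "set B \<subseteq> arrow_types n"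
    using move by (cases; auto simp: arrow_types_def)+
  define G where "G = std_gauss (X @ A @ Y) p"
  define L where "L = std_list (X @ A @ Y)"
  have G: "G \<in> bGD n" unfolding G_def using types AB p by (intro std_bGD) auto
  have lin: "linearization G L" by (simp add: G_def L_def linearization_std)
  have label: "label G = p" by (simp add: G_def std_gauss_def)
  have "map arrow_type L = X @ A @ Y" by (simp add: L_def)
  then obtain LX L' where L': "L = LX @ L'" "map arrow_type LX = X" "map arrow_type L' = A @ Y"
    by (metis map_eq_append_conv)
  then obtain LA LY where L: "L = LX @ LA @ LY" and
    t: "map arrow_type LX = X" "map arrow_type LA = A" "map arrow_type LY = Y"
    by (metis map_eq_append_conv)
  have proper: "proper_arrow n \<alpha>" if "\<alpha> \<in> set L" for \<alpha> using bGD_proper[OF G lin that] .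
  have arrows: "arrows G = set LX \<union> set LA \<union> set LY"
    using lin L by (auto simp: linearization_def)
  have sorted: "sorted_wrt precedes (LX @ LA @ LY)" using lin L by (auto simp: linearization_def)
  have distinct: "distinct (LX @ LA @ LY)" by (rule sorted_wrt_precedes_distinct[OF sorted])
  \<comment> \<open>The moved diagram keeps the old set of ends, or a part of it, and need not be
    equally spaced along its new list, so it is standardized once more.\<close>
  have finish: "(G, std_gauss (X @ B @ Y) p) \<in> wReidemeister_eq n"
    if "gauss_move G G' \<or> G = G'" "linearization G' (LX @ LB @ LY)" "map arrow_type LB = B"
      "label G' = p" "\<And>\<alpha>. \<alpha> \<in> set LB \<Longrightarrow> proper_arrow n \<alpha>" for G' LB
  proof -
    have G': "G' \<in> bGD n"
      by (rule bGD_I[OF that(2)]) (use that proper L p in auto)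
    have "(G, G') \<in> wReidemeister_eq n"
      using that(1) G G' wReidemeister_eq_rules(1,2) by (auto simp: wReidemeister_step_def)
    moreover have "map arrow_type (LX @ LB @ LY) = X @ B @ Y" using that(3) t by simp
    then have "(G', std_gauss (X @ B @ Y) p) \<in> wReidemeister_eq n"
      using wReidemeister_eq_std[OF G' that(2)] by (simp only: that(4))
    ultimately show ?thesis by (rule wReidemeister_eq_rules(4))
  qed
  show ?thesis
    using move
  proof cases
    case (cancel a b e)
    then obtain \<alpha> \<beta> where LA: "LA = [\<alpha>, \<beta>]" "arrow_type \<alpha> = (a, b, e)" "arrow_type \<beta> = (a, b, - e)"
      using t(2) by auto
    obtain x y where \<alpha>: "\<alpha> = \<lparr>tail = (a, x), head = (b, y), arrow_sign = e\<rparr>" using LA(2) arrow_of_type by blast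
    obtain x' y' where \<beta>: "\<beta> = \<lparr>tail = (a, x'), head = (b, y'), arrow_sign = - e\<rparr>" using LA(3) arrow_of_type by blast
    have ab: "a \<noteq> b" using cancel by (auto simp: arrow_types_def)
    have "x < x'" "y < y'" using sorted by (auto simp: LA \<alpha> \<beta> sorted_wrt_append precedes_arrow)
    have "gauss_move G \<lparr>arrows = set LX \<union> set LY, label = p\<rparr>"
    proof (rule gauss_move.Omega2)
      show "arrows G = set LX \<union> set LY \<union> {\<lparr>tail = (a, x), head = (b, y), arrow_sign = e\<rparr>,
          \<lparr>tail = (a, x'), head = (b, y'), arrow_sign = - e\<rparr>}"
        by (auto simp: arrows LA \<alpha> \<beta>)
      show "\<lparr>tail = (a, x), head = (b, y), arrow_sign = e\<rparr> \<notin> set LX \<union> set LY"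
        "\<lparr>tail = (a, x'), head = (b, y'), arrow_sign = - e\<rparr> \<notin> set LX \<union> set LY"
        using distinct by (auto simp: LA \<alpha> \<beta>)
      show "adjacent G a x x'" "adjacent G b y y'"
        using sorted ab \<open>x < x'\<close> \<open>y < y'\<close>
        by (fastforce simp: adjacent_arrow_ends arrows LA \<alpha> \<beta> sorted_wrt_append precedes_arrow)+
    qed (simp_all add: label ab)
    then show ?thesis
      using finish[of "\<lparr>arrows = set LX \<union> set LY, label = p\<rparr>" "[]"] sorted cancel
      by (simp add: linearization_def sorted_wrt_append G_def)
  next
    case (comm a b e c d f)
    then obtain \<alpha> \<beta> where LA: "LA = [\<alpha>, \<beta>]" "arrow_type \<alpha> = (a, b, e)" "arrow_type \<beta> = (c, d, f)"
      using t(2) by auto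
    obtain x y where \<alpha>: "\<alpha> = \<lparr>tail = (a, x), head = (b, y), arrow_sign = e\<rparr>" using LA(2) arrow_of_type by blast
    obtain x' y' where \<beta>: "\<beta> = \<lparr>tail = (c, x'), head = (d, y'), arrow_sign = f\<rparr>" using LA(3) arrow_of_type by blast
    have "linearization G (LX @ [\<beta>, \<alpha>] @ LY)"
      using sorted comm by (auto simp: linearization_def arrows LA sorted_wrt_append) (auto simp: \<alpha> \<beta> precedes_arrow)
    then show ?thesis
      using finish[of G "[\<beta>, \<alpha>]"] comm LA L label proper by (auto simp: G_def)
  next
    case (tails a b e c f)
    then obtain \<alpha> \<beta> where LA: "LA = [\<alpha>, \<beta>]" "arrow_type \<alpha> = (a, b, e)" "arrow_type \<beta> = (a, c, f)"
      using t(2) by auto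
    obtain x y where \<alpha>: "\<alpha> = \<lparr>tail = (a, x), head = (b, y), arrow_sign = e\<rparr>" using LA(2) arrow_of_type by blast
    obtain x' y' where \<beta>: "\<beta> = \<lparr>tail = (a, x'), head = (c, y'), arrow_sign = f\<rparr>" using LA(3) arrow_of_type by blast
    have abc: "a \<noteq> b" "a \<noteq> c" "b \<noteq> c" using tails by (auto simp: arrow_types_def)
    have xx': "x < x'" using sorted by (auto simp: LA \<alpha> \<beta> sorted_wrt_append precedes_arrow)
    let ?\<alpha> = "\<lparr>tail = (a, x'), head = (b, y), arrow_sign = e\<rparr>"
    let ?\<beta> = "\<lparr>tail = (a, x), head = (c, y'), arrow_sign = f\<rparr>"
    define G' where "G' = \<lparr>arrows = (set LX \<union> set LY) \<union> {?\<alpha>, ?\<beta>}, label = p\<rparr>"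
    have "gauss_move G G'"
    proof (rule gauss_move.TC)
      show "arrows G = set LX \<union> set LY \<union> {\<lparr>tail = (a, x), head = (b, y), arrow_sign = e\<rparr>,
          \<lparr>tail = (a, x'), head = (c, y'), arrow_sign = f\<rparr>}"
        by (auto simp: arrows LA \<alpha> \<beta>)
      show "arrows G' = set LX \<union> set LY \<union> {?\<alpha>, ?\<beta>}" by (simp add: G'_def)
      show "\<lparr>tail = (a, x), head = (b, y), arrow_sign = e\<rparr> \<notin> set LX \<union> set LY"
        "\<lparr>tail = (a, x'), head = (c, y'), arrow_sign = f\<rparr> \<notin> set LX \<union> set LY"
        using distinct by (auto simp: LA \<alpha> \<beta>)
      show "adjacent G a x x'"
        using sorted abc xx'
        by (fastforce simp: adjacent_arrow_ends arrows LA \<alpha> \<beta> sorted_wrt_append precedes_arrow)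
    qed (simp_all add: label abc G'_def)
    moreover have "linearization G' (LX @ [?\<beta>, ?\<alpha>] @ LY)"
      using sorted abc xx'
      by (auto simp: linearization_def G'_def LA sorted_wrt_append \<alpha> \<beta> precedes_arrow)
    moreover have "proper_arrow n ?\<alpha>" "proper_arrow n ?\<beta>"
      using proper[of \<alpha>] proper[of \<beta>] by (auto simp: L LA proper_arrow_def \<alpha> \<beta>)
    ultimately show ?thesis
      using finish[of G' "[?\<beta>, ?\<alpha>]"] tails by (auto simp: G_def G'_def)
  next
    case (triangle a b e c)
    then obtain \<alpha> \<beta> \<delta> where LA: "LA = [\<alpha>, \<beta>, \<delta>]" "arrow_type \<alpha> = (a, b, e)" "arrow_type \<beta> = (a, c, e)"
        "arrow_type \<delta> = (b, c, e)"
      using t(2) by auto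
    obtain x y where \<alpha>: "\<alpha> = \<lparr>tail = (a, x), head = (b, y), arrow_sign = e\<rparr>" using LA(2) arrow_of_type by blast
    obtain x' z where \<beta>: "\<beta> = \<lparr>tail = (a, x'), head = (c, z), arrow_sign = e\<rparr>" using LA(3) arrow_of_type by blast
    obtain y' z' where \<delta>: "\<delta> = \<lparr>tail = (b, y'), head = (c, z'), arrow_sign = e\<rparr>" using LA(4) arrow_of_type by blast
    have abc: "a \<noteq> b" "a \<noteq> c" "b \<noteq> c" using triangle by (auto simp: arrow_types_def)
    have less: "x < x'" "y < y'" "z < z'" using sorted by (auto simp: LA \<alpha> \<beta> \<delta> sorted_wrt_append precedes_arrow)
    let ?\<delta> = "\<lparr>tail = (b, y), head = (c, z), arrow_sign = e\<rparr>"
    let ?\<beta> = "\<lparr>tail = (a, x), head = (c, z'), arrow_sign = e\<rparr>"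
    let ?\<alpha> = "\<lparr>tail = (a, x'), head = (b, y'), arrow_sign = e\<rparr>"
    define G' where "G' = \<lparr>arrows = (set LX \<union> set LY) \<union> {?\<delta>, ?\<beta>, ?\<alpha>}, label = p\<rparr>"
    have "gauss_move G G'"
    proof (rule gauss_move.Omega3)
      show "arrows G = set LX \<union> set LY \<union> {\<lparr>tail = (a, x), head = (b, y), arrow_sign = e\<rparr>,
          \<lparr>tail = (a, x'), head = (c, z), arrow_sign = e\<rparr>, \<lparr>tail = (b, y'), head = (c, z'), arrow_sign = e\<rparr>}"
        by (auto simp: arrows LA \<alpha> \<beta> \<delta>)
      show "arrows G' = set LX \<union> set LY \<union> {?\<delta>, ?\<beta>, ?\<alpha>}" by (simp add: G'_def)
      show "\<lparr>tail = (a, x), head = (b, y), arrow_sign = e\<rparr> \<notin> set LX \<union> set LY"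
        "\<lparr>tail = (a, x'), head = (c, z), arrow_sign = e\<rparr> \<notin> set LX \<union> set LY"
        "\<lparr>tail = (b, y'), head = (c, z'), arrow_sign = e\<rparr> \<notin> set LX \<union> set LY"
        using distinct by (auto simp: LA \<alpha> \<beta> \<delta>)
      show "adjacent G a x x'" "adjacent G b y y'" "adjacent G c z z'"
        using sorted abc less
        by (fastforce simp: adjacent_arrow_ends arrows LA \<alpha> \<beta> \<delta> sorted_wrt_append precedes_arrow)+
    qed (simp_all add: label abc G'_def less)
    moreover have "linearization G' (LX @ [?\<delta>, ?\<beta>, ?\<alpha>] @ LY)"
      using sorted abc less
      by (auto simp: linearization_def G'_def LA sorted_wrt_append \<alpha> \<beta> \<delta> precedes_arrow)
    moreover have "proper_arrow n ?\<alpha>" "proper_arrow n ?\<beta>" "proper_arrow n ?\<delta>"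
      using proper[of \<alpha>] proper[of \<beta>] proper[of \<delta>] by (auto simp: L LA proper_arrow_def \<alpha> \<beta> \<delta>)
    ultimately show ?thesis
      using finish[of G' "[?\<delta>, ?\<beta>, ?\<alpha>]"] triangle by (auto simp: G_def G'_def)
  qed
qed


section \<open>Invariance of the value under the moves\<close>

text \<open>An end of \<open>\<gamma>\<close> on the interval \<open>i\<close> would lie strictly
  between \<open>u\<close> and \<open>v\<close>. This keeps the arrows listed between two arrows of
  a move away from the intervals on which those are adjacent.\<close>

lemma not_between_adjacent:
  assumes "\<gamma> \<in> arrows G" "adjacent G i u v" "precedes \<alpha> \<gamma>" "precedes \<gamma> \<beta>"
    "(i, u) \<in> arrow_ends \<alpha>" "(i, v) \<in> arrow_ends \<beta>"
  shows "(i, w) \<notin> arrow_ends \<gamma>"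
proof
  assume "(i, w) \<in> arrow_ends \<gamma>"
  moreover from this have "u < w" "w < v" using assms by (auto simp: precedes_def)
  ultimately show False using assms(1,2) by (fastforce simp: adjacent_arrow_ends)
qed

lemma set_remaining2:
  assumes "distinct (L1 @ a # L2 @ b # L3)" "set (L1 @ a # L2 @ b # L3) = R \<union> {a, b}" "a \<notin> R" "b \<notin> R"
  shows "set L1 \<union> set L2 \<union> set L3 = R"
proof -
  have "R = (R \<union> {a, b}) - {a, b}" using assms(3,4) by auto
  then show ?thesis unfolding assms(2)[symmetric] using assms(1) by auto
qed

lemma set_remaining3:
  assumes "distinct (L1 @ a # L2 @ b # L3 @ c # L4)" "set (L1 @ a # L2 @ b # L3 @ c # L4) = R \<union> {a, b, c}"
    "a \<notin> R" "b \<notin> R" "c \<notin> R"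
  shows "set L1 \<union> set L2 \<union> set L3 \<union> set L4 = R"
proof -
  have "R = (R \<union> {a, b, c}) - {a, b, c}" using assms(3-5) by auto
  then show ?thesis unfolding assms(2)[symmetric] using assms(1) by auto
qed

context welded_representation
begin

abbreviation list_val :: "arrow list \<Rightarrow> 'g" where
  "list_val L \<equiv> arrows_val (map arrow_type L)"

lemma arrow_val_disjoint:
  assumes "proper_arrow n \<alpha>" "proper_arrow n \<beta>" "fst ` arrow_ends \<alpha> \<inter> fst ` arrow_ends \<beta> = {}"
  shows "arrow_val (arrow_type \<alpha>) + arrow_val (arrow_type \<beta>) = arrow_val (arrow_type \<beta>) + arrow_val (arrow_type \<alpha>)"
proof -
  have "arrow_move n [arrow_type \<alpha>, arrow_type \<beta>] [arrow_type \<beta>, arrow_type \<alpha>]"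
    using assms unfolding arrow_type_def
    by (intro arrow_move.comm) (auto simp: proper_arrow_def arrow_type_def arrow_ends_def)
  from arrow_move_val[OF this] show ?thesis by simp
qed

lemma list_val_move_right:
  assumes "proper_arrow n \<alpha>" "\<And>\<beta>. \<beta> \<in> set M \<Longrightarrow> proper_arrow n \<beta>"
    "\<And>\<beta>. \<beta> \<in> set M \<Longrightarrow> fst ` arrow_ends \<alpha> \<inter> fst ` arrow_ends \<beta> = {}"
  shows "list_val (\<alpha> # M) = list_val (M @ [\<alpha>])"
proof -
  have "arrow_val (arrow_type \<alpha>) + sum_list (map arrow_val (map arrow_type M)) =
     sum_list (map arrow_val (map arrow_type M)) + arrow_val (arrow_type \<alpha>)"
    using assms by (intro commute_sum_list) (auto intro!: arrow_val_disjoint)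
  then show ?thesis by simp
qed

text \<open>The last arrow \<open>m\<close> of \<open>L'\<close> is followed in \<open>L\<close> by
  arrows that come before it in \<open>L'\<close>. Preceding each other in both directions, they
  share no interval with \<open>m\<close>, so \<open>m\<close> commutes to the end of
  \<open>L\<close> and the induction applies.\<close>

lemma list_val_unique:
  assumes "sorted_wrt precedes L" "sorted_wrt precedes L'" "set L = set L'"
    "\<And>\<alpha>. \<alpha> \<in> set L' \<Longrightarrow> proper_arrow n \<alpha>"
  shows "list_val L = list_val L'"
  using assms
proof (induction L' arbitrary: L rule: rev_induct)
  case (snoc m L')
  then obtain A B where L: "L = A @ m # B" by (metis in_set_conv_decomp)
  have "distinct L" "distinct (L' @ [m])"
    by (rule sorted_wrt_precedes_distinct[OF snoc.prems(1)], rule sorted_wrt_precedes_distinct[OF snoc.prems(2)])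
  then have set: "set (A @ B) = set L'"
    using snoc.prems(3) L by (auto simp: set_eq_iff)
  have "fst ` arrow_ends m \<inter> fst ` arrow_ends \<beta> = {}" if "\<beta> \<in> set B" for \<beta>
    using snoc.prems(1,2) that set by (intro both_precedes_disjoint) (auto simp: L sorted_wrt_append)
  moreover have "set B \<subseteq> set L'" using set by auto
  ultimately have move: "list_val (m # B) = list_val (B @ [m])"
    using snoc.prems(4) by (intro list_val_move_right) auto
  have "list_val (A @ B) = list_val L'"
    using snoc.prems set L by (intro snoc.IH) (auto simp: sorted_wrt_append)
  then show ?case using move by (simp add: L add.assoc flip: add.assoc)
qed simp

definition gauss_val :: "gauss_diagram \<Rightarrow> 'g" where
  "gauss_val G = list_val (SOME L. linearization G L) + perm_val (label G)"

lemma gauss_val_eq: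
  assumes "G \<in> bGD n" "linearization G L"
  shows "gauss_val G = list_val L + perm_val (label G)"
proof -
  have "linearization G (SOME L. linearization G L)"
    using assms(2) by (rule someI)
  then have "list_val (SOME L. linearization G L) = list_val L"
    using assms bGD_properties(3) by (intro list_val_unique) (auto simp: linearization_def)
  then show ?thesis by (simp add: gauss_val_def)
qed

lemma list_val_move:
  assumes "arrow_move n (map arrow_type LA) (map arrow_type LB)"
  shows "list_val (X @ LA @ Y) = list_val (X @ LB @ Y)"
  using arrow_move_val[OF assms] by simp

text \<open>By adjacency no arrow of \<open>M\<close> meets \<open>a\<close> or \<open>b\<close>, so
  \<open>\<alpha>\<close> can be moved up to \<open>\<beta>\<close> and cancelled.\<close>

lemma Omega2_val:
  assumes G: "G \<in> bGD n" "linearization G (L1 @ \<alpha> # M @ \<beta> # L2)"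
    and \<alpha>: "\<alpha> = \<lparr>tail = (a, x), head = (b, y), arrow_sign = e\<rparr>"
    and \<beta>: "\<beta> = \<lparr>tail = (a, x'), head = (b, y'), arrow_sign = - e\<rparr>"
    and adj: "adjacent G a x x'" "adjacent G b y y'"
  shows "list_val (L1 @ \<alpha> # M @ \<beta> # L2) = list_val (L1 @ M @ L2)"
proof -
  have sorted: "sorted_wrt precedes (L1 @ \<alpha> # M @ \<beta> # L2)"
    and set: "set (L1 @ \<alpha> # M @ \<beta> # L2) = arrows G"
    using G by (auto simp: linearization_def)
  have proper: "proper_arrow n \<gamma>" if "\<gamma> \<in> set (L1 @ \<alpha> # M @ \<beta> # L2)" for \<gamma>
    using that bGD_proper[OF G] by blast
  have "fst ` arrow_ends \<alpha> \<inter> fst ` arrow_ends \<gamma> = {}" if "\<gamma> \<in> set M" for \<gamma>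
  proof -
    have \<gamma>: "precedes \<alpha> \<gamma>" "precedes \<gamma> \<beta>" "\<gamma> \<in> arrows G"
      using that sorted set by (auto simp: sorted_wrt_append)
    have "(a, w) \<notin> arrow_ends \<gamma>" "(b, w) \<notin> arrow_ends \<gamma>" for w
      using not_between_adjacent[OF \<gamma>(3) adj(1) \<gamma>(1,2)] not_between_adjacent[OF \<gamma>(3) adj(2) \<gamma>(1,2)]
      by (auto simp: \<alpha> \<beta>)
    then show ?thesis by (auto simp: \<alpha>)
  qed
  then have "list_val (\<alpha> # M) = list_val (M @ [\<alpha>])"
    using proper by (intro list_val_move_right) auto
  then have "list_val (L1 @ \<alpha> # M @ \<beta> # L2) = list_val ((L1 @ M) @ [\<alpha>, \<beta>] @ L2)"
    by (simp add: add.assoc flip: add.assoc)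
  also have "\<dots> = list_val ((L1 @ M) @ [] @ L2)"
    using proper[of \<alpha>] by (intro list_val_move) (auto simp: \<alpha> \<beta> proper_arrow_def intro: arrow_move.cancel)
  finally show ?thesis by simp
qed

text \<open>Adjacency on \<open>a\<close> and \<open>b\<close> lets \<open>\<alpha>\<close> pass
  \<open>M\<close>, adjacency on \<open>b\<close> and \<open>c\<close> lets \<open>\<delta>\<close>
  pass \<open>N\<close>, so the three arrows become consecutive around \<open>\<beta>\<close>. The
  second conclusion makes the new list usable as a linearization after the move.\<close>

lemma Omega3_val:
  assumes G: "G \<in> bGD n" "linearization G (L1 @ \<alpha> # M @ \<beta> # N @ \<delta> # L2)"
    and \<alpha>: "\<alpha> = \<lparr>tail = (a, x), head = (b, y), arrow_sign = e\<rparr>"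
    and \<beta>: "\<beta> = \<lparr>tail = (a, x'), head = (c, z), arrow_sign = e\<rparr>"
    and \<delta>: "\<delta> = \<lparr>tail = (b, y'), head = (c, z'), arrow_sign = e\<rparr>"
    and \<alpha>': "\<alpha>' = \<lparr>tail = (a, x'), head = (b, y'), arrow_sign = e\<rparr>"
    and \<beta>': "\<beta>' = \<lparr>tail = (a, x), head = (c, z'), arrow_sign = e\<rparr>"
    and \<delta>': "\<delta>' = \<lparr>tail = (b, y), head = (c, z), arrow_sign = e\<rparr>"
    and abc: "distinct [a, b, c]"
    and adj: "adjacent G a x x'" "adjacent G b y y'" "adjacent G c z z'"
  shows "list_val (L1 @ \<alpha> # M @ \<beta> # N @ \<delta> # L2) = list_val (L1 @ M @ [\<delta>', \<beta>', \<alpha>'] @ N @ L2)"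
    and "sorted_wrt precedes (L1 @ M @ [\<delta>', \<beta>', \<alpha>'] @ N @ L2)"
proof -
  have sorted: "sorted_wrt precedes (L1 @ \<alpha> # M @ \<beta> # N @ \<delta> # L2)"
    and set: "set (L1 @ \<alpha> # M @ \<beta> # N @ \<delta> # L2) = arrows G"
    using G by (auto simp: linearization_def)
  have proper: "proper_arrow n \<gamma>" if "\<gamma> \<in> set (L1 @ \<alpha> # M @ \<beta> # N @ \<delta> # L2)" for \<gamma>
    using that bGD_proper[OF G] by blast
  have M: "(a, w) \<notin> arrow_ends \<gamma>" "(b, w) \<notin> arrow_ends \<gamma>" if "\<gamma> \<in> set M" for \<gamma> w
  proof -
    have \<gamma>: "precedes \<alpha> \<gamma>" "precedes \<gamma> \<beta>" "precedes \<gamma> \<delta>" "\<gamma> \<in> arrows G"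
      using that sorted set by (auto simp: sorted_wrt_append)
    show "(a, w) \<notin> arrow_ends \<gamma>" "(b, w) \<notin> arrow_ends \<gamma>"
      using not_between_adjacent[OF \<gamma>(4) adj(1) \<gamma>(1,2)] not_between_adjacent[OF \<gamma>(4) adj(2) \<gamma>(1,3)]
      by (auto simp: \<alpha> \<beta> \<delta>)
  qed
  have N: "(b, w) \<notin> arrow_ends \<gamma>" "(c, w) \<notin> arrow_ends \<gamma>" if "\<gamma> \<in> set N" for \<gamma> w
  proof -
    have \<gamma>: "precedes \<alpha> \<gamma>" "precedes \<beta> \<gamma>" "precedes \<gamma> \<delta>" "\<gamma> \<in> arrows G"
      using that sorted set by (auto simp: sorted_wrt_append)
    show "(b, w) \<notin> arrow_ends \<gamma>" "(c, w) \<notin> arrow_ends \<gamma>"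
      using not_between_adjacent[OF \<gamma>(4) adj(2) \<gamma>(1,3)] not_between_adjacent[OF \<gamma>(4) adj(3) \<gamma>(2,3)]
      by (auto simp: \<alpha> \<beta> \<delta>)
  qed
  have "list_val (\<alpha> # M) = list_val (M @ [\<alpha>])"
    using proper M by (intro list_val_move_right) (auto simp: \<alpha>)
  moreover have "list_val (\<delta> # N) = list_val (N @ [\<delta>])"
    using proper N by (intro list_val_move_right) (auto simp: \<delta>)
  ultimately have "list_val (L1 @ \<alpha> # M @ \<beta> # N @ \<delta> # L2) = list_val ((L1 @ M) @ [\<alpha>, \<beta>, \<delta>] @ (N @ L2))"
    by (simp add: add.assoc flip: add.assoc)
  also have "\<dots> = list_val ((L1 @ M) @ [\<delta>', \<beta>', \<alpha>'] @ (N @ L2))"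
    using proper[of \<alpha>] proper[of \<beta>] abc
    by (intro list_val_move) (auto simp: \<alpha> \<beta> \<delta> \<alpha>' \<beta>' \<delta>' proper_arrow_def intro!: arrow_move.triangle)
  finally show "list_val (L1 @ \<alpha> # M @ \<beta> # N @ \<delta> # L2) = list_val (L1 @ M @ [\<delta>', \<beta>', \<alpha>'] @ N @ L2)"
    by simp
  show "sorted_wrt precedes (L1 @ M @ [\<delta>', \<beta>', \<alpha>'] @ N @ L2)"
    using sorted abc M N
    by (auto simp: sorted_wrt_append \<alpha> \<beta> \<delta> \<alpha>' \<beta>' \<delta>' precedes_arrow) (blast+)
qed

text \<open>Adjacency keeps \<open>M\<close> away from the interval \<open>a\<close> only; its
  arrows may meet the intervals of the heads. The linearization \<open>L'\<close> after the move
  decides which arrows of \<open>M\<close> go before both tails (\<open>lo\<close>) and which behind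
  (\<open>hi\<close>). Its existence excludes a chain of arrows in \<open>M\<close> leading from
  \<open>h\<close> to \<open>h'\<close>.\<close>

lemma TC_val:
  assumes G: "G \<in> bGD n" "linearization G (L1 @ \<alpha> # M @ \<beta> # L2)"
    and G': "G' \<in> bGD n" "linearization G' L'"
    and arrows: "arrows G = insert \<alpha> (insert \<beta> R)" "arrows G' = insert \<alpha>' (insert \<beta>' R)"
    and R: "\<alpha> \<notin> R" "\<beta> \<notin> R"
    and \<alpha>: "\<alpha> = \<lparr>tail = (a, x), head = h, arrow_sign = e\<rparr>"
    and \<beta>: "\<beta> = \<lparr>tail = (a, x'), head = h', arrow_sign = e'\<rparr>"
    and \<alpha>': "\<alpha>' = \<lparr>tail = (a, x'), head = h, arrow_sign = e\<rparr>"
    and \<beta>': "\<beta>' = \<lparr>tail = (a, x), head = h', arrow_sign = e'\<rparr>"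
    and abc: "distinct [a, fst h, fst h']"
    and adj: "adjacent G a x x'"
  shows "list_val (L1 @ \<alpha> # M @ \<beta> # L2) = list_val L'"
proof -
  have sorted: "sorted_wrt precedes (L1 @ \<alpha> # M @ \<beta> # L2)"
    and set: "set (L1 @ \<alpha> # M @ \<beta> # L2) = arrows G"
    using G by (auto simp: linearization_def)
  have sorted': "sorted_wrt precedes L'" and set': "set L' = arrows G'"
    using G' by (auto simp: linearization_def)
  have proper: "proper_arrow n \<gamma>" if "\<gamma> \<in> arrows G" for \<gamma>
    using that bGD_properties(3)[OF G(1)] by blast
  have proper': "proper_arrow n \<gamma>" if "\<gamma> \<in> arrows G'" for \<gamma>
    using that bGD_properties(3)[OF G'(1)] by blast
  have "distinct (L1 @ \<alpha> # M @ \<beta> # L2)" by (rule sorted_wrt_precedes_distinct[OF sorted])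
  then have setR: "set L1 \<union> set M \<union> set L2 = R"
    using set arrows(1) R
    by (intro set_remaining2[of _ \<alpha> _ \<beta>]) (simp_all only: Un_insert_right Un_empty_right not_False_eq_True)
  have "x < x'" using sorted by (auto simp: sorted_wrt_append \<alpha> \<beta> precedes_arrow)
  have "\<beta>' \<noteq> \<alpha>'" using abc by (auto simp: \<alpha>' \<beta>')
  then obtain K1 K K2 where "L' = K1 @ \<beta>' # K @ \<alpha>' # K2 \<or> L' = K1 @ \<alpha>' # K @ \<beta>' # K2"
    using two_elements_split[of \<beta>' L' \<alpha>'] set' arrows by auto
  moreover have "\<not> precedes \<alpha>' \<beta>'" using \<open>x < x'\<close> by (auto simp: \<alpha>' \<beta>' precedes_arrow)
  ultimately have L': "L' = K1 @ \<beta>' # K @ \<alpha>' # K2"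
    using sorted' by (auto simp: sorted_wrt_append)
  have "distinct L'" by (rule sorted_wrt_precedes_distinct[OF sorted'])
  have MR: "\<gamma> \<in> set K1 \<union> set K \<union> set K2" if "\<gamma> \<in> set M" for \<gamma>
  proof -
    have "(a, w) \<notin> arrow_ends \<gamma>" for w
      using not_between_adjacent[OF _ adj, of \<gamma> \<alpha> \<beta>] that sorted set
      by (auto simp: sorted_wrt_append \<alpha> \<beta>)
    moreover have "(a, x') \<in> arrow_ends \<alpha>'" "(a, x) \<in> arrow_ends \<beta>'" by (auto simp: \<alpha>' \<beta>')
    ultimately have "\<gamma> \<noteq> \<alpha>'" "\<gamma> \<noteq> \<beta>'" by metis+
    moreover have "\<gamma> \<in> arrows G'" using that setR arrows by auto
    ultimately show ?thesis using set' L' by auto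
  qed
  have Ma: "(a, w) \<notin> arrow_ends \<gamma>" if "\<gamma> \<in> set M" for \<gamma> w
    using not_between_adjacent[OF _ adj, of \<gamma> \<alpha> \<beta>] that sorted set
    by (auto simp: sorted_wrt_append \<alpha> \<beta>)
  define lo where "lo = filter (\<lambda>\<gamma>. \<gamma> \<notin> set K2) M"
  define hi where "hi = filter (\<lambda>\<gamma>. \<gamma> \<in> set K2) M"
  have lo: "precedes \<gamma> \<alpha>'" "\<gamma> \<in> set M" if "\<gamma> \<in> set lo" for \<gamma>
    using that MR[of \<gamma>] sorted' by (auto simp: lo_def L' sorted_wrt_append)
  have hi: "precedes \<beta>' \<gamma>" "precedes \<alpha>' \<gamma>" "\<gamma> \<in> set M" if "\<gamma> \<in> set hi" for \<gamma>
    using that sorted' by (auto simp: hi_def L' sorted_wrt_append)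
  have lohi: "precedes \<gamma> \<gamma>'" if "\<gamma> \<in> set lo" "\<gamma>' \<in> set hi" for \<gamma> \<gamma>'
    using that MR[of \<gamma>] sorted' by (auto simp: lo_def hi_def L' sorted_wrt_append)
  have sortedM: "sorted_wrt precedes lo" "sorted_wrt precedes hi"
    using sorted by (auto simp: lo_def hi_def sorted_wrt_append intro: sorted_wrt_filter)
  have setM: "set lo \<union> set hi = set M" by (auto simp: lo_def hi_def)
  have M: "precedes \<gamma> \<beta>" "precedes \<alpha> \<gamma>" if "\<gamma> \<in> set M" for \<gamma>
    using that sorted by (auto simp: sorted_wrt_append)
  \<comment> \<open>An arrow of \<open>lo\<close> comes after \<open>\<alpha>\<close> and before
    \<open>\<alpha>'\<close>, which have the same head, and it avoids \<open>a\<close>; so it shares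
    no interval with \<open>\<alpha>\<close>. In the same way \<open>hi\<close> shares none with
    \<open>\<beta>\<close>.\<close>
  have 1: "sorted_wrt precedes (L1 @ lo @ [\<alpha>, \<beta>] @ hi @ L2)"
    using sorted sortedM setM lohi lo hi M Ma
    by (auto simp: sorted_wrt_append) (auto simp: \<alpha> \<beta> \<alpha>' \<beta>' precedes_arrow)
  have L1: "precedes \<gamma> \<beta>'" "precedes \<gamma> \<alpha>'" if "\<gamma> \<in> set L1" for \<gamma>
  proof -
    have "precedes \<gamma> \<alpha>" "precedes \<gamma> \<beta>" using that sorted by (auto simp: sorted_wrt_append)
    then show "precedes \<gamma> \<beta>'" "precedes \<gamma> \<alpha>'" by (auto simp: \<alpha> \<beta> \<alpha>' \<beta>' precedes_arrow)
  qed
  have L2: "precedes \<beta>' \<gamma>" "precedes \<alpha>' \<gamma>" if "\<gamma> \<in> set L2" for \<gamma>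
  proof -
    have "precedes \<alpha> \<gamma>" "precedes \<beta> \<gamma>" using that sorted by (auto simp: sorted_wrt_append)
    then show "precedes \<beta>' \<gamma>" "precedes \<alpha>' \<gamma>" by (auto simp: \<alpha> \<beta> \<alpha>' \<beta>' precedes_arrow)
  qed
  have lo\<beta>: "precedes \<gamma> \<beta>'" if "\<gamma> \<in> set lo" for \<gamma>
  proof -
    have "precedes \<gamma> \<beta>" using M lo that by blast
    then show ?thesis using Ma[OF lo(2)[OF that]] by (auto simp: \<beta> \<beta>' precedes_arrow)
  qed
  have "precedes \<beta>' \<alpha>'" using \<open>x < x'\<close> abc by (auto simp: \<alpha>' \<beta>' precedes_arrow)
  then have 2: "sorted_wrt precedes (L1 @ lo @ [\<beta>', \<alpha>'] @ hi @ L2)"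
    using sorted sortedM setM lohi lo lo\<beta> hi L1 L2 by (auto simp: sorted_wrt_append)
  have "list_val (L1 @ \<alpha> # M @ \<beta> # L2) = list_val (L1 @ lo @ [\<alpha>, \<beta>] @ hi @ L2)"
    using sorted 1 setM set proper by (intro list_val_unique) auto
  also have "\<dots> = list_val ((L1 @ lo) @ [\<alpha>, \<beta>] @ (hi @ L2))" by simp
  also have "\<dots> = list_val ((L1 @ lo) @ [\<beta>', \<alpha>'] @ (hi @ L2))"
    using proper[of \<alpha>] proper[of \<beta>] abc arrows
    by (intro list_val_move) (auto simp: \<alpha> \<beta> \<alpha>' \<beta>' proper_arrow_def intro!: arrow_move.tails)
  also have "\<dots> = list_val (L1 @ lo @ [\<beta>', \<alpha>'] @ hi @ L2)" by simp
  also have "\<dots> = list_val L'"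
    using sorted' 2 proper' setM setR set' arrows by (intro list_val_unique) auto
  finally show ?thesis .
qed

lemma gauss_move_val:
  assumes "gauss_move G G'" "G \<in> bGD n" "G' \<in> bGD n"
  shows "gauss_val G = gauss_val G'"
proof -
  obtain L where L: "linearization G L" using bGD_linearization[OF assms(2)] by auto
  then have sorted: "sorted_wrt precedes L" and set: "set L = arrows G"
    by (auto simp: linearization_def)
  have distinct: "distinct L" by (rule sorted_wrt_precedes_distinct[OF sorted])
  obtain L' where L': "linearization G' L'" using bGD_linearization[OF assms(3)] by auto
  then have sorted': "sorted_wrt precedes L'" and set': "set L' = arrows G'"
    by (auto simp: linearization_def)
  have proper': "proper_arrow n \<gamma>" if "\<gamma> \<in> set L'" for \<gamma>
    using that bGD_proper[OF assms(3) L'] by blast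
  have "label G' = label G" using assms(1) by cases auto
  moreover have "list_val L = list_val L'"
    using assms(1)
  proof cases
    case (Omega2 R a x b y e x' y')
    let ?\<alpha> = "\<lparr>tail = (a, x), head = (b, y), arrow_sign = e\<rparr>"
    let ?\<beta> = "\<lparr>tail = (a, x'), head = (b, y'), arrow_sign = - e\<rparr>"
    have ne: "?\<alpha> \<noteq> ?\<beta>" using assms(2) bGD_properties(3)[OF assms(2), of ?\<alpha>] Omega2
      by (auto simp: proper_arrow_def arrow_types_def)
    have sym: "adjacent G i v u" if "adjacent G i u v" for i u v
      using that by (simp add: adjacent_def min.commute max.commute)
    have finish: "list_val (L1 @ M @ L2) = list_val L'"
      if "sorted_wrt precedes (L1 @ M @ L2)" "set L1 \<union> set M \<union> set L2 = R" for L1 M L2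
      using that set' Omega2(2) by (intro list_val_unique[OF _ sorted' _ proper']) auto
    have "?\<alpha> \<in> set L" "?\<beta> \<in> set L" using set Omega2(1) by auto
    \<comment> \<open>The move does not say which of the two arrows comes first; the second order is
      the first one with the opposite sign.\<close>
    from two_elements_split[OF this ne]
    consider L1 M L2 where "L = L1 @ ?\<alpha> # M @ ?\<beta> # L2" | L1 M L2 where "L = L1 @ ?\<beta> # M @ ?\<alpha> # L2"
      by blast
    then show ?thesis
    proof cases
      case 1
      have "set L1 \<union> set M \<union> set L2 = R"
        by (rule set_remaining2[OF distinct[unfolded 1] set[unfolded 1 Omega2(1)] Omega2(4,5)])
      moreover have "sorted_wrt precedes (L1 @ M @ L2)"
        using sorted unfolding 1 by (auto simp: sorted_wrt_append)
      ultimately show ?thesis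
        using finish Omega2_val[OF assms(2) L[unfolded 1] refl refl Omega2(7,8)] unfolding 1 by simp
    next
      case 2
      have "set L1 \<union> set M \<union> set L2 = R"
        by (rule set_remaining2[OF distinct[unfolded 2] set[unfolded 2 Omega2(1) insert_commute[of ?\<alpha>]] Omega2(5,4)])
      moreover have "sorted_wrt precedes (L1 @ M @ L2)"
        using sorted unfolding 2 by (auto simp: sorted_wrt_append)
      moreover have "?\<alpha> = \<lparr>tail = (a, x), head = (b, y), arrow_sign = - (- e)\<rparr>" by simp
      ultimately show ?thesis
        using finish Omega2_val[OF assms(2) L[unfolded 2] refl _ sym sym, OF _ Omega2(7,8)] unfolding 2 by simp
    qed
  next
    case (Omega3 R a x b y e x' c z y' z')
    let ?\<alpha> = "\<lparr>tail = (a, x), head = (b, y), arrow_sign = e\<rparr>"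
    let ?\<beta> = "\<lparr>tail = (a, x'), head = (c, z), arrow_sign = e\<rparr>"
    let ?\<delta> = "\<lparr>tail = (b, y'), head = (c, z'), arrow_sign = e\<rparr>"
    \<comment> \<open>The inequalities on the intervals \<open>a\<close> and \<open>c\<close> force
      the order of the three arrows in every linearization.\<close>
    have np: "\<not> precedes ?\<beta> ?\<alpha>" "\<not> precedes ?\<delta> ?\<beta>"
      using Omega3 by (auto simp: precedes_arrow)
    have "?\<alpha> \<noteq> ?\<beta>" "?\<delta> \<noteq> ?\<beta>" "?\<delta> \<noteq> ?\<alpha>" using Omega3 by auto
    with two_elements_split[of ?\<alpha> L ?\<beta>] obtain L1 M K where
      1: "L = L1 @ ?\<alpha> # M @ ?\<beta> # K"
      using set Omega3(1) sorted np(1) by (auto simp: sorted_wrt_append)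
    have "?\<delta> \<in> set L" using set Omega3(1) by auto
    then have "?\<delta> \<in> set K"
      using 1 sorted np \<open>?\<delta> \<noteq> ?\<beta>\<close> \<open>?\<delta> \<noteq> ?\<alpha>\<close> by (auto simp: sorted_wrt_append)
    then obtain N L2 where "K = N @ ?\<delta> # L2" by (metis in_set_conv_decomp)
    with 1 have LL: "L = L1 @ ?\<alpha> # M @ ?\<beta> # N @ ?\<delta> # L2" by simp
    note * = Omega3_val[OF assms(2) L[unfolded LL] refl refl refl refl refl refl]
    let ?L = "L1 @ M @ [\<lparr>tail = (b, y), head = (c, z), arrow_sign = e\<rparr>, \<lparr>tail = (a, x), head = (c, z'), arrow_sign = e\<rparr>,
       \<lparr>tail = (a, x'), head = (b, y'), arrow_sign = e\<rparr>] @ N @ L2"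
    have "list_val L = list_val ?L"
      unfolding LL using Omega3 by (intro *) auto
    also have "\<dots> = list_val L'"
    proof (rule list_val_unique[OF _ sorted' _ proper'])
      show "sorted_wrt precedes ?L" using Omega3 by (intro *) auto
      have "set L1 \<union> set M \<union> set N \<union> set L2 = R"
        by (rule set_remaining3[OF distinct[unfolded LL] set[unfolded LL Omega3(1)] Omega3(4-6)])
      then show "set ?L = set L'" using set' Omega3(2) by auto
    qed
    finally show ?thesis .
  next
    case (TC R a x h e x' h' e')
    let ?\<alpha> = "\<lparr>tail = (a, x), head = h, arrow_sign = e\<rparr>"
    let ?\<beta> = "\<lparr>tail = (a, x'), head = h', arrow_sign = e'\<rparr>"
    have ne: "?\<alpha> \<noteq> ?\<beta>" using TC(6) by auto
    have arr: "arrows G = insert ?\<alpha> (insert ?\<beta> R)" "arrows G = insert ?\<beta> (insert ?\<alpha> R)"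
      "arrows G' = insert \<lparr>tail = (a, x'), head = h, arrow_sign = e\<rparr> (insert \<lparr>tail = (a, x), head = h', arrow_sign = e'\<rparr> R)"
      "arrows G' = insert \<lparr>tail = (a, x), head = h', arrow_sign = e'\<rparr> (insert \<lparr>tail = (a, x'), head = h, arrow_sign = e\<rparr> R)"
      unfolding TC(1,2) by blast+
    have sym: "adjacent G a x' x"
      using TC(7) by (simp add: adjacent_def min.commute max.commute)
    have "?\<alpha> \<in> set L" "?\<beta> \<in> set L" unfolding set TC(1) by blast+
    from two_elements_split[OF this ne]
    consider L1 M L2 where "L = L1 @ ?\<alpha> # M @ ?\<beta> # L2" | L1 M L2 where "L = L1 @ ?\<beta> # M @ ?\<alpha> # L2"
      by blast
    then show ?thesis
    proof cases
      case 1
      show ?thesis unfolding 1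
        by (rule TC_val[OF assms(2) L[unfolded 1] assms(3) L' arr(1,3) _ _ refl refl refl refl]) (use TC(4-7) in auto)
    next
      case 2
      show ?thesis unfolding 2
        by (rule TC_val[OF assms(2) L[unfolded 2] assms(3) L' arr(2,4) _ _ refl refl refl refl]) (use TC(4-6) sym in auto)
    qed
  qed
  ultimately show ?thesis
    using gauss_val_eq[OF assms(2) L] gauss_val_eq[OF assms(3) L'] by simp
qed

text \<open>Increasing maps of the intervals carry a linearization to a linearization with the same
  arrow types.\<close>

lemma reparametrize_val:
  assumes "reparametrization \<phi>" "G \<in> bGD n" "reparametrize \<phi> G \<in> bGD n"
  shows "gauss_val (reparametrize \<phi> G) = gauss_val G"
proof -
  obtain L where L: "linearization G L" using bGD_linearization[OF assms(2)] by auto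
  let ?m = "map_arrow (\<lambda>(i, x). (i, \<phi> i x))"
  have ends: "arrow_ends (?m \<alpha>) = (\<lambda>(i, x). (i, \<phi> i x)) ` arrow_ends \<alpha>" for \<alpha>
    by (simp add: arrow_ends_def map_arrow_def)
  have "precedes (?m \<alpha>) (?m \<beta>)" if "precedes \<alpha> \<beta>" "\<alpha> \<in> set L" "\<beta> \<in> set L" for \<alpha> \<beta>
  proof -
    have "\<phi> i u < \<phi> i v" if "(i, u) \<in> arrow_ends \<alpha>" "(i, v) \<in> arrow_ends \<beta>" for i u v
    proof -
      have "u \<in> {0..1}" "v \<in> {0..1}"
        using bGD_proper[OF assms(2) L \<open>\<alpha> \<in> set L\<close>] bGD_proper[OF assms(2) L \<open>\<beta> \<in> set L\<close>] that
        by (force simp: proper_arrow_def)+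
      moreover have "u < v" using \<open>precedes \<alpha> \<beta>\<close> that by (auto simp: precedes_def)
      ultimately show ?thesis using reparametrization_less_iff[OF assms(1)] by auto
    qed
    then show ?thesis unfolding precedes_def ends by auto
  qed
  then have "sorted_wrt precedes (map ?m L)"
    using L unfolding linearization_def sorted_wrt_map by (auto intro: sorted_wrt_mono_rel[rotated])
  then have "linearization (reparametrize \<phi> G) (map ?m L)"
    using L by (auto simp: linearization_def reparametrize_def)
  moreover have "map arrow_type (map ?m L) = map arrow_type L"
    by (auto simp: arrow_type_def map_arrow_def split_beta)
  then have "list_val (map ?m L) = list_val L" by (simp only:)
  moreover have "label (reparametrize \<phi> G) = label G" by (simp add: reparametrize_def)
  ultimately show ?thesis
    using gauss_val_eq[OF assms(2) L] gauss_val_eq[OF assms(3), of "map ?m L"] by (simp only:)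
qed

lemma wReidemeister_eq_val:
  "(G, G') \<in> wReidemeister_eq n \<Longrightarrow> gauss_val G = gauss_val G'"
  unfolding wReidemeister_eq_def
proof (induction rule: rtrancl_induct)
  case (step G' G'')
  have "gauss_val H = gauss_val H'" if "(H, H') \<in> wReidemeister_step n" for H H'
    using that gauss_move_val reparametrize_val unfolding wReidemeister_step_def by fastforce
  with step show ?case by auto
qed simp

end

section \<open>Concatenation of Gauss diagrams\<close>

lemma concat_gauss_linearization:
  assumes G: "G \<in> bGD n" "linearization G L" and G': "G' \<in> bGD n" "linearization G' L'"
  defines "M \<equiv> map (map_arrow (\<lambda>(i, x). (i, x / 2))) L @
    map (map_arrow (\<lambda>(j, x). (inv_into UNIV (label G) j, (1 + x) / 2))) L'"
  shows "concat_gauss G G' \<in> bGD n" "linearization (concat_gauss G G') M"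
    "map arrow_type M = map arrow_type L @ relabel (inv_into UNIV (label G)) (map arrow_type L')"
proof -
  let ?f = "map_arrow (\<lambda>(i, x). (i, x / 2))"
  let ?g = "map_arrow (\<lambda>(j, x). (inv_into UNIV (label G) j, (1 + x) / 2))"
  let ?p = "inv_into UNIV (label G)"
  have p: "?p permutes {1..n}" by (rule permutes_inv[OF bGD_properties(2)[OF G(1)]])
  have inj: "?p i = ?p j \<longleftrightarrow> i = j" for i j by (rule inj_eq[OF permutes_inj[OF p]])
  have ends: "arrow_ends (?f \<alpha>) = (\<lambda>(i, x). (i, x / 2)) ` arrow_ends \<alpha>"
    "arrow_ends (?g \<alpha>) = (\<lambda>(j, x). (?p j, (1 + x) / 2)) ` arrow_ends \<alpha>" for \<alpha>
    by (auto simp: arrow_ends_def map_arrow_def)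
  have range: "0 < x" "x < 1" "1 \<le> i" "i \<le> n" if "\<alpha> \<in> set L \<union> set L'" "(i, x) \<in> arrow_ends \<alpha>" for \<alpha> i x
    using that bGD_proper[OF G] bGD_proper[OF G'] by (force simp: proper_arrow_def)+
  have "sorted_wrt precedes (map ?f L)" "sorted_wrt precedes (map ?g L')"
    using G(2) G'(2) unfolding sorted_wrt_map linearization_def
    by (auto elim!: sorted_wrt_mono_rel[rotated] simp: precedes_def ends inj)
  moreover have "precedes (?f \<alpha>) (?g \<beta>)" if "\<alpha> \<in> set L" "\<beta> \<in> set L'" for \<alpha> \<beta>
    unfolding precedes_def ends using range that by fastforce
  ultimately have "sorted_wrt precedes M"
    by (auto simp: M_def sorted_wrt_append)
  then show lin: "linearization (concat_gauss G G') M"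
    using G(2) G'(2) by (auto simp: linearization_def concat_gauss_def M_def)
  show types: "map arrow_type M = map arrow_type L @ relabel ?p (map arrow_type L')"
    by (auto simp: M_def relabel_def arrow_type_def map_arrow_def split_beta)
  have "set (map arrow_type M) \<subseteq> arrow_types n"
    unfolding types using relabel_arrow_types[OF p bGD_types[OF G']] bGD_types[OF G] by auto
  moreover have "arrow_ends \<alpha> \<subseteq> {1..n} \<times> {0<..<1}" if "\<alpha> \<in> set M" for \<alpha>
  proof -
    have 1: "arrow_ends (?f \<beta>) \<subseteq> {1..n} \<times> {0<..<1}" if "\<beta> \<in> set L" for \<beta>
      unfolding ends using range that by fastforce
    have 2: "arrow_ends (?g \<beta>) \<subseteq> {1..n} \<times> {0<..<1}" if "\<beta> \<in> set L'" for \<beta>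
      unfolding ends using range that permutes_in_image[OF p] by fastforce
    from that consider \<beta> where "\<beta> \<in> set L" "\<alpha> = ?f \<beta>" | \<beta> where "\<beta> \<in> set L'" "\<alpha> = ?g \<beta>"
      by (auto simp: M_def)
    then show ?thesis using 1 2 by cases simp_all
  qed
  ultimately have "proper_arrow n \<alpha>" if "\<alpha> \<in> set M" for \<alpha>
    using that by (auto simp: proper_arrow_def)
  moreover have "label (concat_gauss G G') permutes {1..n}"
    using permutes_compose[OF bGD_properties(2)[OF G(1)] bGD_properties(2)[OF G'(1)]]
    by (simp add: concat_gauss_def)
  ultimately show "concat_gauss G G' \<in> bGD n" by (intro bGD_I[OF lin]) auto
qed

text \<open>As in \<open>val_eq\<close>, the permutation of \<open>G\<close> is moved past the
  arrows of \<open>G'\<close>, which undoes their renaming by the inverse label.\<close>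

lemma (in welded_representation) concat_gauss_val:
  assumes "G \<in> bGD n" "G' \<in> bGD n"
  shows "gauss_val (concat_gauss G G') = gauss_val G + gauss_val G'"
proof -
  obtain L L' where L: "linearization G L" "linearization G' L'"
    using bGD_linearization assms by blast
  let ?p = "label G"
  note c = concat_gauss_linearization[OF assms(1) L(1) assms(2) L(2)]
  have p: "?p permutes {1..n}" "label G' permutes {1..n}" using bGD_properties(2) assms by auto
  have "perm_val ?p + arrows_val (relabel ?p (relabel (inv_into UNIV ?p) (map arrow_type L'))) =
      arrows_val (relabel (inv_into UNIV ?p) (map arrow_type L')) + perm_val ?p"
    by (intro arrows_val_relabel p relabel_arrow_types permutes_inv bGD_types[OF assms(2) L(2)])
  then have *: "perm_val ?p + list_val L' = arrows_val (relabel (inv_into UNIV ?p) (map arrow_type L')) + perm_val ?p"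
    by (simp only: relabel_simps permutes_inv_o[OF p(1)])
  have "gauss_val (concat_gauss G G') =
      list_val L + arrows_val (relabel (inv_into UNIV ?p) (map arrow_type L')) + perm_val (label G' \<circ> ?p)"
    unfolding gauss_val_eq[OF c(1,2)] c(3) by (simp add: concat_gauss_def)
  also have "\<dots> = list_val L + (arrows_val (relabel (inv_into UNIV ?p) (map arrow_type L')) + perm_val ?p) + perm_val (label G')"
    using perm_val_comp[OF p] by (simp add: add.assoc)
  also have "\<dots> = gauss_val G + gauss_val G'"
    unfolding *[symmetric] gauss_val_eq[OF assms(1) L(1)] gauss_val_eq[OF assms(2) L(2)]
    by (simp add: add.assoc)
  finally show ?thesis .
qed


section \<open>The Gauss diagram of a strand diagram\<close>

text \<open>The recursion is unfolded crossing by crossing: the \<open>c\<close>-th letter is traced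
  back through the letters before it, as suits a diagram whose crossings are numbered from the
  left.\<close>

lemma word_arrows_concat:
  "word_arrows w = concat (map (\<lambda>c. relabel (inv_into UNIV (end_pos (take c w))) (letter_arrows (w ! c))) [0..<length w])"
proof -
  define F where "F w c = relabel (inv_into UNIV (end_pos (take c w))) (letter_arrows (w ! c))" for w c
  have "word_arrows w = concat (map (F w) [0..<length w])"
  proof (induction w rule: rev_induct)
    case (snoc l w)
    have "map (F (w @ [l])) [0..<length w] = map (F w) [0..<length w]"
      by (intro map_cong) (auto simp: nth_append F_def)
    moreover have "F (w @ [l]) (length w) = relabel (inv_into UNIV (end_pos w)) (letter_arrows l)"
      by (simp add: F_def)
    ultimately show ?case using snoc by (simp add: word_arrows_append del: map_eq_conv)
  qed simp
  then show ?thesis by (simp only: F_def[abs_def])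
qed

lemma sorted_wrt_concat:
  "sorted_wrt (\<lambda>l m. \<forall>a\<in>set l. \<forall>b\<in>set m. P a b) Ls \<Longrightarrow> (\<And>l. l \<in> set Ls \<Longrightarrow> sorted_wrt P l) \<Longrightarrow>
    sorted_wrt P (concat Ls)"
  by (induction Ls) (auto simp: sorted_wrt_append)

locale strands =
  fixes n :: nat and D :: strand_diagram
  assumes diagram: "D \<in> strand_diagrams n"
begin

abbreviation h :: "nat \<Rightarrow> real \<Rightarrow> real" where
  "h \<equiv> height D"

definition crossings :: "real set" where
  "crossings = fst ` double_points n D"

lemma continuous_h: "k \<in> {1..n} \<Longrightarrow> continuous_on {0..1} (h k)"
  and h_0: "k \<in> {1..n} \<Longrightarrow> h k 0 = real k"
  and h_1: "bij_betw (\<lambda>k. h k 1) {1..n} (real ` {1..n})"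
  and finite_double_points: "finite (double_points n D)"
  and card_double_point: "p \<in> double_points n D \<Longrightarrow> card {k\<in>{1..n}. p \<in> arc_points D k} = 2"
  and inj_fst: "inj_on fst (double_points n D)"
  and transversal: "x \<in> {0..1} \<Longrightarrow> k \<in> {1..n} \<Longrightarrow> l \<in> {1..n} \<Longrightarrow> k \<noteq> l \<Longrightarrow> h k x = h l x \<Longrightarrow>
    (above_before D k l x \<and> above_after D l k x) \<or> (above_before D l k x \<and> above_after D k l x)"
  using diagram unfolding strand_diagrams_def by blast+

lemma double_points_iff:
  "(x, y) \<in> double_points n D \<longleftrightarrow>
    x \<in> {0..1} \<and> (\<exists>k\<in>{1..n}. \<exists>l\<in>{1..n}. k \<noteq> l \<and> h k x = y \<and> h l x = y)"
proof -
  have "(x, y) \<in> arc_points D k \<longleftrightarrow> x \<in> {0..1} \<and> h k x = y" for k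
    by (auto simp: arc_points_def)
  then show ?thesis by (simp add: double_points_def) blast
qed

lemma double_pointI:
  assumes "x \<in> {0..1}" "k \<in> {1..n}" "l \<in> {1..n}" "k \<noteq> l" "h k x = h l x"
  shows "(x, h k x) \<in> double_points n D"
  unfolding double_points_iff using assms by (intro conjI bexI[of _ k] bexI[of _ l]) auto

lemma crossings_iff:
  "x \<in> crossings \<longleftrightarrow> x \<in> {0..1} \<and> (\<exists>k\<in>{1..n}. \<exists>l\<in>{1..n}. k \<noteq> l \<and> h k x = h l x)"
proof
  assume "x \<in> crossings"
  then obtain p where p: "p \<in> double_points n D" "x = fst p" unfolding crossings_def by blast
  then have "(x, snd p) \<in> double_points n D" by simp
  then obtain k l where "x \<in> {0..1}" "k \<in> {1..n}" "l \<in> {1..n}" "k \<noteq> l" "h k x = snd p" "h l x = snd p"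
    unfolding double_points_iff by blast
  then show "x \<in> {0..1} \<and> (\<exists>k\<in>{1..n}. \<exists>l\<in>{1..n}. k \<noteq> l \<and> h k x = h l x)"
    by (intro conjI bexI[of _ k] bexI[of _ l]) auto
next
  assume "x \<in> {0..1} \<and> (\<exists>k\<in>{1..n}. \<exists>l\<in>{1..n}. k \<noteq> l \<and> h k x = h l x)"
  then obtain k l where "x \<in> {0..1}" "k \<in> {1..n}" "l \<in> {1..n}" "k \<noteq> l" "h k x = h l x"
    by blast
  from imageI[OF double_pointI[OF this], of fst] show "x \<in> crossings" by (simp add: crossings_def)
qed

lemma crossingI:
  "x \<in> {0..1} \<Longrightarrow> k \<in> {1..n} \<Longrightarrow> l \<in> {1..n} \<Longrightarrow> k \<noteq> l \<Longrightarrow> h k x = h l x \<Longrightarrow> x \<in> crossings"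
  unfolding crossings_iff by (intro conjI bexI[of _ k] bexI[of _ l])

lemma crossingE:
  assumes "x \<in> crossings"
  obtains k l where "x \<in> {0..1}" "k \<in> {1..n}" "l \<in> {1..n}" "k \<noteq> l" "h k x = h l x"
  using assms unfolding crossings_iff by (elim conjE bexE)

lemma finite_crossings: "finite crossings"
  unfolding crossings_def using finite_double_points by simp

lemma h_1_inj: "k \<in> {1..n} \<Longrightarrow> l \<in> {1..n} \<Longrightarrow> h k 1 = h l 1 \<longleftrightarrow> k = l"
  using inj_on_eq_iff[OF bij_betw_imp_inj_on[OF h_1]] by simp

lemma crossing_range: "x \<in> crossings \<Longrightarrow> 0 < x \<and> x < 1"
proof -
  assume "x \<in> crossings"
  then obtain k l where kl: "x \<in> {0..1}" "k \<in> {1..n}" "l \<in> {1..n}" "k \<noteq> l" "h k x = h l x"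
    by (rule crossingE)
  moreover from this have "x \<noteq> 0" "x \<noteq> 1"
    using h_0[of k] h_0[of l] h_1_inj[of k l] by auto
  ultimately show ?thesis by auto
qed

text \<open>Injectivity of \<open>fst\<close> leaves one double point above each abscissa, and
  exactly two arcs pass through it.\<close>

lemma crossing_unique:
  assumes "x \<in> {0..1}" "k \<in> {1..n}" "l \<in> {1..n}" "k \<noteq> l" "h k x = h l x"
    "k' \<in> {1..n}" "l' \<in> {1..n}" "k' \<noteq> l'" "h k' x = h l' x"
  shows "h k' x = h k x" "{k', l'} = {k, l}"
proof -
  have p: "(x, h k x) \<in> double_points n D" "(x, h k' x) \<in> double_points n D"
    using assms by (auto intro: double_pointI)
  show eq: "h k' x = h k x"
    using inj_onD[OF inj_fst _ p] by simp
  let ?S = "{m\<in>{1..n}. (x, h k x) \<in> arc_points D m}"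
  have "card ?S = 2" by (rule card_double_point[OF p(1)])
  have *: "{a, b} = ?S" if "a \<noteq> b" "{a, b} \<subseteq> ?S" for a b
    using that \<open>card ?S = 2\<close> by (intro card_subset_eq) auto
  have "{k, l} \<subseteq> ?S" "{k', l'} \<subseteq> ?S"
    using assms eq by (auto simp: arc_points_def)
  then show "{k', l'} = {k, l}" using *[OF assms(4)] *[OF assms(8)] by simp
qed

section \<open>The vertical order of the arcs between and at crossings\<close>

lemma order_constant:
  assumes "k \<in> {1..n}" "l \<in> {1..n}" "0 \<le> a" "a \<le> b" "b \<le> 1"
    "\<And>x. a \<le> x \<Longrightarrow> x \<le> b \<Longrightarrow> h k x \<noteq> h l x"
  shows "h k a < h l a \<longleftrightarrow> h k b < h l b"
proof -
  have *: "h k' b < h l' b" if "h k' a < h l' a" "{k', l'} = {k, l}" for k' l'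
  proof (rule ccontr)
    assume "\<not> h k' b < h l' b"
    have "k' \<in> {1..n}" "l' \<in> {1..n}" using that(2) assms(1,2) by (auto simp: doubleton_eq_iff)
    then have "continuous_on {0..1} (\<lambda>x. h k' x - h l' x)"
      by (intro continuous_on_diff continuous_h)
    then have kl: "continuous_on {a..b} (\<lambda>x. h k' x - h l' x)"
      by (rule continuous_on_subset) (use assms in auto)
    let ?I = "(\<lambda>x. h k' x - h l' x) ` {a..b}"
    have conn: "connected ?I"
      by (intro connected_continuous_image kl) simp
    have mem: "h k' a - h l' a \<in> ?I" "h k' b - h l' b \<in> ?I"
      by (rule imageI, simp add: assms)+
    have "0 \<in> ?I"
      by (rule connectedD_interval[OF conn mem]) (use \<open>\<not> h k' b < h l' b\<close> that(1) in simp_all)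
    then obtain x where x: "0 = h k' x - h l' x" "x \<in> {a..b}" by (rule imageE)
    have "h k x = h l x" using x(1) that(2) unfolding doubleton_eq_iff by auto
    then show False using assms(6)[of x] x(2) by simp
  qed
  have "h k b \<noteq> h l b" "h k a \<noteq> h l a" using assms by auto
  moreover have "{l, k} = {k, l}" by auto
  ultimately show ?thesis using *[of k l] *[of l k] by (meson linorder_neqE_linordered_idom order_less_asym)
qed

text \<open>Without a meeting in \<open>{t..<x}\<close> the order of the two arcs is constant there,
  so the germ at \<open>x\<close> can be read off at the single point \<open>t\<close>.\<close>

lemma above_before_iff:
  assumes "k \<in> {1..n}" "l \<in> {1..n}" "0 \<le> t" "t < x" "x \<le> 1"
    "\<And>s. t \<le> s \<Longrightarrow> s < x \<Longrightarrow> h k s \<noteq> h l s"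
  shows "above_before D k l x \<longleftrightarrow> h l t < h k t"
proof -
  have *: "h l s < h k s \<longleftrightarrow> h l t < h k t" if "t < s" "s < x" for s
  proof -
    have "h l t < h k t \<longleftrightarrow> h l s < h k s"
    proof (rule order_constant)
      show "h l y \<noteq> h k y" if "t \<le> y" "y \<le> s" for y
        using assms(6)[of y] that \<open>s < x\<close> by auto
    qed (use that assms in auto)
    then show ?thesis ..
  qed
  show ?thesis
  proof
    assume "above_before D k l x"
    then obtain b where "b < x" "\<And>s. b < s \<Longrightarrow> s < x \<Longrightarrow> h l s < h k s"
      unfolding above_before_def eventually_at_left[OF \<open>t < x\<close>] by blast
    moreover obtain s where "max b t < s" "s < x"
      using dense[of "max b t" x] \<open>b < x\<close> assms by auto
    ultimately show "h l t < h k t" using *[of s] by auto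
  next
    assume "h l t < h k t"
    then show "above_before D k l x"
      unfolding above_before_def eventually_at_left[OF \<open>t < x\<close>] using * assms(4) by (intro exI[of _ t]) auto
  qed
qed

lemma above_after_iff:
  assumes "k \<in> {1..n}" "l \<in> {1..n}" "0 \<le> x" "x < t" "t \<le> 1"
    "\<And>s. x < s \<Longrightarrow> s \<le> t \<Longrightarrow> h k s \<noteq> h l s"
  shows "above_after D k l x \<longleftrightarrow> h l t < h k t"
proof -
  have *: "h l s < h k s \<longleftrightarrow> h l t < h k t" if "x < s" "s < t" for s
  proof (rule order_constant)
    show "h l y \<noteq> h k y" if "s \<le> y" "y \<le> t" for y
      using assms(6)[of y] that \<open>x < s\<close> by auto
  qed (use that assms in auto)
  show ?thesis
  proof
    assume "above_after D k l x"
    then obtain b where "b > x" "\<And>s. x < s \<Longrightarrow> s < b \<Longrightarrow> h l s < h k s"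
      unfolding above_after_def eventually_at_right[OF \<open>x < t\<close>] by blast
    moreover obtain s where "x < s" "s < min b t"
      using dense[of x "min b t"] \<open>b > x\<close> assms by auto
    ultimately show "h l t < h k t" using *[of s] by auto
  next
    assume "h l t < h k t"
    then show "above_after D k l x"
      unfolding above_after_def eventually_at_right[OF \<open>x < t\<close>] using * assms(4) by (intro exI[of _ t]) auto
  qed
qed

lemma order_swaps:
  assumes "k \<in> {1..n}" "l \<in> {1..n}" "k \<noteq> l" "0 \<le> t" "t < x" "x < t'" "t' \<le> 1" "h k x = h l x"
    "\<And>s. t \<le> s \<Longrightarrow> s \<le> t' \<Longrightarrow> s \<noteq> x \<Longrightarrow> h k s \<noteq> h l s"
  shows "h k t < h l t \<longleftrightarrow> h l t' < h k t'"
proof -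
  have ne: "h l s \<noteq> h k s" if "t \<le> s" "s \<le> t'" "s \<noteq> x" for s using assms(9)[OF that] by simp
  have "above_before D k l x \<longleftrightarrow> h l t < h k t" "above_before D l k x \<longleftrightarrow> h k t < h l t"
    using assms ne by (intro above_before_iff; simp)+
  moreover have "above_after D k l x \<longleftrightarrow> h l t' < h k t'" "above_after D l k x \<longleftrightarrow> h k t' < h l t'"
    using assms ne by (intro above_after_iff; simp)+
  moreover have "x \<in> {0..1}" using assms by auto
  ultimately show ?thesis using transversal[of x k l] assms by auto
qed

text \<open>The position of the arc above \<open>t\<close>, counted from the bottom;
  \<open>\<le>\<close> includes the arc itself, so positions start at 1.\<close>

definition rank :: "real \<Rightarrow> nat \<Rightarrow> nat" where
  "rank t k = card {l\<in>{1..n}. h l t \<le> h k t}"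

lemma rank_inj:
  assumes "t \<in> {0..1}" "t \<notin> crossings" "k \<in> {1..n}" "l \<in> {1..n}" "rank t k = rank t l"
  shows "k = l"
proof (rule ccontr)
  assume "k \<noteq> l"
  then have ne: "h k t \<noteq> h l t" using assms(2) crossingI[OF assms(1,3,4)] by auto
  have *: "rank t a < rank t b" if "h a t < h b t" "b \<in> {1..n}" for a b
  proof -
    have "{l\<in>{1..n}. h l t \<le> h a t} \<subseteq> {l\<in>{1..n}. h l t \<le> h b t}" using that by auto
    moreover have "b \<in> {l\<in>{1..n}. h l t \<le> h b t} - {l\<in>{1..n}. h l t \<le> h a t}" using that by auto
    ultimately have "{l\<in>{1..n}. h l t \<le> h a t} \<subset> {l\<in>{1..n}. h l t \<le> h b t}" by blast
    then show ?thesis unfolding rank_def by (rule psubset_card_mono[rotated]) simp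
  qed
  from ne have "h k t < h l t \<or> h l t < h k t" by auto
  with *[of k l] *[of l k] assms(3-5) show False by auto
qed

lemma rank_0: "k \<in> {1..n} \<Longrightarrow> rank 0 k = k"
proof -
  assume k: "k \<in> {1..n}"
  then have "{l\<in>{1..n}. h l 0 \<le> h k 0} = {1..k}" by (auto simp: h_0)
  then show ?thesis by (simp add: rank_def)
qed

lemma rank_constant:
  assumes "0 \<le> t" "t \<le> t'" "t' \<le> 1" "{t..t'} \<inter> crossings = {}" "k \<in> {1..n}"
  shows "rank t k = rank t' k"
proof -
  have "h l t \<le> h k t \<longleftrightarrow> h l t' \<le> h k t'" if "l \<in> {1..n}" for l
  proof (cases "l = k")
    case False
    have ne: "h k s \<noteq> h l s" if "s \<in> {t..t'}" for s
    proof
      assume eq: "h k s = h l s"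
      have "s \<in> {0..1}" using that assms by auto
      then have "s \<in> crossings" using eq False assms(5) \<open>l \<in> {1..n}\<close> by (intro crossingI[of s k l]) auto
      then show False using that assms(4) by auto
    qed
    then have "h k t < h l t \<longleftrightarrow> h k t' < h l t'"
      using assms that by (intro order_constant) auto
    then show ?thesis by auto
  qed simp
  then show ?thesis unfolding rank_def by (metis (mono_tags, lifting) Collect_cong)
qed

text \<open>Every pair of arcs other than \<open>k\<close>, \<open>l\<close> keeps its order
  throughout the window. So the \<open>i - 1\<close> arcs below the crossing are the same on both
  sides, and only \<open>k\<close> and \<open>l\<close> exchange the positions \<open>i\<close> and
  \<open>i + 1\<close>.\<close>

lemma rank_crossing:
  assumes t: "0 \<le> t" "t < x" "x < t'" "t' \<le> 1" "{t..t'} \<inter> crossings = {x}"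
    and kl: "k \<in> {1..n}" "l \<in> {1..n}" "k \<noteq> l" "h k x = h l x" "h l t < h k t"
  defines "i \<equiv> card {m\<in>{1..n}. h m x < h k x} + 1"
  shows "rank t l = i" "rank t k = Suc i" "\<And>m. m \<in> {1..n} \<Longrightarrow> rank t' m = adj i (rank t m)"
proof -
  let ?A = "{m\<in>{1..n}. h m x < h k x}"
  have x01: "x \<in> {0..1}" using t(1-4) by auto
  have ne: "h a s \<noteq> h b s" if "s \<in> {t..t'}" "a \<in> {1..n}" "b \<in> {1..n}" "a \<noteq> b" "s \<noteq> x \<or> {a, b} \<noteq> {k, l}" for a b s
  proof
    assume eq: "h a s = h b s"
    have "s \<in> {0..1}" using that(1) t(1-4) by auto
    then have "s \<in> crossings" using eq that(2-4) by (intro crossingI[of s a b]) auto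
    then have "s \<in> {t..t'} \<inter> crossings" using that(1) by simp
    then have "s = x" unfolding t(5) by simp
    then show False using crossing_unique(2)[OF x01 kl(1-4), of a b] that(2-5) eq by simp
  qed
  have ord: "h a s < h b s \<longleftrightarrow> h a s' < h b s'"
    if "s \<in> {t..t'}" "s' \<in> {t..t'}" "a \<in> {1..n}" "b \<in> {1..n}" "{a, b} \<noteq> {k, l}" for a b s s'
  proof (cases "a = b")
    case False
    have *: "h a s < h b s \<longleftrightarrow> h a s' < h b s'" if "s \<le> s'" "s \<in> {t..t'}" "s' \<in> {t..t'}" for s s'
    proof (rule order_constant[OF \<open>a \<in> {1..n}\<close> \<open>b \<in> {1..n}\<close>])
      show "h a y \<noteq> h b y" if "s \<le> y" "y \<le> s'" for y
        using that \<open>s \<in> {t..t'}\<close> \<open>s' \<in> {t..t'}\<close> \<open>a \<in> {1..n}\<close> \<open>b \<in> {1..n}\<close> \<open>{a, b} \<noteq> {k, l}\<close> False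
        by (intro ne) auto
    qed (use that t(1,4) in auto)
    show ?thesis
    proof (cases "s \<le> s'")
      case True
      then show ?thesis by (rule *[OF _ that(1,2)])
    next
      case False
      then have "s' \<le> s" by simp
      from *[OF this that(2,1)] show ?thesis ..
    qed
  qed simp
  have tt: "t \<in> {t..t'}" "t' \<in> {t..t'}" "x \<in> {t..t'}" using t(2,3) by auto
  have swap: "h k t' < h l t'"
  proof -
    have "h l t < h k t \<longleftrightarrow> h k t' < h l t'"
    proof (rule order_swaps)
      show "h l s \<noteq> h k s" if "t \<le> s" "s \<le> t'" "s \<noteq> x" for s
        using that kl(1-3) by (intro ne) auto
    qed (use kl(1-4) t(1-4) in auto)
    with kl(5) show ?thesis by simp
  qed
  have A: "m \<in> ?A \<longleftrightarrow> h m t < h l t" "m \<in> ?A \<longleftrightarrow> h m t < h k t"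
     "m \<in> ?A \<longleftrightarrow> h m t' < h l t'" "m \<in> ?A \<longleftrightarrow> h m t' < h k t'" if "m \<in> {1..n}" "m \<noteq> k" "m \<noteq> l" for m
  proof -
    have "{m, k} \<noteq> {k, l}" "{m, l} \<noteq> {k, l}" using that kl(3) by (auto simp: doubleton_eq_iff)
    note * = ord[OF tt(3,1) that(1) kl(1) this(1)] ord[OF tt(3,1) that(1) kl(2) this(2)]
      ord[OF tt(3,2) that(1) kl(1) this(1)] ord[OF tt(3,2) that(1) kl(2) this(2)]
    show "m \<in> ?A \<longleftrightarrow> h m t < h l t" "m \<in> ?A \<longleftrightarrow> h m t < h k t"
     "m \<in> ?A \<longleftrightarrow> h m t' < h l t'" "m \<in> ?A \<longleftrightarrow> h m t' < h k t'"
      using that(1) * kl(4) by simp_all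
  qed
  have kA: "k \<notin> ?A" "l \<notin> ?A" "finite ?A" using kl by auto
  have neq: "h m t \<noteq> h k t" "h m t \<noteq> h l t" "h m t' \<noteq> h k t'" "h m t' \<noteq> h l t'"
    if "m \<in> {1..n}" "m \<noteq> k" "m \<noteq> l" for m
  proof -
    have *: "{m, k} \<noteq> {k, l}" "{m, l} \<noteq> {k, l}" using that kl(3) by (auto simp: doubleton_eq_iff)
    show "h m t \<noteq> h k t" "h m t' \<noteq> h k t'"
      using ne[OF tt(1) that(1) kl(1) that(2)] ne[OF tt(2) that(1) kl(1) that(2)] * by simp_all
    show "h m t \<noteq> h l t" "h m t' \<noteq> h l t'"
      using ne[OF tt(1) that(1) kl(2) that(3)] ne[OF tt(2) that(1) kl(2) that(3)] * by simp_all
  qed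
  have le: "h m t \<le> h l t \<longleftrightarrow> m \<in> ?A" "h m t \<le> h k t \<longleftrightarrow> m \<in> ?A"
    "h m t' \<le> h l t' \<longleftrightarrow> m \<in> ?A" "h m t' \<le> h k t' \<longleftrightarrow> m \<in> ?A"
    if "m \<in> {1..n}" "m \<noteq> k" "m \<noteq> l" for m
    unfolding order_le_less using neq[OF that] A[OF that] by simp_all
  have sets: "{m\<in>{1..n}. P m} = ?A \<union> {m\<in>{k, l}. P m}"
    if "\<And>m. m \<in> {1..n} \<Longrightarrow> m \<noteq> k \<Longrightarrow> m \<noteq> l \<Longrightarrow> P m \<longleftrightarrow> m \<in> ?A" for P
  proof (rule Set.set_eqI)
    fix m show "m \<in> {m\<in>{1..n}. P m} \<longleftrightarrow> m \<in> ?A \<union> {m\<in>{k, l}. P m}"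
      using that[of m] kl(1,2) kA by (cases "m = k \<or> m = l") auto
  qed
  have "{m\<in>{k, l}. h m t \<le> h l t} = {l}" "{m\<in>{k, l}. h m t \<le> h k t} = {k, l}"
    "{m\<in>{k, l}. h m t' \<le> h k t'} = {k}" "{m\<in>{k, l}. h m t' \<le> h l t'} = {k, l}"
    using kl(5) swap by auto
  note singles = this
  have ranks: "{m\<in>{1..n}. h m t \<le> h l t} = ?A \<union> {m\<in>{k, l}. h m t \<le> h l t}"
    "{m\<in>{1..n}. h m t \<le> h k t} = ?A \<union> {m\<in>{k, l}. h m t \<le> h k t}"
    "{m\<in>{1..n}. h m t' \<le> h k t'} = ?A \<union> {m\<in>{k, l}. h m t' \<le> h k t'}"
    "{m\<in>{1..n}. h m t' \<le> h l t'} = ?A \<union> {m\<in>{k, l}. h m t' \<le> h l t'}"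
    by (rule sets, rule le; assumption)+
  have l: "rank t l = i" and k: "rank t k = Suc i" and k': "rank t' k = i" and l': "rank t' l = Suc i"
    unfolding rank_def ranks singles using kA kl(3) by (simp_all add: i_def)
  show "rank t l = i" "rank t k = Suc i" by (fact l k)+
  have tX: "t \<notin> crossings"
  proof
    assume "t \<in> crossings"
    then have "t \<in> {t..t'} \<inter> crossings" using t(2,3) by simp
    then show False unfolding t(5) using t(2) by simp
  qed
  show "rank t' m = adj i (rank t m)" if m: "m \<in> {1..n}" for m
  proof -
    consider "m = k" | "m = l" | "m \<noteq> k" "m \<noteq> l" by blast
    then show ?thesis
    proof cases
      case 3
      have "h a t \<le> h m t \<longleftrightarrow> h a t' \<le> h m t'" if "a \<in> {1..n}" for a
      proof -
        have "{m, a} \<noteq> {k, l}" using 3 by (auto simp: doubleton_eq_iff)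
        from ord[OF tt(1,2) m that this] show ?thesis by (simp flip: not_less)
      qed
      then have "rank t' m = rank t m" unfolding rank_def by (metis (mono_tags, lifting) Collect_cong)
      moreover have "rank t m \<noteq> i" "rank t m \<noteq> Suc i"
        using rank_inj[OF _ tX m kl(2)] rank_inj[OF _ tX m kl(1)] 3 l k t(1-4) by auto
      ultimately show ?thesis by (simp add: adj_apply)
    qed (use l k l' k' in \<open>simp_all add: adj_apply\<close>)
  qed
qed

section \<open>Positions of the arcs and the word of the diagram\<close>

abbreviation xs :: "real list" where
  "xs \<equiv> sorted_list_of_set crossings"

abbreviation word :: "letter list" where
  "word \<equiv> diagram_word n D"

lemma word_eq: "word = map (\<lambda>x. letter_at n D (x, THE y. (x, y) \<in> double_points n D)) xs"
  by (simp add: diagram_word_def crossings_def)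

lemma length_word: "length word = length xs"
  by (simp add: word_eq)

lemma xs_nth: "c < length xs \<Longrightarrow> xs ! c \<in> crossings"
  using finite_crossings nth_mem[of c xs] by simp

lemma xs_less: "c < d \<Longrightarrow> d < length xs \<Longrightarrow> xs ! c < xs ! d"
  using strict_sorted_list_of_set[of crossings] by (rule sorted_wrt_nth_less)

lemma crossings_nth: "x \<in> crossings \<Longrightarrow> \<exists>c<length xs. x = xs ! c"
  using finite_crossings by (metis in_set_conv_nth set_sorted_list_of_set)

lemma word_nth:
  assumes "c < length xs" "k \<in> {1..n}" "l \<in> {1..n}" "k \<noteq> l" "h k (xs ! c) = h l (xs ! c)"
  shows "word ! c = letter_at n D (xs ! c, h k (xs ! c))"
proof -
  let ?x = "xs ! c"
  have "?x \<in> {0..1}" using crossing_range[OF xs_nth[OF assms(1)]] by simp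
  then have p: "(?x, h k ?x) \<in> double_points n D" using assms by (intro double_pointI)
  then have "(THE y. (?x, y) \<in> double_points n D) = h k ?x"
    using inj_onD[OF inj_fst] by (intro the_equality) fastforce+
  then show ?thesis using assms(1) by (simp add: word_eq)
qed

text \<open>The point 0 or the midpoint between two consecutive crossings will do. Away from
  crossings the arcs have distinct positions.\<close>

lemma generic_before:
  assumes "c < length xs"
  obtains t where "0 \<le> t" "t < xs ! c" "\<And>d. d < length xs \<Longrightarrow> xs ! d \<le> t \<longleftrightarrow> d < c" "t \<notin> crossings"
proof (cases c)
  case 0
  have "\<not> xs ! d \<le> 0" if "d < length xs" for d
    using crossing_range[OF xs_nth[OF that]] by auto
  moreover have "0 \<notin> crossings" using crossing_range by blast
  ultimately show ?thesis
    using that[of 0] 0 crossing_range[OF xs_nth[OF assms]] by auto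
next
  case (Suc b)
  let ?t = "(xs ! b + xs ! c) / 2"
  have b: "xs ! b < xs ! c" using xs_less[of b c] Suc assms by auto
  have *: "xs ! d \<le> ?t \<longleftrightarrow> d < c" "xs ! d \<noteq> ?t" if "d < length xs" for d
  proof -
    have "xs ! d \<le> xs ! b" if "d < c"
      using xs_less[of d b] Suc that assms by (cases "d = b") auto
    moreover have "xs ! c \<le> xs ! d" if "\<not> d < c"
      using xs_less[of c d] Suc that \<open>d < length xs\<close> by (cases "d = c") auto
    ultimately show "xs ! d \<le> ?t \<longleftrightarrow> d < c" "xs ! d \<noteq> ?t" using b by (cases "d < c"; force)+
  qed
  have "0 < xs ! b" using crossing_range[OF xs_nth[of b]] Suc assms by auto
  then show ?thesis
    using that[of ?t] b * crossings_nth[of ?t] by fastforce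
qed

text \<open>Induction on the number of crossings left of \<open>t\<close>: passing one of them acts
  on the positions by the transposition of its letter.\<close>

lemma rank_eq:
  assumes "c \<le> length xs" "0 \<le> t" "t \<le> 1" "t \<notin> crossings"
    "\<And>d. d < length xs \<Longrightarrow> xs ! d \<le> t \<longleftrightarrow> d < c" "k \<in> {1..n}"
  shows "rank t k = end_pos (take c word) k"
  using assms
proof (induction c arbitrary: t k)
  case 0
  have "{0..t} \<inter> crossings = {}"
    using 0 crossings_nth by fastforce
  then show ?case using rank_constant[of 0 t k] rank_0 0 by simp
next
  case (Suc c)
  then have c: "c < length xs" by simp
  obtain t0 where t0: "0 \<le> t0" "t0 < xs ! c" "\<And>d. d < length xs \<Longrightarrow> xs ! d \<le> t0 \<longleftrightarrow> d < c" "t0 \<notin> crossings"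
    using generic_before[OF c] by blast
  let ?x = "xs ! c"
  have x: "?x \<in> crossings" by (rule xs_nth[OF c])
  have t: "?x < t" using Suc.prems(5)[OF c] Suc.prems(4) x by (auto simp: order_le_less)
  have cr: "{t0..t} \<inter> crossings = {?x}"
  proof -
    have "y = ?x" if "y \<in> crossings" "t0 \<le> y" "y \<le> t" for y
    proof -
      obtain d where d: "d < length xs" "y = xs ! d" using crossings_nth \<open>y \<in> crossings\<close> by blast
      have "d < Suc c" using Suc.prems(5)[OF d(1)] that d by simp
      moreover have "\<not> d < c"
      proof
        assume "d < c"
        then have "y = t0" using t0(3)[OF d(1)] that d by simp
        then show False using t0(4) that(1) by simp
      qed
      ultimately show ?thesis using d by (metis less_antisym)
    qed
    then have "{t0..t} \<inter> crossings \<subseteq> {?x}" by auto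
    moreover have "?x \<in> {t0..t} \<inter> crossings" using x t t0(2) by simp
    ultimately show ?thesis by blast
  qed
  obtain k' l' where kl': "k' \<in> {1..n}" "l' \<in> {1..n}" "k' \<noteq> l'" "h k' ?x = h l' ?x"
    using x by (rule crossingE)
  have "t0 \<in> {0..1}" using t0 t Suc.prems by auto
  then have "h k' t0 \<noteq> h l' t0" using t0(4) crossingI[OF _ kl'(1-3)] by auto
  then obtain k0 l0 where kl: "k0 \<in> {1..n}" "l0 \<in> {1..n}" "k0 \<noteq> l0" "h k0 ?x = h l0 ?x" "h l0 t0 < h k0 t0"
    using kl' by (metis linorder_neqE_linordered_idom)
  let ?i = "card {m\<in>{1..n}. h m ?x < h k0 ?x} + 1"
  have "letter_index (word ! c) = ?i"
    unfolding word_nth[OF c kl(1-4)] by (simp add: letter_at_def Let_def split: crossing.split)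
  moreover have "take (Suc c) word = take c word @ [word ! c]"
    using c length_word by (simp add: take_Suc_conv_app_nth)
  ultimately have "end_pos (take (Suc c) word) = adj ?i \<circ> end_pos (take c word)"
    by (simp only: end_pos_append end_pos.simps id_comp)
  moreover have "rank t k = adj ?i (rank t0 k)"
    using rank_crossing(3)[OF t0(1,2) t _ cr kl] Suc.prems by simp
  moreover have "rank t0 k = end_pos (take c word) k"
    using c t0 t Suc.prems by (intro Suc.IH) auto
  ultimately show ?case by simp
qed

text \<open>At the right end the heights are the integers from 1 to \<open>n\<close>, so the
  position of an arc there is its height.\<close>

lemma strand_end_eq: 
  assumes "k \<in> {1..n}"
  shows "strand_end D k = end_pos word k"
proof -
  have "h k 1 \<in> real ` {1..n}" using h_1 assms by (auto simp: bij_betw_def)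
  then obtain j where j: "j \<in> {1..n}" "h k 1 = real j" by auto
  then have "strand_end D k = j" by (simp add: strand_end_def)
  have "inj_on (\<lambda>l. h l 1) {1..n}" "(\<lambda>l. h l 1) ` {1..n} = real ` {1..n}"
    using h_1 by (auto simp: bij_betw_def)
  note inj = this(1) and img = this(2)
  have "(\<lambda>l. h l 1) ` {l\<in>{1..n}. h l 1 \<le> h k 1} = {y \<in> (\<lambda>l. h l 1) ` {1..n}. y \<le> h k 1}" by blast
  also have "\<dots> = {y \<in> real ` {1..n}. y \<le> real j}" by (simp only: img j(2))
  also have "\<dots> = real ` {1..j}" using j(1) by auto
  finally have "(\<lambda>l. h l 1) ` {l\<in>{1..n}. h l 1 \<le> h k 1} = real ` {1..j}" .
  moreover have "inj_on (\<lambda>l. h l 1) {l\<in>{1..n}. h l 1 \<le> h k 1}"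
    using inj by (rule inj_on_subset) auto
  ultimately have "rank 1 k = card (real ` {1..j})"
    unfolding rank_def using card_image[of "\<lambda>l. h l 1" "{l\<in>{1..n}. h l 1 \<le> h k 1}"] by simp
  then have "rank 1 k = j" by (simp add: card_image)
  moreover have "rank 1 k = end_pos (take (length xs) word) k"
  proof (rule rank_eq)
    fix d assume "d < length xs"
    then show "xs ! d \<le> 1 \<longleftrightarrow> d < length xs" using crossing_range[OF xs_nth] by fastforce
  qed (use assms crossing_range in auto)
  ultimately show ?thesis using \<open>strand_end D k = j\<close> length_word by simp
qed

text \<open>Collects what is needed to compare a crossing with its letter; the two strands are named
  through the positions \<open>i\<close> and \<open>i + 1\<close> which they occupy just before
  it.\<close>

lemma crossing_data:
  assumes "c < length xs"
  defines "x \<equiv> xs ! c"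
  obtains lo up i where "lo \<in> {1..n}" "up \<in> {1..n}" "lo \<noteq> up" "h lo x = h up x"
    "\<And>k l. k \<in> {1..n} \<Longrightarrow> l \<in> {1..n} \<Longrightarrow> k \<noteq> l \<Longrightarrow> h k x = h l x \<Longrightarrow> (k = lo \<and> l = up) \<or> (k = up \<and> l = lo)"
    "above_before D up lo x" "\<not> above_before D lo up x"
    "lo = inv_into UNIV (end_pos (take c word)) i" "up = inv_into UNIV (end_pos (take c word)) (Suc i)"
    "word ! c = (case kind D (x, h lo x) of Positive \<Rightarrow> Sigma i | Negative \<Rightarrow> Sigma_inv i | Welded \<Rightarrow> Rho i)"
    "1 \<le> i" "i < n"
proof -
  obtain t0 where t0: "0 \<le> t0" "t0 < x" "\<And>d. d < length xs \<Longrightarrow> xs ! d \<le> t0 \<longleftrightarrow> d < c" "t0 \<notin> crossings"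
    using generic_before[OF assms(1)] unfolding x_def by blast
  have x: "x \<in> crossings" unfolding x_def by (rule xs_nth[OF assms(1)])
  then have x01: "0 < x" "x < 1" using crossing_range by auto
  obtain t' where t': "x < t'" "t' \<le> 1" "{t0..t'} \<inter> crossings = {x}"
  proof -
    \<comment> \<open>The abscissa 1 keeps the set nonempty, and \<open>t'\<close> inside the
      diagram, when no further crossing follows.\<close>
    let ?S = "insert 1 {y \<in> crossings. x < y}"
    have fin: "finite ?S" using finite_crossings by simp
    then have m: "x < Min ?S" using x01 by simp
    then obtain t' where t': "x < t'" "t' < Min ?S" using dense by blast
    have "y = x" if "y \<in> crossings" "t0 \<le> y" "y \<le> t'" for y
    proof -
      obtain d where d: "d < length xs" "y = xs ! d" using crossings_nth \<open>y \<in> crossings\<close> by blast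
      have "\<not> x < y"
      proof
        assume "x < y"
        then have "Min ?S \<le> y" using that fin by (intro Min_le) auto
        then show False using that t' by auto
      qed
      moreover have "\<not> d < c"
      proof
        assume "d < c"
        then have "y = t0" using t0(3)[OF d(1)] that d by simp
        then show False using t0(4) that(1) by simp
      qed
      then have "x \<le> y" using xs_less[of c d] d unfolding x_def by (cases "c = d") auto
      ultimately show ?thesis by simp
    qed
    then have "{t0..t'} \<inter> crossings \<subseteq> {x}" by auto
    moreover have "x \<in> {t0..t'} \<inter> crossings" using x t'(1) t0(2) by simp
    ultimately have "{t0..t'} \<inter> crossings = {x}" by blast
    moreover have "t' \<le> 1" using t' Min_le[OF fin, of 1] by simp
    ultimately show ?thesis using that[of t'] t'(1) by blast
  qed
  obtain k' l' where kl': "k' \<in> {1..n}" "l' \<in> {1..n}" "k' \<noteq> l'" "h k' x = h l' x"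
    using x by (rule crossingE)
  have t01: "t0 \<in> {0..1}" using t0 x01 by auto
  then have "h k' t0 \<noteq> h l' t0" using t0(4) crossingI[OF _ kl'(1-3)] by auto
  then obtain k l where kl: "k \<in> {1..n}" "l \<in> {1..n}" "k \<noteq> l" "h k x = h l x" "h l t0 < h k t0"
    using kl' by (metis linorder_neqE_linordered_idom)
  define i where "i = card {m\<in>{1..n}. h m x < h k x} + 1"
  note rc = rank_crossing(1,2)[OF t0(1,2) t'(1,2,3) kl, folded i_def]
  have re: "rank t0 m = end_pos (take c word) m" if "m \<in> {1..n}" for m
    using t0 t01 that assms(1) by (intro rank_eq) auto
  have ne: "h a s \<noteq> h b s" if "t0 \<le> s" "s < x" "a \<in> {k, l}" "b \<in> {k, l}" "a \<noteq> b" for a b s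
  proof
    assume "h a s = h b s"
    then have "s \<in> crossings" using that kl t01 x01 by (intro crossingI[of s a b]) auto
    then have "s \<in> {t0..t'} \<inter> crossings" using that(1,2) t'(1) by simp
    then show False unfolding t'(3) using that(2) by simp
  qed
  show ?thesis
  proof (rule that[of l k i])
    show "word ! c = (case kind D (x, h l x) of Positive \<Rightarrow> Sigma i | Negative \<Rightarrow> Sigma_inv i | Welded \<Rightarrow> Rho i)"
      using word_nth[OF assms(1) kl(1-3)] kl(4) unfolding x_def[symmetric] i_def
      by (cases "kind D (x, h l x)") (simp_all add: letter_at_def Let_def)
    show "(a = l \<and> b = k) \<or> (a = k \<and> b = l)" if "a \<in> {1..n}" "b \<in> {1..n}" "a \<noteq> b" "h a x = h b x" for a b
      using crossing_unique(2)[of x k l a b] that kl x01 by (auto simp: doubleton_eq_iff)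
    have "above_before D k l x \<longleftrightarrow> h l t0 < h k t0"
      using kl t0 x01 ne by (intro above_before_iff) auto
    with kl show "above_before D k l x" by simp
    have "above_before D l k x \<longleftrightarrow> h k t0 < h l t0"
      using kl t0 x01 ne by (intro above_before_iff) auto
    with kl show "\<not> above_before D l k x" by simp
    show "l = inv_into UNIV (end_pos (take c word)) i" "k = inv_into UNIV (end_pos (take c word)) (Suc i)"
      using rc re kl bij_is_inj[OF bij_end_pos] by (metis inv_f_f)+
    have "rank t0 k \<le> card {1..n}" unfolding rank_def by (intro card_mono) auto
    then show "i < n" using rc by simp
    show "1 \<le> i" by (simp add: i_def)
  qed (use kl in auto)
qed

lemma valid_diagram_word: "valid_word n word"
  unfolding valid_word_def
proof
  fix l assume "l \<in> set word"
  then obtain c where c: "c < length xs" "l = word ! c"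
    using length_word by (metis in_set_conv_nth)
  show "1 \<le> letter_index l \<and> letter_index l < n"
    by (rule crossing_data[OF c(1)]) (auto simp: c(2) split: crossing.splits)
qed

lemma label_gauss_of: "label (gauss_of n D) = end_pos word"
proof
  fix k
  show "label (gauss_of n D) k = end_pos word k"
    using strand_end_eq[of k] permutes_not_in[OF end_pos_permutes[OF valid_diagram_word], of k]
    by (simp add: gauss_of_def)
qed

section \<open>The arrows at the crossings\<close>

definition arrow_at :: "real \<Rightarrow> nat \<times> nat \<times> int \<Rightarrow> arrow" where
  "arrow_at x = (\<lambda>(a, b, e). \<lparr>tail = (a, x), head = (b, x), arrow_sign = e\<rparr>)"

definition crossing_arrows :: "nat \<Rightarrow> arrow list" where
  "crossing_arrows c = map (arrow_at (xs ! c))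
     (relabel (inv_into UNIV (end_pos (take c word))) (letter_arrows (word ! c)))"

definition diagram_arrows :: "arrow list" where
  "diagram_arrows = concat (map crossing_arrows [0..<length xs])"

lemma map_arrow_type_diagram_arrows: "map arrow_type diagram_arrows = word_arrows word"
proof -
  have "map arrow_type (crossing_arrows c) =
      relabel (inv_into UNIV (end_pos (take c word))) (letter_arrows (word ! c))" for c
    by (auto simp: crossing_arrows_def arrow_at_def intro!: map_idI)
  then show ?thesis
    by (simp add: diagram_arrows_def word_arrows_concat[of word] map_concat o_def length_word)
qed

text \<open>Since \<open>up\<close> arrives above \<open>lo\<close>, the kind of the crossing
  decides which of the two passes over, if any; tracing back the positions \<open>i\<close>,
  \<open>i + 1\<close> of the letter gives the same arrow.\<close>

lemma set_crossing_arrows: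
  assumes "c < length xs"
  shows "set (crossing_arrows c) = {\<alpha> \<in> arrows (gauss_of n D). snd (tail \<alpha>) = xs ! c}"
proof -
  let ?x = "xs ! c"
  obtain lo up i where 
    1: "lo \<in> {1..n}" "up \<in> {1..n}" "lo \<noteq> up" "h lo ?x = h up ?x" and
    2: "\<And>k l. k \<in> {1..n} \<Longrightarrow> l \<in> {1..n} \<Longrightarrow> k \<noteq> l \<Longrightarrow> h k ?x = h l ?x \<Longrightarrow> (k = lo \<and> l = up) \<or> (k = up \<and> l = lo)" and
    3: "above_before D up lo ?x" "\<not> above_before D lo up ?x" and
    4: "lo = inv_into UNIV (end_pos (take c word)) i" "up = inv_into UNIV (end_pos (take c word)) (Suc i)" and
    5: "word ! c = (case kind D (?x, h lo ?x) of Positive \<Rightarrow> Sigma i | Negative \<Rightarrow> Sigma_inv i | Welded \<Rightarrow> Rho i)"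
    by (rule crossing_data[OF assms], rule that)
  have x: "?x \<in> {0..1}" using crossing_range[OF xs_nth[OF assms]] by auto
  let ?s = "\<lambda>k. if kind D (?x, h k ?x) = Positive then 1 else - 1 :: int"
  have "{\<alpha> \<in> arrows (gauss_of n D). snd (tail \<alpha>) = ?x} =
    {arrow_at ?x (k, l, ?s k) | k l. k \<in> {1..n} \<and> l \<in> {1..n} \<and> k \<noteq> l \<and> h k ?x = h l ?x \<and> passes_over D k l ?x}"
    using x by (auto simp: gauss_of_def arrow_at_def) metis
  also have "\<dots> = {arrow_at ?x (k, l, ?s k) | k l. ((k = lo \<and> l = up) \<or> (k = up \<and> l = lo)) \<and> passes_over D k l ?x}"
  proof -
    have "k \<in> {1..n} \<and> l \<in> {1..n} \<and> k \<noteq> l \<and> h k ?x = h l ?x \<longleftrightarrow> (k = lo \<and> l = up) \<or> (k = up \<and> l = lo)" for k l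
      using 1 2[of k l] by auto
    then show ?thesis by (simp only: conj_assoc[symmetric])
  qed
  also have "\<dots> = (if passes_over D lo up ?x then {arrow_at ?x (lo, up, ?s lo)} else {}) \<union>
      (if passes_over D up lo ?x then {arrow_at ?x (up, lo, ?s up)} else {})"
    by auto
  also have "\<dots> = set (crossing_arrows c)"
    unfolding crossing_arrows_def 5
    using 1(4) 3 by (cases "kind D (?x, h lo ?x)")
      (auto simp: passes_over_def 4[symmetric])
  finally show ?thesis by simp
qed

lemma linearization_diagram_arrows: "linearization (gauss_of n D) diagram_arrows"
proof -
  have "snd (tail \<alpha>) \<in> crossings" if "\<alpha> \<in> arrows (gauss_of n D)" for \<alpha>
    using that by (auto simp: gauss_of_def intro: crossingI)
  then have "set diagram_arrows = arrows (gauss_of n D)"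
    using set_crossing_arrows crossings_nth by (fastforce simp: diagram_arrows_def)
  moreover have "sorted_wrt precedes diagram_arrows"
    unfolding diagram_arrows_def
  proof (rule sorted_wrt_concat)
    have ends: "u = xs ! c" if "\<alpha> \<in> set (crossing_arrows c)" "(i, u) \<in> arrow_ends \<alpha>" for c \<alpha> i u
      using that by (auto simp: crossing_arrows_def arrow_at_def)
    show "sorted_wrt (\<lambda>l m. \<forall>a\<in>set l. \<forall>b\<in>set m. precedes a b) (map crossing_arrows [0..<length xs])"
      using ends xs_less by (auto simp: sorted_wrt_iff_nth_less precedes_def) metis
    fix l assume "l \<in> set (map crossing_arrows [0..<length xs])"
    then obtain c where "l = crossing_arrows c" by auto
    then show "sorted_wrt precedes l" by (cases "word ! c") (auto simp: crossing_arrows_def)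
  qed
  ultimately show ?thesis by (simp add: linearization_def)
qed

lemma gauss_of_bGD: "gauss_of n D \<in> bGD n"
proof (rule bGD_I[OF linearization_diagram_arrows])
  fix \<alpha> assume \<alpha>: "\<alpha> \<in> set diagram_arrows"
  then have "arrow_type \<alpha> \<in> set (map arrow_type diagram_arrows)" by auto
  then have "arrow_type \<alpha> \<in> arrow_types n"
    unfolding map_arrow_type_diagram_arrows using word_arrows_types[OF valid_diagram_word] by blast
  moreover obtain c where "c < length xs" "\<alpha> \<in> set (crossing_arrows c)"
    using \<alpha> by (auto simp: diagram_arrows_def)
  ultimately show "proper_arrow n \<alpha>"
    using crossing_range[OF xs_nth[of c]]
    by (auto simp: proper_arrow_def crossing_arrows_def arrow_at_def arrow_types_def)
next
  show "label (gauss_of n D) permutes {1..n}"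
    unfolding label_gauss_of by (rule end_pos_permutes[OF valid_diagram_word])
qed

end


section \<open>Stacking and elementary diagrams\<close>

text \<open>All conditions on double points are reduced to pairs of arcs: \<open>uniq\<close> covers
  both the absence of triple points and the distinctness of abscissas, and \<open>meet\<close> with
  a finite \<open>X\<close> gives finiteness.\<close>

lemma strand_diagramI:
  assumes cont: "\<And>k. k \<in> {1..n} \<Longrightarrow> continuous_on {0..1} (height D k)"
    and start: "\<And>k. k \<in> {1..n} \<Longrightarrow> height D k 0 = real k"
    and finish: "bij_betw (\<lambda>k. height D k 1) {1..n} (real ` {1..n})"
    and fin: "finite X"
    and meet: "\<And>x k l. x \<in> {0..1} \<Longrightarrow> k \<in> {1..n} \<Longrightarrow> l \<in> {1..n} \<Longrightarrow> k \<noteq> l \<Longrightarrow>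
      height D k x = height D l x \<Longrightarrow> x \<in> X"
    and uniq: "\<And>x k l k' l'. x \<in> {0..1} \<Longrightarrow> k \<in> {1..n} \<Longrightarrow> l \<in> {1..n} \<Longrightarrow> k \<noteq> l \<Longrightarrow>
      height D k x = height D l x \<Longrightarrow> k' \<in> {1..n} \<Longrightarrow> l' \<in> {1..n} \<Longrightarrow> k' \<noteq> l' \<Longrightarrow>
      height D k' x = height D l' x \<Longrightarrow> {k', l'} = {k, l}"
    and trans: "\<And>x k l. x \<in> {0..1} \<Longrightarrow> k \<in> {1..n} \<Longrightarrow> l \<in> {1..n} \<Longrightarrow> k \<noteq> l \<Longrightarrow>
      height D k x = height D l x \<Longrightarrow> (above_before D k l x \<and> above_after D l k x) \<or>
        (above_before D l k x \<and> above_after D k l x)"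
  shows "D \<in> strand_diagrams n"
proof -
  have dp: "\<exists>k l. k \<in> {1..n} \<and> l \<in> {1..n} \<and> k \<noteq> l \<and> fst p \<in> {0..1} \<and> height D k (fst p) = snd p \<and> height D l (fst p) = snd p"
    if "p \<in> double_points n D" for p
  proof -
    obtain k l where "k \<in> {1..n}" "l \<in> {1..n}" "k \<noteq> l" "p \<in> arc_points D k" "p \<in> arc_points D l"
      using \<open>p \<in> double_points n D\<close> unfolding double_points_def by (elim CollectE bexE conjE)
    then show ?thesis by (intro exI[of _ k] exI[of _ l]) (auto simp: arc_points_def)
  qed
  have "double_points n D \<subseteq> (\<lambda>(k, x). (x, height D k x)) ` ({1..n} \<times> X)"
  proof
    fix p assume "p \<in> double_points n D"
    then obtain k l where kl: "k \<in> {1..n}" "l \<in> {1..n}" "k \<noteq> l" "fst p \<in> {0..1}"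
       "height D k (fst p) = snd p" "height D l (fst p) = snd p" using dp by metis
    then have "fst p \<in> X" using meet[of "fst p" k l] by simp
    with kl show "p \<in> (\<lambda>(k, x). (x, height D k x)) ` ({1..n} \<times> X)"
      by (intro image_eqI[of _ _ "(k, fst p)"]) (simp_all add: prod_eq_iff)
  qed
  then have "finite (double_points n D)" by (rule finite_subset) (use fin in simp)
  moreover have "card {m\<in>{1..n}. p \<in> arc_points D m} = 2" if p: "p \<in> double_points n D" for p
  proof -
    obtain k l where kl: "k \<in> {1..n}" "l \<in> {1..n}" "k \<noteq> l" "fst p \<in> {0..1}"
       "height D k (fst p) = snd p" "height D l (fst p) = snd p" using dp[OF p] by metis
    have arc: "p \<in> arc_points D m \<longleftrightarrow> height D m (fst p) = snd p" for m
      using kl(4) by (cases p) (auto simp: arc_points_def)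
    have "m = k \<or> m = l" if "m \<in> {1..n}" "height D m (fst p) = snd p" for m
    proof (rule ccontr)
      assume "\<not> (m = k \<or> m = l)"
      then have "{m, k} = {k, l}" using kl that by (intro uniq[of "fst p" k l m k]) auto
      then show False using \<open>\<not> (m = k \<or> m = l)\<close> by auto
    qed
    then have "{m\<in>{1..n}. p \<in> arc_points D m} = {k, l}" unfolding arc using kl by blast
    then show ?thesis using kl(3) by simp
  qed
  moreover have "inj_on fst (double_points n D)"
  proof (rule inj_onI)
    fix p q assume pq: "p \<in> double_points n D" "q \<in> double_points n D" "fst p = fst q"
    obtain k l where kl: "k \<in> {1..n}" "l \<in> {1..n}" "k \<noteq> l" "fst p \<in> {0..1}"
       "height D k (fst p) = snd p" "height D l (fst p) = snd p" using dp[OF pq(1)] by metis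
    obtain k' l' where kl': "k' \<in> {1..n}" "l' \<in> {1..n}" "k' \<noteq> l'"
       "height D k' (fst p) = snd q" "height D l' (fst p) = snd q" using dp[OF pq(2)] pq(3) by metis
    have "{k', l'} = {k, l}" using kl kl' by (intro uniq[of "fst p" k l k' l']) auto
    then have "snd p = snd q" using kl kl' by (auto simp: doubleton_eq_iff)
    with pq(3) show "p = q" by (simp add: prod_eq_iff)
  qed
  ultimately show ?thesis
    unfolding strand_diagrams_def using cont start finish trans by simp
qed

text \<open>The crossing condition is one on germs; this carries it to the rescaled halves of a
  stacked diagram.\<close>

lemma filtermap_affine:
  assumes a: "0 < (a::real)"
  shows "filtermap (\<lambda>s. a * s + c) (at_left x) = at_left (a * x + c)"
    "filtermap (\<lambda>s. a * s + c) (at_right x) = at_right (a * x + c)"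
proof -
  have inv: "a * ((t - c) / a) + c = t" for t using a by simp
  have less: "s < (t - c) / a \<longleftrightarrow> a * s + c < t" "(t - c) / a < s \<longleftrightarrow> t < a * s + c" for s t
    using a by (auto simp: field_simps)
  show "filtermap (\<lambda>s. a * s + c) (at_left x) = at_left (a * x + c)"
    unfolding filter_eq_iff eventually_filtermap eventually_at_left_field
  proof (intro allI iffI)
    fix P assume "\<exists>b<x. \<forall>y>b. y < x \<longrightarrow> P (a * y + c)"
    then obtain b where b: "b < x" "\<And>y. b < y \<Longrightarrow> y < x \<Longrightarrow> P (a * y + c)" by blast
    have "P t" if "a * b + c < t" "t < a * x + c" for t
      using b(2)[of "(t - c) / a"] that by (simp only: less inv)
    then show "\<exists>b<a * x + c. \<forall>y>b. y < a * x + c \<longrightarrow> P y"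
      using b(1) a by (intro exI[of _ "a * b + c"]) simp
  next
    fix P assume "\<exists>b<a * x + c. \<forall>y>b. y < a * x + c \<longrightarrow> P y"
    then obtain b where b: "b < a * x + c" "\<And>y. b < y \<Longrightarrow> y < a * x + c \<Longrightarrow> P y" by blast
    then show "\<exists>b<x. \<forall>y>b. y < x \<longrightarrow> P (a * y + c)"
      using a by (intro exI[of _ "(b - c) / a"]) (simp add: less)
  qed
  show "filtermap (\<lambda>s. a * s + c) (at_right x) = at_right (a * x + c)"
    unfolding filter_eq_iff eventually_filtermap eventually_at_right_field
  proof (intro allI iffI)
    fix P assume "\<exists>b>x. \<forall>y>x. y < b \<longrightarrow> P (a * y + c)"
    then obtain b where b: "x < b" "\<And>y. x < y \<Longrightarrow> y < b \<Longrightarrow> P (a * y + c)" by blast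
    have "P t" if "a * x + c < t" "t < a * b + c" for t
      using b(2)[of "(t - c) / a"] that by (simp only: less inv)
    then show "\<exists>b>a * x + c. \<forall>y>a * x + c. y < b \<longrightarrow> P y"
      using b(1) a by (intro exI[of _ "a * b + c"]) simp
  next
    fix P assume "\<exists>b>a * x + c. \<forall>y>a * x + c. y < b \<longrightarrow> P y"
    then obtain b where b: "a * x + c < b" "\<And>y. a * x + c < y \<Longrightarrow> y < b \<Longrightarrow> P y" by blast
    then show "\<exists>b>x. \<forall>y>x. y < b \<longrightarrow> P (a * y + c)"
      using a by (intro exI[of _ "(b - c) / a"]) (simp add: less)
  qed
qed

lemma above_affine:
  assumes "0 < a" "u < x" "x < v"
    and "\<And>s. u < s \<Longrightarrow> s < v \<Longrightarrow> height S k s = height D k' (a * s + c)"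
    and "\<And>s. u < s \<Longrightarrow> s < v \<Longrightarrow> height S l s = height D l' (a * s + c)"
  shows "above_before S k l x \<longleftrightarrow> above_before D k' l' (a * x + c)"
    "above_after S k l x \<longleftrightarrow> above_after D k' l' (a * x + c)"
proof -
  have "eventually (\<lambda>s. u < s \<and> s < v) (at_left x)"
    unfolding eventually_at_left_field using assms(2,3) by (intro exI[of _ u]) auto
  then have "eventually (\<lambda>s. (height S l s < height S k s) = (height D l' (a * s + c) < height D k' (a * s + c))) (at_left x)"
    by eventually_elim (simp add: assms(4,5))
  then have "above_before S k l x \<longleftrightarrow> eventually (\<lambda>s. height D l' (a * s + c) < height D k' (a * s + c)) (at_left x)"
    unfolding above_before_def by (rule eventually_subst)
  also have "\<dots> \<longleftrightarrow> above_before D k' l' (a * x + c)"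
    unfolding above_before_def filtermap_affine(1)[OF assms(1), symmetric] eventually_filtermap ..
  finally show "above_before S k l x \<longleftrightarrow> above_before D k' l' (a * x + c)" .
  have "eventually (\<lambda>s. u < s \<and> s < v) (at_right x)"
    unfolding eventually_at_right_field using assms(2,3) by (intro exI[of _ v]) auto
  then have "eventually (\<lambda>s. (height S l s < height S k s) = (height D l' (a * s + c) < height D k' (a * s + c))) (at_right x)"
    by eventually_elim (simp add: assms(4,5))
  then have "above_after S k l x \<longleftrightarrow> eventually (\<lambda>s. height D l' (a * s + c) < height D k' (a * s + c)) (at_right x)"
    unfolding above_after_def by (rule eventually_subst)
  also have "\<dots> \<longleftrightarrow> above_after D k' l' (a * x + c)"
    unfolding above_after_def filtermap_affine(2)[OF assms(1), symmetric] eventually_filtermap ..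
  finally show "above_after S k l x \<longleftrightarrow> above_after D k' l' (a * x + c)" .
qed

section \<open>Stacked diagrams and their words\<close>

context strands
begin

lemma h_1_eq: "k \<in> {1..n} \<Longrightarrow> h k 1 = real (strand_end D k)"
proof -
  assume k: "k \<in> {1..n}"
  then have "h k 1 \<in> real ` {1..n}" using h_1 by (auto simp: bij_betw_def)
  then obtain j where "h k 1 = real j" by auto
  then show ?thesis by (simp add: strand_end_def)
qed

lemma strand_end_bij: "bij_betw (strand_end D) {1..n} {1..n}"
proof -
  have "bij_betw (end_pos word) {1..n} {1..n}"
    by (rule permutes_imp_bij[OF end_pos_permutes[OF valid_diagram_word]])
  then show ?thesis by (rule bij_betw_cong[THEN iffD1, rotated]) (simp add: strand_end_eq)
qed

lemma strand_end_in: "k \<in> {1..n} \<Longrightarrow> strand_end D k \<in> {1..n}"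
  using strand_end_bij by (rule bij_betwE[THEN bspec])

lemma strand_end_inj: "k \<in> {1..n} \<Longrightarrow> l \<in> {1..n} \<Longrightarrow> strand_end D k = strand_end D l \<longleftrightarrow> k = l"
  using inj_on_eq_iff[OF bij_betw_imp_inj_on[OF strand_end_bij]] .

lemma letter_at_crossing:
  assumes "x \<in> {0..1}" "k \<in> {1..n}" "l \<in> {1..n}" "k \<noteq> l" "h k x = h l x"
  shows "letter_at n D (x, THE y. (x, y) \<in> double_points n D) = letter_at n D (x, h k x)"
proof -
  have p: "(x, h k x) \<in> double_points n D" using assms by (rule double_pointI)
  have "(THE y. (x, y) \<in> double_points n D) = h k x"
  proof (rule the_equality[of "\<lambda>y. (x, y) \<in> double_points n D", OF p])
    fix y assume "(x, y) \<in> double_points n D"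
    from inj_onD[OF inj_fst _ this p] show "y = h k x" by simp
  qed
  then show ?thesis by simp
qed

end

locale two_strands = D: strands n D + E: strands n E for n D E
begin

abbreviation S :: strand_diagram where
  "S \<equiv> stack D E"

lemma height_left: "x \<le> 1/2 \<Longrightarrow> height S k x = height D k (2 * x)"
  by (simp add: stack_def)

text \<open>At the seam \<open>x = 1/2\<close> the definition of \<open>stack\<close> uses
  \<open>D\<close>; the formula for \<open>E\<close> agrees there because \<open>E\<close> starts at
  the heights where \<open>D\<close> ends.\<close>

lemma height_right: "k \<in> {1..n} \<Longrightarrow> 1/2 \<le> x \<Longrightarrow> height S k x = height E (strand_end D k) (2 * x - 1)"
proof -
  assume k: "k \<in> {1..n}" and "1/2 \<le> x"
  then consider "1/2 < x" | "x = 1/2" by linarith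
  then show ?thesis
  proof cases
    case 2
    show ?thesis unfolding 2 using D.h_1_eq[OF k] E.h_0[OF D.strand_end_in[OF k]] by (simp add: stack_def)
  qed (simp add: stack_def)
qed

text \<open>At the seam the heights are distinct, so every meeting lies strictly inside one
  half.\<close>

lemma meet_cases:
  assumes "x \<in> {0..1}" "k \<in> {1..n}" "l \<in> {1..n}" "k \<noteq> l" "height S k x = height S l x"
  obtains (left) "x < 1/2" "2 * x \<in> {0..1}" "height D k (2 * x) = height D l (2 * x)"
  | (right) "1/2 < x" "2 * x - 1 \<in> {0..1}"
      "height E (strand_end D k) (2 * x - 1) = height E (strand_end D l) (2 * x - 1)"
proof -
  consider "x < 1/2" | "x = 1/2" | "1/2 < x" by linarith
  then show ?thesis
  proof cases
    case 1 with assms left show ?thesis by (simp add: height_left)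
  next
    case 2
    then have "height D k 1 = height D l 1" using assms(5)[unfolded 2] by (simp add: height_left)
    then show ?thesis using D.h_1_inj[OF assms(2,3)] assms(4) by simp
  next
    case 3 with assms right show ?thesis by (simp add: height_right)
  qed
qed

lemma stack_strands: "S \<in> strand_diagrams n"
proof (rule strand_diagramI)
  fix k assume k: "k \<in> {1..n}"
  have "continuous_on {0..1/2} (\<lambda>x. height D k (2 * x))"
    by (rule continuous_on_compose2[OF D.continuous_h[OF k]]) (auto intro!: continuous_intros)
  then have 1: "continuous_on {0..1/2} (height S k)"
    by (rule continuous_on_eq) (simp add: height_left)
  have "continuous_on {1/2..1} (\<lambda>x. height E (strand_end D k) (2 * x - 1))"
    by (rule continuous_on_compose2[OF E.continuous_h[OF D.strand_end_in[OF k]]]) (auto intro!: continuous_intros)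
  then have 2: "continuous_on {1/2..1} (height S k)"
    by (rule continuous_on_eq) (simp add: height_right[OF k])
  have "{0..1/2} \<union> {1/2..1} = {0..1::real}" by auto
  with continuous_on_closed_Un[OF _ _ 1 2] show "continuous_on {0..1} (height S k)" by simp
  show "height S k 0 = real k" using D.h_0[OF k] by (simp add: height_left)
next
  have "bij_betw ((\<lambda>k. height E k 1) \<circ> strand_end D) {1..n} (real ` {1..n})"
    by (rule bij_betw_trans[OF D.strand_end_bij E.h_1])
  then show "bij_betw (\<lambda>k. height S k 1) {1..n} (real ` {1..n})"
    by (rule bij_betw_cong[THEN iffD1, rotated]) (simp add: height_right)
next
  show "finite ((\<lambda>x. x / 2) ` D.crossings \<union> (\<lambda>x. (1 + x) / 2) ` E.crossings)"
    using D.finite_crossings E.finite_crossings by simp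
next
  fix x k l assume kl: "x \<in> {0..1}" "k \<in> {1..n}" "l \<in> {1..n}" "k \<noteq> l" "height S k x = height S l x"
  then have ne: "strand_end D k \<noteq> strand_end D l" by (simp add: D.strand_end_inj)
  have mem: "strand_end D k \<in> {1..n}" "strand_end D l \<in> {1..n}" using kl D.strand_end_in by blast+
  show "x \<in> (\<lambda>x. x / 2) ` D.crossings \<union> (\<lambda>x. (1 + x) / 2) ` E.crossings"
    using kl
  proof (cases rule: meet_cases)
    case left
    then have "2 * x \<in> D.crossings" using kl by (intro D.crossingI)
    then show ?thesis by (intro UnI1 image_eqI[of _ _ "2 * x"]) auto
  next
    case right
    then have "2 * x - 1 \<in> E.crossings" using mem ne by (intro E.crossingI)
    then show ?thesis by (intro UnI2 image_eqI[of _ _ "2 * x - 1"]) auto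
  qed
  show "(above_before S k l x \<and> above_after S l k x) \<or> (above_before S l k x \<and> above_after S k l x)"
    using kl
  proof (cases rule: meet_cases)
    case left
    have "above_before S a b x = above_before D a b (2 * x + 0) \<and> above_after S a b x = above_after D a b (2 * x + 0)" for a b
      using left(1) above_affine[of 2 "x - 1" x "1/2" S a D a 0 b b] by (simp add: height_left)
    then show ?thesis using D.transversal[of "2 * x" k l] left kl by simp
  next
    case right
    have "above_before S a b x = above_before E (strand_end D a) (strand_end D b) (2 * x + (-1)) \<and>
       above_after S a b x = above_after E (strand_end D a) (strand_end D b) (2 * x + (-1))"
      if "a \<in> {1..n}" "b \<in> {1..n}" for a b
      using right(1) above_affine[of 2 "1/2" x "x + 1" S a E "strand_end D a" "-1" b "strand_end D b"] that
      by (simp add: height_right)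
    then show ?thesis using E.transversal[of "2 * x - 1" "strand_end D k" "strand_end D l"] right kl mem ne by simp
  qed
  fix k' l' assume kl': "k' \<in> {1..n}" "l' \<in> {1..n}" "k' \<noteq> l'" "height S k' x = height S l' x"
  then have ne': "strand_end D k' \<noteq> strand_end D l'" by (simp add: D.strand_end_inj)
  have mem': "strand_end D k' \<in> {1..n}" "strand_end D l' \<in> {1..n}" using kl' D.strand_end_in by blast+
  show "{k', l'} = {k, l}"
    using kl
  proof (cases rule: meet_cases)
    case left
    have "height D k' (2 * x) = height D l' (2 * x)" using kl'(4) left(1) by (simp add: height_left)
    with D.crossing_unique(2)[OF left(2) kl(2-4) left(3) kl'(1-3)] show ?thesis by simp
  next
    case right
    have "height E (strand_end D k') (2 * x - 1) = height E (strand_end D l') (2 * x - 1)"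
      using kl'(1,2,4) right(1) by (simp add: height_right)
    with E.crossing_unique(2)[OF right(2) mem ne right(3) mem' ne']
    have "{strand_end D k', strand_end D l'} = {strand_end D k, strand_end D l}" by simp
    then show ?thesis
      unfolding doubleton_eq_iff by (simp only: D.strand_end_inj kl(2,3) kl'(1,2))
  qed
qed

sublocale S: strands n S
  by standard (rule stack_strands)

lemma crossings_stack: "S.crossings = (\<lambda>x. x / 2) ` D.crossings \<union> (\<lambda>x. (1 + x) / 2) ` E.crossings"
proof
  show "S.crossings \<subseteq> (\<lambda>x. x / 2) ` D.crossings \<union> (\<lambda>x. (1 + x) / 2) ` E.crossings"
  proof
    fix x assume "x \<in> S.crossings"
    then obtain k l where kl: "x \<in> {0..1}" "k \<in> {1..n}" "l \<in> {1..n}" "k \<noteq> l" "height S k x = height S l x"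
      by (rule S.crossingE)
    then show "x \<in> (\<lambda>x. x / 2) ` D.crossings \<union> (\<lambda>x. (1 + x) / 2) ` E.crossings"
    proof (cases rule: meet_cases)
      case left
      then have "2 * x \<in> D.crossings" using kl by (intro D.crossingI)
      then show ?thesis by (intro UnI1 image_eqI[of _ _ "2 * x"]) auto
    next
      case right
      then have "2 * x - 1 \<in> E.crossings"
        using kl D.strand_end_in D.strand_end_inj by (intro E.crossingI[of _ "strand_end D k" "strand_end D l"]) auto
      then show ?thesis by (intro UnI2 image_eqI[of _ _ "2 * x - 1"]) auto
    qed
  qed
  have "x / 2 \<in> S.crossings" if x: "x \<in> D.crossings" for x
  proof -
    obtain k l where "x \<in> {0..1}" "k \<in> {1..n}" "l \<in> {1..n}" "k \<noteq> l" "height D k x = height D l x"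
      using x by (rule D.crossingE)
    then show ?thesis by (intro S.crossingI[of _ k l]) (auto simp: height_left)
  qed
  moreover have "(1 + x) / 2 \<in> S.crossings" if x: "x \<in> E.crossings" for x
  proof -
    obtain k l where kl: "x \<in> {0..1}" "k \<in> {1..n}" "l \<in> {1..n}" "k \<noteq> l" "height E k x = height E l x"
      using x by (rule E.crossingE)
    obtain k' l' where "k' \<in> {1..n}" "strand_end D k' = k" "l' \<in> {1..n}" "strand_end D l' = l"
      using kl(2,3) D.strand_end_bij by (metis bij_betw_imp_surj_on imageE)
    with kl show ?thesis by (intro S.crossingI[of _ k' l']) (auto simp: height_right add_divide_distrib)
  qed
  ultimately show "(\<lambda>x. x / 2) ` D.crossings \<union> (\<lambda>x. (1 + x) / 2) ` E.crossings \<subseteq> S.crossings" by auto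
qed

lemma sorted_crossings_stack: "S.xs = map (\<lambda>x. x / 2) D.xs @ map (\<lambda>x. (1 + x) / 2) E.xs"
proof (rule strict_sorted_equal)
  show "sorted_wrt (<) (map (\<lambda>x. x / 2) D.xs @ map (\<lambda>x. (1 + x) / 2) E.xs)"
    unfolding sorted_wrt_append sorted_wrt_map
  proof (intro conjI ballI)
    show "sorted_wrt (\<lambda>x y. x / 2 < y / 2) D.xs" "sorted_wrt (\<lambda>x y. (1 + x) / 2 < (1 + y) / 2) E.xs"
      by (rule sorted_wrt_mono_rel[OF _ strict_sorted_list_of_set]; simp)+
    fix a b assume "a \<in> set (map (\<lambda>x. x / 2) D.xs)" "b \<in> set (map (\<lambda>x. (1 + x) / 2) E.xs)"
    then show "a < b" 
      using D.crossing_range E.crossing_range D.finite_crossings E.finite_crossings by fastforce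
  qed
qed (use D.finite_crossings E.finite_crossings in \<open>simp_all add: crossings_stack\<close>)

lemma diagram_word_stack: "diagram_word n S = diagram_word n D @ diagram_word n E"
proof -
  let ?L = "\<lambda>D x. letter_at n D (x, THE y. (x, y) \<in> double_points n D)"
  have "?L S (x / 2) = ?L D x" if x: "x \<in> D.crossings" for x
  proof -
    obtain k l where kl: "x \<in> {0..1}" "k \<in> {1..n}" "l \<in> {1..n}" "k \<noteq> l" "height D k x = height D l x"
      using x by (rule D.crossingE)
    have "?L S (x / 2) = letter_at n S (x / 2, height S k (x / 2))"
      using kl by (intro S.letter_at_crossing[of _ k l]) (auto simp: height_left)
    also have "\<dots> = letter_at n D (x, height D k x)"
      using kl(1) by (simp add: letter_at_def height_left) (simp add: stack_def)
    finally show ?thesis using D.letter_at_crossing[OF kl] by simp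
  qed
  moreover have "?L S ((1 + x) / 2) = ?L E x" if x: "x \<in> E.crossings" for x
  proof -
    obtain k l where kl: "x \<in> {0..1}" "k \<in> {1..n}" "l \<in> {1..n}" "k \<noteq> l" "height E k x = height E l x"
      using x by (rule E.crossingE)
    obtain k' l' where kl': "k' \<in> {1..n}" "strand_end D k' = k" "l' \<in> {1..n}" "strand_end D l' = l"
      using kl(2,3) D.strand_end_bij by (metis bij_betw_imp_surj_on imageE)
    have pos: "0 < x" using E.crossing_range[OF x] by simp
    have h: "height S m ((1 + x) / 2) = height E (strand_end D m) x" if "m \<in> {1..n}" for m
      using height_right[OF that, of "(1 + x) / 2"] pos by (simp add: add_divide_distrib)
    have "?L S ((1 + x) / 2) = letter_at n S ((1 + x) / 2, height S k' ((1 + x) / 2))"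
    proof (rule S.letter_at_crossing)
      show "height S k' ((1 + x) / 2) = height S l' ((1 + x) / 2)" using kl kl' h by simp
    qed (use kl kl' in auto)
    also have "\<dots> = letter_at n E (x, height E k x)"
    proof -
      \<comment> \<open>The arcs of the right half carry the names given by \<open>D\<close>; the
        number of arcs below a crossing does not depend on names.\<close>
      have "strand_end D ` {m\<in>{1..n}. height E (strand_end D m) x < height E k x} =
          {m\<in>strand_end D ` {1..n}. height E m x < height E k x}" by blast
      also have "strand_end D ` {1..n} = {1..n}" using D.strand_end_bij by (rule bij_betw_imp_surj_on)
      finally have "card {m\<in>{1..n}. height E m x < height E k x} =
          card (strand_end D ` {m\<in>{1..n}. height E (strand_end D m) x < height E k x})" by simp
      also have "\<dots> = card {m\<in>{1..n}. height E (strand_end D m) x < height E k x}"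
        by (intro card_image inj_on_subset[OF bij_betw_imp_inj_on[OF D.strand_end_bij]]) auto
      also have "{m\<in>{1..n}. height E (strand_end D m) x < height E k x} =
          {m\<in>{1..n}. height S m ((1 + x) / 2) < height E k x}"
        using h by (intro Collect_cong conj_cong refl) simp
      finally have "card {m\<in>{1..n}. height E m x < height E k x} =
          card {m\<in>{1..n}. height S m ((1 + x) / 2) < height E k x}" .
      moreover have "kind S ((1 + x) / 2, y) = kind E (x, y)" for y
        using pos by (simp add: stack_def add_divide_distrib)
      moreover have "height S k' ((1 + x) / 2) = height E k x" using h kl' by simp
      ultimately show ?thesis unfolding letter_at_def fst_conv snd_conv by (simp only:)
    qed
    finally show ?thesis using E.letter_at_crossing[OF kl] by simp
  qed
  ultimately show ?thesis
    unfolding S.word_eq D.word_eq E.word_eq sorted_crossings_stack map_append map_map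
    using D.finite_crossings E.finite_crossings by (intro arg_cong2[of _ _ _ _ "(@)"] map_cong) auto
qed

end


text \<open>For \<open>i \<in> I\<close> the arcs \<open>i\<close> and \<open>i + 1\<close> exchange
  along power curves meeting at height \<open>i + 1/2\<close> and abscissa
  \<open>(1/2) powr (1 / e i)\<close>. So the exponent sets the time of the crossing, and the
  integer part of the height recovers its index.\<close>

definition elementary :: "nat set \<Rightarrow> (nat \<Rightarrow> real) \<Rightarrow> (nat \<Rightarrow> crossing) \<Rightarrow> strand_diagram" where
  "elementary I e \<kappa> = \<lparr>
     height = (\<lambda>k x. if k \<in> I then real k + x powr e k
       else if k - 1 \<in> I then real k - x powr e (k - 1) else real k),
     kind = (\<lambda>p. \<kappa> (nat \<lfloor>snd p\<rfloor>))\<rparr>"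

definition letter_of :: "crossing \<Rightarrow> nat \<Rightarrow> letter" where
  "letter_of t i = (case t of Positive \<Rightarrow> Sigma i | Negative \<Rightarrow> Sigma_inv i | Welded \<Rightarrow> Rho i)"

locale far_crossings =
  fixes n :: nat and I :: "nat set" and e :: "nat \<Rightarrow> real" and \<kappa> :: "nat \<Rightarrow> crossing"
  assumes I: "I \<subseteq> {1..<n}" and far: "i \<in> I \<Longrightarrow> j \<in> I \<Longrightarrow> i < j \<Longrightarrow> i + 2 \<le> j"
    and e_pos: "0 < e i" and e_inj: "inj_on e I"
begin

abbreviation D :: strand_diagram where
  "D \<equiv> elementary I e \<kappa>"

lemma finite_I: "finite I"
  using I finite_subset by blast

lemma I_pos: "i \<in> I \<Longrightarrow> 1 \<le> i \<and> i < n"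
  using I by auto

lemma h_lower: "i \<in> I \<Longrightarrow> height D i x = real i + x powr e i"
  by (simp add: elementary_def)

lemma h_upper: "i \<in> I \<Longrightarrow> height D (Suc i) x = real (Suc i) - x powr e i"
  using far[of i "Suc i"] by (auto simp: elementary_def)

lemma h_other: "k \<notin> I \<Longrightarrow> k - 1 \<notin> I \<Longrightarrow> height D k x = real k"
  by (simp add: elementary_def)

lemma strand_cases [case_names lower upper other]:
  assumes "1 \<le> k"
  obtains "k \<in> I" | i where "i \<in> I" "k = Suc i" | "k \<notin> I" "k - 1 \<notin> I"
  using assms by (cases k) auto

lemma powr_range: "x \<in> {0..1} \<Longrightarrow> 0 \<le> x powr e i \<and> x powr e i \<le> 1"
  using powr_mono2[of "e i" x 1] e_pos[of i] by auto

lemma powr_half_iff: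
  assumes "0 \<le> x"
  shows "x powr e i = 1/2 \<longleftrightarrow> x = (1/2) powr (1 / e i)"
proof
  assume *: "x powr e i = 1/2"
  then have "x = (x powr e i) powr (1 / e i)"
    using assms e_pos[of i] by (simp add: powr_powr)
  then show "x = (1/2) powr (1 / e i)" unfolding * .
next
  assume "x = (1/2) powr (1 / e i)"
  then show "x powr e i = 1/2" using e_pos[of i] by (simp add: powr_powr)
qed

lemma h_bounds:
  assumes "1 \<le> k" "x \<in> {0..1}"
  shows "k \<notin> I \<Longrightarrow> height D k x \<le> real k" "k - 1 \<notin> I \<Longrightarrow> real k \<le> height D k x"
    "height D k x \<le> real k + 1" "real k - 1 \<le> height D k x"
proof -
  have "(k \<notin> I \<longrightarrow> height D k x \<le> real k) \<and> (k - 1 \<notin> I \<longrightarrow> real k \<le> height D k x) \<and>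
      height D k x \<le> real k + 1 \<and> real k - 1 \<le> height D k x"
    using assms(1)
  proof (cases rule: strand_cases)
    case lower
    then show ?thesis
      using powr_range[OF assms(2), of k] by (auto simp: h_lower intro: order_trans[OF _ powr_ge_zero])
  next
    case (upper i)
    then show ?thesis
      using powr_range[OF assms(2), of i] by (auto simp: h_upper intro: order_trans[OF _ powr_ge_zero])
  next
    case other
    then show ?thesis by (simp add: h_other)
  qed
  then show "k \<notin> I \<Longrightarrow> height D k x \<le> real k" "k - 1 \<notin> I \<Longrightarrow> real k \<le> height D k x"
    "height D k x \<le> real k + 1" "real k - 1 \<le> height D k x" by blast+
qed

text \<open>An arc rises above its level only if its index is in \<open>I\<close>, sinks below it
  only if the preceding index is, and moves by at most 1. As indices in \<open>I\<close> differ by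
  at least 2, only the two arcs of one exchange can touch.\<close>

lemma meet:
  assumes "x \<in> {0..1}" "1 \<le> k" "k < l" "height D k x = height D l x"
  shows "k \<in> I" "l = Suc k" "x powr e k = 1/2"
proof -
  have l: "1 \<le> l" using assms by simp
  show k: "k \<in> I"
  proof (rule ccontr)
    assume "k \<notin> I"
    then have kle: "height D l x \<le> real k" using h_bounds(1)[OF assms(2,1)] assms(4) by simp
    show False
    proof (cases "l - 1 \<in> I")
      case True
      then have "l - 1 \<noteq> k" using \<open>k \<notin> I\<close> by auto
      then have "real k + 1 \<le> real l - 1" using assms(3) by linarith
      then show False using h_bounds(4)[OF l assms(1)] kle by simp
    next
      case False
      then show False using h_bounds(2)[OF l assms(1)] kle assms(3) by simp
    qed
  qed
  show "l = Suc k"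
  proof (rule ccontr)
    assume "l \<noteq> Suc k"
    then have kl: "Suc (Suc k) \<le> l" using assms(3) by simp
    have up: "height D l x \<le> real k + 1" using h_bounds(3)[OF assms(2,1)] assms(4) by simp
    have "l - 1 \<in> I"
    proof (rule ccontr)
      assume "l - 1 \<notin> I"
      then show False using h_bounds(2)[OF l assms(1)] up kl by simp
    qed
    then have "k + 2 \<le> l - 1" using far[OF k] kl by simp
    then have "real k + 2 \<le> real l - 1" by linarith
    then show False using h_bounds(4)[OF l assms(1)] up by simp
  qed
  then show "x powr e k = 1/2" using assms(4) k by (simp add: h_lower h_upper)
qed

lemma meet_sym:
  assumes "x \<in> {0..1}" "k \<in> {1..n}" "l \<in> {1..n}" "k \<noteq> l" "height D k x = height D l x"
  obtains i where "i \<in> I" "{k, l} = {i, Suc i}" "x powr e i = 1/2" "0 < x" "x < 1"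
proof -
  let ?a = "min k l" and ?b = "max k l"
  have "1 \<le> ?a" "?a < ?b" "height D ?a x = height D ?b x"
    using assms(2-5) by (auto simp: min_def max_def)
  note m = meet[OF assms(1) this]
  have "x \<noteq> 0" "x \<noteq> 1" using m(3) e_pos[of ?a] by auto
  moreover have "{k, l} = {?a, ?b}" by (auto simp: min_def max_def)
  ultimately show thesis using m assms(1) by (intro that[of ?a]) auto
qed

lemma elementary_strands: "D \<in> strand_diagrams n"
proof (rule strand_diagramI)
  fix k assume k: "k \<in> {1..n}"
  then have "1 \<le> k" by simp
  have c: "continuous_on {0..1} (\<lambda>x. x powr e i)" for i
    using e_pos by (intro continuous_on_powr' continuous_on_id continuous_on_const) auto
  show "continuous_on {0..1} (height D k)"
    using \<open>1 \<le> k\<close>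
  proof (cases rule: strand_cases)
    case lower
    have "continuous_on {0..1} (\<lambda>x. real k + x powr e k)" by (intro continuous_on_add continuous_on_const c)
    then show ?thesis by (rule continuous_on_eq) (simp add: h_lower[OF lower])
  next
    case (upper i)
    have "continuous_on {0..1} (\<lambda>x. real (Suc i) - x powr e i)" by (intro continuous_on_diff continuous_on_const c)
    then show ?thesis unfolding upper(2) by (rule continuous_on_eq) (simp only: h_upper[OF upper(1)])
  next
    case other
    have "continuous_on {0..1} (\<lambda>x::real. real k)" by (intro continuous_intros)
    then show ?thesis by (rule continuous_on_eq) (simp add: h_other[OF other])
  qed
  show "height D k 0 = real k"
    using \<open>1 \<le> k\<close> by (cases rule: strand_cases) (auto simp: h_lower h_upper h_other)
next
  have inj: "inj_on (\<lambda>k. height D k 1) {1..n}"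
  proof (rule inj_onI, rule ccontr)
    fix k l assume kl: "k \<in> {1..n}" "l \<in> {1..n}" "height D k 1 = height D l 1" "k \<noteq> l"
    have "(1::real) \<in> {0..1}" by simp
    then obtain i where "(1::real) < 1" using kl(1,2,4,3) by (rule meet_sym)
    then show False by simp
  qed
  have "height D k 1 \<in> real ` {1..n}" if "k \<in> {1..n}" for k
  proof -
    have "1 \<le> k" using that by simp
    then show ?thesis
    proof (cases rule: strand_cases)
      case lower then show ?thesis using I_pos[of k] by (intro image_eqI[of _ _ "Suc k"]) (auto simp: h_lower)
    next
      case (upper i) then show ?thesis using I_pos[of i] by (intro image_eqI[of _ _ i]) (auto simp: h_upper)
    next
      case other then show ?thesis using that by (intro image_eqI[of _ _ k]) (auto simp: h_other)
    qed
  qed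
  then have "(\<lambda>k. height D k 1) ` {1..n} \<subseteq> real ` {1..n}" by auto
  moreover have "card ((\<lambda>k. height D k 1) ` {1..n}) = card (real ` {1..n})"
    by (simp only: card_image[OF inj] card_image[OF inj_on_of_nat])
  ultimately have "(\<lambda>k. height D k 1) ` {1..n} = real ` {1..n}"
    by (intro card_subset_eq) simp_all
  then show "bij_betw (\<lambda>k. height D k 1) {1..n} (real ` {1..n})" using inj by (simp add: bij_betw_def)
next
  show "finite ((\<lambda>i. (1/2) powr (1 / e i)) ` I)" using finite_I by simp
next
  fix x k l assume kl: "x \<in> {0..1}" "k \<in> {1..n}" "l \<in> {1..n}" "k \<noteq> l" "height D k x = height D l x"
  obtain i where i: "i \<in> I" "{k, l} = {i, Suc i}" "x powr e i = 1/2" "0 < x" "x < 1"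
    using kl by (rule meet_sym)
  show "x \<in> (\<lambda>i. (1/2) powr (1 / e i)) ` I"
    using i powr_half_iff[of x i] by auto
  have b: "above_before D (Suc i) i x"
    unfolding above_before_def eventually_at_left_field
  proof (intro exI[of _ 0] conjI allI impI)
    fix s assume "0 < s" "s < x"
    then have "s powr e i < 1/2" using powr_less_mono2[of "e i" s x] e_pos[of i] i(3) by simp
    then show "height D i s < height D (Suc i) s" using i(1) by (simp add: h_lower h_upper)
  qed (use i in auto)
  have a: "above_after D i (Suc i) x"
    unfolding above_after_def eventually_at_right_field
  proof (intro exI[of _ 1] conjI allI impI)
    fix s assume "x < s" "s < 1"
    then have "1/2 < s powr e i" using powr_less_mono2[of "e i" x s] e_pos[of i] i(3,4) by simp
    then show "height D (Suc i) s < height D i s" using i(1) by (simp add: h_lower h_upper)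
  qed (use i in auto)
  show "(above_before D k l x \<and> above_after D l k x) \<or> (above_before D l k x \<and> above_after D k l x)"
    using a b i(2) by (auto simp: doubleton_eq_iff)
  fix k' l' assume kl': "k' \<in> {1..n}" "l' \<in> {1..n}" "k' \<noteq> l'" "height D k' x = height D l' x"
  obtain j where j: "j \<in> I" "{k', l'} = {j, Suc j}" "x powr e j = 1/2" "0 < x" "x < 1"
    using kl(1) kl' by (rule meet_sym)
  have "e i = e j" using i(3-5) j(3) powr_inj[of x "e i" "e j"] by simp
  then have "i = j" using e_inj i(1) j(1) by (auto dest: inj_onD)
  then show "{k', l'} = {k, l}" using i(2) j(2) by simp
qed

sublocale strands n D
  by standard (rule elementary_strands)

lemma crossings_elementary: "crossings = (\<lambda>i. (1/2) powr (1 / e i)) ` I"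
proof
  show "crossings \<subseteq> (\<lambda>i. (1/2) powr (1 / e i)) ` I"
  proof
    fix x assume "x \<in> crossings"
    then obtain k l where kl: "x \<in> {0..1}" "k \<in> {1..n}" "l \<in> {1..n}" "k \<noteq> l" "h k x = h l x"
      by (rule crossingE)
    obtain i where i: "i \<in> I" "{k, l} = {i, Suc i}" "x powr e i = 1/2" "0 < x" "x < 1"
      using kl by (rule meet_sym)
    then show "x \<in> (\<lambda>i. (1/2) powr (1 / e i)) ` I" using powr_half_iff[of x i] by auto
  qed
  show "(\<lambda>i. (1/2) powr (1 / e i)) ` I \<subseteq> crossings"
  proof clarify
    fix i assume i: "i \<in> I"
    let ?x = "(1/2) powr (1 / e i)"
    have "?x powr e i = 1/2" using powr_half_iff[of ?x i] by simp
    moreover have "?x \<in> {0..1}" using powr_mono2[of "1 / e i" "1/2" 1] e_pos[of i] by simp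
    ultimately show "?x \<in> crossings"
      using i I_pos[OF i] by (intro crossingI[of _ i "Suc i"]) (auto simp: h_lower h_upper)
  qed
qed

lemma letter_at_elementary:
  assumes i: "i \<in> I"
  defines "x \<equiv> (1/2) powr (1 / e i)"
  shows "letter_at n D (x, THE y. (x, y) \<in> double_points n D) = letter_of (\<kappa> i) i"
proof -
  have half: "x powr e i = 1/2" using powr_half_iff[of x i] by (simp add: x_def)
  have x: "x \<in> {0..1}" using powr_mono2[of "1 / e i" "1/2" 1] e_pos[of i] by (simp add: x_def)
  have hi: "h i x = real i + 1/2" "h (Suc i) x = real i + 1/2"
    using half i by (simp_all add: h_lower h_upper)
  have "{m\<in>{1..n}. h m x < real i + 1/2} = {1..<i}"
  proof (rule Set.set_eqI)
    fix m
    consider "m = 0" | "1 \<le> m" "m < i" | "m = i \<or> m = Suc i" | "Suc i < m" by linarith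
    then show "m \<in> {m\<in>{1..n}. h m x < real i + 1/2} \<longleftrightarrow> m \<in> {1..<i}"
    proof cases
      case 2
      then have "real m + 1 \<le> real i" by linarith
      then have "h m x < real i + 1/2" using h_bounds(3)[OF 2(1) x] by linarith
      with 2 I_pos[OF i] show ?thesis by simp
    next
      case 3 with hi show ?thesis by auto
    next
      case 4
      then have "real i + 1 \<le> real m - 1" "1 \<le> m" by linarith+
      then have "\<not> h m x < real i + 1/2" using h_bounds(4)[of m x] x by linarith
      with 4 show ?thesis by simp
    qed simp
  qed
  then have "card {m\<in>{1..n}. h m x < real i + 1/2} + 1 = i" using I_pos[OF i] by simp
  moreover have "nat \<lfloor>real i + 1/2\<rfloor> = i" by linarith
  then have "kind D (x, real i + 1/2) = \<kappa> i" by (simp add: elementary_def)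
  moreover have "letter_at n D (x, THE y. (x, y) \<in> double_points n D) = letter_at n D (x, real i + 1/2)"
    using letter_at_crossing[of x i "Suc i"] x I_pos[OF i] hi by simp
  ultimately show ?thesis by (simp add: letter_at_def letter_of_def)
qed

end

lemma elementary_word_single:
  assumes "1 \<le> i" "i < n"
  shows "elementary {i} (\<lambda>_. 1) \<kappa> \<in> strand_diagrams n"
    "diagram_word n (elementary {i} (\<lambda>_. 1) \<kappa>) = [letter_of (\<kappa> i) i]"
proof -
  interpret far_crossings n "{i}" "\<lambda>_. 1" \<kappa> by standard (use assms in auto)
  show "D \<in> strand_diagrams n" by (rule elementary_strands)
  show "word = [letter_of (\<kappa> i) i]"
    unfolding word_eq crossings_elementary using letter_at_elementary[of i] by simp
qed

text \<open>The smaller exponent crosses first. Which of \<open>i\<close> and \<open>j\<close> is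
  larger is left open, so both words of a distant commutation are covered.\<close>

lemma elementary_word_pair:
  assumes "1 \<le> i" "i < n" "1 \<le> j" "j < n" "i + 2 \<le> j \<or> j + 2 \<le> i" "0 < e i" "e i < e j" "\<And>k. 0 < e k"
  shows "elementary {i, j} e \<kappa> \<in> strand_diagrams n"
    "diagram_word n (elementary {i, j} e \<kappa>) = [letter_of (\<kappa> i) i, letter_of (\<kappa> j) j]"
proof -
  interpret far_crossings n "{i, j}" e \<kappa> by standard (use assms in auto)
  show "D \<in> strand_diagrams n" by (rule elementary_strands)
  have "1 / e j < 1 / e i" using assms by (simp add: frac_less2)
  then have less: "(1/2) powr (1 / e i) < (1/2::real) powr (1 / e j)"
    using powr_less_mono'[of "1/2" "1 / e j" "1 / e i"] by simp
  have "xs = [(1/2) powr (1 / e i), (1/2) powr (1 / e j)]"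
    by (rule strict_sorted_equal) (use less finite_crossings in \<open>simp_all add: crossings_elementary\<close>)
  then show "word = [letter_of (\<kappa> i) i, letter_of (\<kappa> j) j]"
    unfolding word_eq using letter_at_elementary[of i] letter_at_elementary[of j] by simp
qed

lemma trivial_strands_word:
  "trivial_strands \<in> strand_diagrams n" "diagram_word n trivial_strands = []"
proof -
  interpret far_crossings n "{}" "\<lambda>_. 1" "\<lambda>_. Welded" by standard auto
  have eq: "D = trivial_strands" by (simp add: elementary_def trivial_strands_def)
  show "trivial_strands \<in> strand_diagrams n" using elementary_strands eq by simp
  have "word = []" unfolding word_eq crossings_elementary by simp
  with eq show "diagram_word n trivial_strands = []" by simp
qed

lemma stack_diagrams:
  assumes "D \<in> strand_diagrams n" "E \<in> strand_diagrams n"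
  shows "stack D E \<in> strand_diagrams n" "diagram_word n (stack D E) = diagram_word n D @ diagram_word n E"
proof -
  interpret two_strands n D E by standard (fact assms)+
  show "stack D E \<in> strand_diagrams n" "diagram_word n (stack D E) = diagram_word n D @ diagram_word n E"
    by (rule stack_strands, rule diagram_word_stack)
qed

lemma letter_of_cases:
  obtains t where "l = letter_of t (letter_index l)"
  using that[of Positive] that[of Negative] that[of Welded] by (cases l) (auto simp: letter_of_def)

lemma ex_diagram:
  assumes "valid_word n w"
  shows "\<exists>D\<in>strand_diagrams n. diagram_word n D = w"
  using assms
proof (induction w)
  case Nil
  show ?case using trivial_strands_word by blast
next
  case (Cons l w)
  then obtain D where D: "D \<in> strand_diagrams n" "diagram_word n D = w" by auto
  obtain t where "l = letter_of t (letter_index l)" by (rule letter_of_cases)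
  then have "stack (elementary {letter_index l} (\<lambda>_. 1) (\<lambda>_. t)) D \<in> strand_diagrams n"
    "diagram_word n (stack (elementary {letter_index l} (\<lambda>_. 1) (\<lambda>_. t)) D) = l # w"
    using elementary_word_single[of "letter_index l" n "\<lambda>_. t"] stack_diagrams Cons.prems D by auto
  then show ?case by blast
qed


section \<open>Planar isotopies\<close>

context strands
begin

lemma not_both_above_before: "\<not> (above_before D k l x \<and> above_before D l k x)"
proof
  assume "above_before D k l x \<and> above_before D l k x"
  then have "eventually (\<lambda>s. h l s < h k s \<and> h k s < h l s) (at_left x)"
    unfolding above_before_def by (auto intro: eventually_conj)
  then have "eventually (\<lambda>s. False) (at_left x)" by (rule eventually_mono) auto
  then show False by simp
qed

lemma first_meeting:
  assumes "k \<in> {1..n}" "l \<in> {1..n}" "0 < x" "x \<le> 1" "\<And>s. 0 \<le> s \<Longrightarrow> s < x \<Longrightarrow> h k s \<noteq> h l s"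
  shows "above_before D k l x \<longleftrightarrow> l < k"
  using above_before_iff[OF assms(1,2) order_refl assms(3-5)] h_0 assms(1,2) by simp

text \<open>Between consecutive meetings the order is constant and at each meeting it is reversed,
  so the answer alternates. Together with \<open>first_meeting\<close> this determines the order at
  a crossing from the labels and the number of earlier meetings, data that a homeomorphism
  preserves.\<close>

lemma next_meeting:
  assumes kl: "k \<in> {1..n}" "l \<in> {1..n}" "k \<noteq> l" and x: "0 \<le> p" "p < x" "x \<le> 1"
    and p: "h k p = h l p" and ne: "\<And>s. p < s \<Longrightarrow> s < x \<Longrightarrow> h k s \<noteq> h l s"
  shows "above_before D k l x \<longleftrightarrow> \<not> above_before D k l p"
proof -
  obtain t where t: "p < t" "t < x" using dense[OF x(2)] by auto
  have b: "above_before D k l x \<longleftrightarrow> h l t < h k t"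
    by (rule above_before_iff[OF kl(1,2)]) (use x t ne in auto)
  have a1: "above_after D k l p \<longleftrightarrow> h l t < h k t"
    by (rule above_after_iff[OF kl(1,2)]) (use x t ne in auto)
  have "h l s \<noteq> h k s" if "p < s" "s \<le> t" for s using ne[of s] that t by auto
  then have a2: "above_after D l k p \<longleftrightarrow> h k t < h l t"
    by (intro above_after_iff[OF kl(2,1)]) (use x t in auto)
  have "p \<in> {0..1}" using x by simp
  from transversal[OF this kl p] not_both_above_before[of k l p] show ?thesis
    unfolding a1 a2 b by auto
qed

end

text \<open>\<open>continuous_inj_imp_mono\<close> compares an interior point with the ends only, so
  it is used on \<open>{0..1}\<close> and once more on \<open>{x..1}\<close>.\<close>

lemma continuous_inj_strict_mono:
  fixes f :: "real \<Rightarrow> real"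
  assumes cont: "continuous_on {0..1} f" and inj: "inj_on f {0..1}" and f: "f 0 < f 1"
  shows "strict_mono_on {0..1} f"
proof (rule strict_mono_onI)
  fix x y :: real assume xy: "x \<in> {0..1}" "y \<in> {0..1}" "x < y"
  have mid: "f 0 < f z \<and> f z < f 1" if "0 < z" "z < 1" for z
    using continuous_inj_imp_mono[OF that cont inj] f by auto
  consider "y = 1" "x = 0" | "y = 1" "0 < x" | "y < 1" "x = 0" | "y < 1" "0 < x" using xy by fastforce
  then show "f x < f y"
  proof cases
    case 4
    have "continuous_on {x..1} f" "inj_on f {x..1}"
      using cont inj xy by (auto intro: continuous_on_subset inj_on_subset)
    from continuous_inj_imp_mono[OF xy(3) 4(1) this] mid[of y] xy 4 show ?thesis by auto
  qed (use mid xy f in auto)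
qed

text \<open>The final homeomorphism maps each arc, a graph, onto a graph and fixes the boundary. So
  it acts on the abscissas of the arc \<open>k\<close> by an increasing map \<open>\<phi> k\<close>;
  meetings go to meetings, and the order of the arcs there is recovered by alternation.\<close>

lemma isotopic_reparametrize:
  assumes D: "D \<in> strand_diagrams n" and D': "D' \<in> strand_diagrams n" and iso: "planar_isotopic n D D'"
  shows "\<exists>\<phi>. reparametrization \<phi> \<and> gauss_of n D' = reparametrize \<phi> (gauss_of n D)"
proof -
  interpret A: strands n D by standard (rule D)
  interpret B: strands n D' by standard (rule D')
  obtain H G where H: "homeomorphism strip strip (H 1) G"
    "\<forall>p\<in>{0, 1} \<times> UNIV. H 1 p = p"
    "\<forall>k\<in>{1..n}. H 1 ` arc_points D k = arc_points D' k"
    "\<forall>p\<in>double_points n D. kind D' (H 1 p) = kind D p"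
    using iso unfolding planar_isotopic_def by (metis atLeastAtMost_iff order_refl zero_le_one)
  define F where "F = (H 1 :: real \<times> real \<Rightarrow> real \<times> real)"
  have inj: "p = q" if "F p = F q" "p \<in> strip" "q \<in> strip" for p q
    using H(1) that unfolding F_def homeomorphism_def by metis
  have bd: "F (0, y) = (0, y)" "F (1, y) = (1, y)" for y
    using H(2) unfolding F_def by auto
  \<comment> \<open>The identity for all other indices, because \<open>reparametrization\<close>
    speaks about every index.\<close>
  define \<phi> where "\<phi> k x = (if k \<in> {1..n} then fst (F (x, A.h k x)) else x)" for k x
  have F: "F (x, A.h k x) = (\<phi> k x, B.h k (\<phi> k x))" "\<phi> k x \<in> {0..1}" if "k \<in> {1..n}" "x \<in> {0..1}" for k x
  proof -
    have "(x, A.h k x) \<in> arc_points D k" using that by (auto simp: arc_points_def)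
    then have "F (x, A.h k x) \<in> arc_points D' k" using H(3) that unfolding F_def by blast
    then obtain z where "F (x, A.h k x) = (z, B.h k z)" "z \<in> {0..1}" by (auto simp: arc_points_def)
    then show "F (x, A.h k x) = (\<phi> k x, B.h k (\<phi> k x))" "\<phi> k x \<in> {0..1}" using that by (auto simp: \<phi>_def)
  qed
  have sm: "strict_mono_on {0..1} (\<phi> k)" and ct: "continuous_on {0..1} (\<phi> k)" if k: "k \<in> {1..n}" for k
  proof -
    have "continuous_on strip F" using H(1) unfolding F_def homeomorphism_def by blast
    then have "continuous_on {0..1} (\<lambda>x. F (x, A.h k x))"
      by (rule continuous_on_compose2) (auto intro!: continuous_on_Pair continuous_on_id A.continuous_h[OF k])
    then show ct: "continuous_on {0..1} (\<phi> k)" using k by (simp add: \<phi>_def[abs_def] continuous_on_fst)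
    have "inj_on (\<phi> k) {0..1}"
    proof (rule inj_onI)
      fix x y assume xy: "x \<in> {0..1}" "y \<in> {0..1}" "\<phi> k x = \<phi> k y"
      then have "F (x, A.h k x) = F (y, A.h k y)" using F(1)[OF k] by simp
      then have "(x, A.h k x) = (y, A.h k y)" by (rule inj) (use xy in auto)
      then show "x = y" by simp
    qed
    moreover have "\<phi> k 0 < \<phi> k 1" using k bd by (simp add: \<phi>_def)
    ultimately show "strict_mono_on {0..1} (\<phi> k)" using ct by (intro continuous_inj_strict_mono)
  qed
  have "strict_mono_on {0..1} (\<phi> k) \<and> continuous_on {0..1} (\<phi> k) \<and> \<phi> k 0 = 0 \<and> \<phi> k 1 = 1" for k
  proof (cases "k \<in> {1..n}")
    case True
    then show ?thesis using sm ct bd by (simp add: \<phi>_def)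
  next
    case False
    then have "\<phi> k x = x" for x unfolding \<phi>_def by (simp only: if_False)
    then have "\<phi> k = (\<lambda>x. x)" by (intro ext)
    then show ?thesis by (simp add: strict_mono_on_def continuous_on_id)
  qed
  then have rep: "reparametrization \<phi>" by (simp add: reparametrization_def)
  have less: "\<phi> k x < \<phi> k y \<longleftrightarrow> x < y" if "x \<in> {0..1}" "y \<in> {0..1}" for k x y
    by (rule reparametrization_less_iff[OF rep that])
  have meet: "\<phi> l x = \<phi> k x" "B.h k (\<phi> k x) = B.h l (\<phi> k x)"
    if "k \<in> {1..n}" "l \<in> {1..n}" "x \<in> {0..1}" "A.h k x = A.h l x" for k l x
    using F(1)[OF that(1,3)] F(1)[OF that(2,3)] that(4) by auto
  have meet': "\<exists>x\<in>{0..1}. \<phi> k x = z \<and> A.h k x = A.h l x"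
    if kl: "k \<in> {1..n}" "l \<in> {1..n}" "z \<in> {0..1}" "B.h k z = B.h l z" for k l z
  proof -
    have "(z, B.h k z) \<in> F ` arc_points D k" "(z, B.h l z) \<in> F ` arc_points D l"
      using H(3) kl unfolding F_def by (auto simp: arc_points_def)
    then obtain x y where xy: "x \<in> {0..1}" "F (x, A.h k x) = (z, B.h k z)" "y \<in> {0..1}" "F (y, A.h l y) = (z, B.h l z)"
      by (auto simp: arc_points_def)
    then have "F (x, A.h k x) = F (y, A.h l y)" using kl(4) by simp
    then have "(x, A.h k x) = (y, A.h l y)" by (rule inj) (use xy in auto)
    moreover have "\<phi> k x = z" using F(1)[OF kl(1) xy(1)] xy(2) by simp
    ultimately show ?thesis using xy(1) by auto
  qed
  \<comment> \<open>Induction over the meetings of the two arcs from the left: in both diagrams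
    their order starts from the labels and alternates. This takes the place of an orientation
    argument in the plane.\<close>
  have above: "above_before D k l x \<longleftrightarrow> above_before D' k l (\<phi> k x)"
    if kl: "k \<in> {1..n}" "l \<in> {1..n}" "k \<noteq> l" and x: "x \<in> {0..1}" "A.h k x = A.h l x" for k l x
  proof -
    define C where "C = {c \<in> {0..1}. A.h k c = A.h l c}"
    have fin: "finite C"
      by (rule finite_subset[OF _ A.finite_crossings]) (use kl in \<open>auto simp: C_def intro: A.crossingI\<close>)
    have below: "\<exists>c\<in>C. c < y \<and> s = \<phi> k c"
      if "y \<in> {0..1}" "0 \<le> s" "s < \<phi> k y" "B.h k s = B.h l s" for y s
    proof -
      have "\<phi> k y \<in> {0..1}" using F(2)[OF kl(1) that(1)] .
      then have "s \<in> {0..1}" using that by auto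
      from meet'[OF kl(1,2) this that(4)] obtain c where "c \<in> {0..1}" "\<phi> k c = s" "A.h k c = A.h l c" by blast
      then show ?thesis using less[of c y k] that by (intro bexI[of _ c]) (auto simp: C_def)
    qed
    have "above_before D k l y \<longleftrightarrow> above_before D' k l (\<phi> k y)" if "y \<in> C" for y
      using that
    proof (induction "card {c \<in> C. c < y}" arbitrary: y rule: less_induct)
      case less
      have y: "y \<in> {0..1}" "A.h k y = A.h l y" using less.prems by (auto simp: C_def)
      then have "y \<in> A.crossings" using kl by (intro A.crossingI)
      then have y0: "0 < y" "y \<le> 1" using A.crossing_range by force+
      have p1: "\<phi> k y \<le> 1" using F(2)[OF kl(1) y(1)] by simp
      have p0: "0 < \<phi> k y" using \<open>\<And>k x y. x \<in> {0..1} \<Longrightarrow> y \<in> {0..1} \<Longrightarrow> (\<phi> k x < \<phi> k y) = (x < y)\<close>[of 0 y k] y0 rep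
        by (simp add: reparametrization_def)
      show ?case
      proof (cases "{c \<in> C. c < y} = {}")
        case True
        have "above_before D k l y \<longleftrightarrow> l < k"
        proof (rule A.first_meeting[OF kl(1,2) y0])
          fix s assume "0 \<le> s" "s < y"
          then show "A.h k s \<noteq> A.h l s" using True y0 by (auto simp: C_def)
        qed
        moreover have "above_before D' k l (\<phi> k y) \<longleftrightarrow> l < k"
        proof (rule B.first_meeting[OF kl(1,2) p0 p1])
          fix s assume "0 \<le> s" "s < \<phi> k y"
          then show "B.h k s \<noteq> B.h l s" using True below[OF y(1)] by blast
        qed
        ultimately show ?thesis by simp
      next
        case False
        define p where "p = Max {c \<in> C. c < y}"
        have "p \<in> {c \<in> C. c < y}" unfolding p_def using fin False by (intro Max_in) auto
        then have p: "p \<in> C" "p < y" by auto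
        then have p01: "p \<in> {0..1}" "A.h k p = A.h l p" by (auto simp: C_def)
        have max: "c \<le> p" if "c \<in> C" "c < y" for c
          unfolding p_def using fin that by (intro Max_ge) auto
        have "{c \<in> C. c < p} \<subset> {c \<in> C. c < y}" using p by auto
        then have "card {c \<in> C. c < p} < card {c \<in> C. c < y}" using fin by (intro psubset_card_mono) auto
        then have IH: "above_before D k l p \<longleftrightarrow> above_before D' k l (\<phi> k p)" using less.hyps p by blast
        have "above_before D k l y \<longleftrightarrow> \<not> above_before D k l p"
        proof (rule A.next_meeting[OF kl _ p(2) y0(2) p01(2)])
          fix s assume "p < s" "s < y"
          then show "A.h k s \<noteq> A.h l s" using max[of s] p01 y0 by (auto simp: C_def)
        qed (use p01 in auto)
        moreover have "above_before D' k l (\<phi> k y) \<longleftrightarrow> \<not> above_before D' k l (\<phi> k p)"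
        proof (rule B.next_meeting[OF kl _ _ p1])
          show "0 \<le> \<phi> k p" using F(2)[OF kl(1) p01(1)] by simp
          show "\<phi> k p < \<phi> k y" using reparametrization_less_iff[OF rep p01(1) y(1)] p(2) by simp
          show "B.h k (\<phi> k p) = B.h l (\<phi> k p)" by (rule meet(2)[OF kl(1,2) p01])
          fix s assume s: "\<phi> k p < s" "s < \<phi> k y"
          show "B.h k s \<noteq> B.h l s"
          proof
            assume "B.h k s = B.h l s"
            then obtain c where c: "c \<in> C" "c < y" "s = \<phi> k c"
              using below[OF y(1), of s] s F(2)[OF kl(1) p01(1)] by auto
            then have "c \<in> {0..1}" by (simp add: C_def)
            then have "\<not> p < c" using max[OF c(1,2)] by simp
            then show False using reparametrization_less_iff[OF rep p01(1) \<open>c \<in> {0..1}\<close>] s c by simp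
          qed
        qed
        ultimately show ?thesis using IH by simp
      qed
    qed
    moreover have "x \<in> C" using x by (simp add: C_def)
    ultimately show ?thesis by blast
  qed
  have kind: "kind D' (\<phi> k x, B.h k (\<phi> k x)) = kind D (x, A.h k x)"
    if "k \<in> {1..n}" "l \<in> {1..n}" "k \<noteq> l" "x \<in> {0..1}" "A.h k x = A.h l x" for k l x
    using H(4) A.double_pointI[OF that(4,1,2,3,5)] F(1)[OF that(1,4)] unfolding F_def by metis
  have over: "passes_over D k l x \<longleftrightarrow> passes_over D' k l (\<phi> k x)"
    if "k \<in> {1..n}" "l \<in> {1..n}" "k \<noteq> l" "x \<in> {0..1}" "A.h k x = A.h l x" for k l x
    using kind[OF that] above[OF that] above[OF that(2,1) _ that(4)] meet(1)[OF that(1,2,4,5)] that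
    by (simp add: passes_over_def split: crossing.split)
  let ?m = "map_arrow (\<lambda>(i, x). (i, \<phi> i x))"
  let ?a = "\<lambda>D k l x. \<lparr>tail = (k, x), head = (l, x), arrow_sign = (if kind D (x, height D k x) = Positive then 1 else -1)\<rparr>"
  let ?P = "\<lambda>D k l x. k \<in> {1..n} \<and> l \<in> {1..n} \<and> k \<noteq> l \<and> x \<in> {0..1} \<and> height D k x = height D l x \<and> passes_over D k l x"
  have image: "?m (?a D k l x) = ?a D' k l (\<phi> k x)" "?P D' k l (\<phi> k x)" if "?P D k l x" for k l x
    using that kind[of k l x] meet[of k l x] over[of k l x] F(2)[of k x] by (simp_all add: map_arrow_def)
  have "{?a D' k l z | k l z. ?P D' k l z} = ?m ` {?a D k l x | k l x. ?P D k l x}"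
  proof (intro equalityI subsetI)
    fix \<alpha> assume "\<alpha> \<in> {?a D' k l z | k l z. ?P D' k l z}"
    then obtain k l z where \<alpha>: "\<alpha> = ?a D' k l z" and P: "?P D' k l z" by blast
    then obtain x where x: "x \<in> {0..1}" "\<phi> k x = z" "A.h k x = A.h l x" using meet'[of k l z] by blast
    then have "?P D k l x" using P over[of k l x] by blast
    moreover from image(1)[OF this] have "\<alpha> = ?m (?a D k l x)" using \<alpha> x(2) by simp
    ultimately show "\<alpha> \<in> ?m ` {?a D k l x | k l x. ?P D k l x}" by blast
  next
    fix \<alpha> assume "\<alpha> \<in> ?m ` {?a D k l x | k l x. ?P D k l x}"
    then obtain k l x where "\<alpha> = ?m (?a D k l x)" "?P D k l x" by blast
    then show "\<alpha> \<in> {?a D' k l z | k l z. ?P D' k l z}" using image[of k l x] by blast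
  qed
  then have "arrows (gauss_of n D') = ?m ` arrows (gauss_of n D)" by (simp only: gauss_of_def gauss_diagram.select_convs)
  moreover have "label (gauss_of n D') = label (gauss_of n D)"
  proof -
    have "B.h k 1 = A.h k 1" if "k \<in> {1..n}" for k
      using F(1)[OF that, of 1] bd(2)[of "A.h k 1"] by auto
    then have "strand_end D' k = strand_end D k" if "k \<in> {1..n}" for k
      using that by (simp add: strand_end_def)
    then show ?thesis by (auto simp: gauss_of_def)
  qed
  ultimately have "gauss_of n D' = reparametrize \<phi> (gauss_of n D)"
    by (simp add: reparametrize_def)
  with rep show ?thesis by blast
qed

text \<open>The isotopy which exchanges two distant crossings.  In \<open>stack U (stack E V)\<close> the diagram \<open>E\<close>
  occupies the window \<open>1/2 \<le> x \<le> 3/4\<close>.  In its coordinate \<open>4 * x - 2\<close> the points of height \<open>y\<close> are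
  moved horizontally by a power whose exponent runs from \<open>1\<close> at \<open>t = 0\<close> to \<open>2 powr c y\<close> at \<open>t = 1\<close>, so
  crossings at different heights move independently.\<close>

definition shear :: "(real \<Rightarrow> real) \<Rightarrow> real \<Rightarrow> real \<times> real \<Rightarrow> real \<times> real" where
  "shear c t = (\<lambda>(x, y). let m = max (1/2) (min (3/4) x) in
     (x - m + (2 + (4 * m - 2) powr (2 powr (t * c y))) / 4, y))"

lemma shear_simps:
  "x \<le> 1/2 \<Longrightarrow> shear c t (x, y) = (x, y)"
  "3/4 \<le> x \<Longrightarrow> shear c t (x, y) = (x, y)"
  "0 \<le> s \<Longrightarrow> s \<le> 1 \<Longrightarrow> shear c t ((2 + s) / 4, y) = ((2 + s powr (2 powr (t * c y))) / 4, y)"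
proof -
  have m: "x \<le> 1/2 \<Longrightarrow> max (1/2) (min (3/4) x) = 1/2" "3/4 \<le> x \<Longrightarrow> max (1/2) (min (3/4) x) = 3/4"
    by (simp_all add: max_def min_def)
  show "x \<le> 1/2 \<Longrightarrow> shear c t (x, y) = (x, y)" by (simp add: shear_def m(1))
  show "3/4 \<le> x \<Longrightarrow> shear c t (x, y) = (x, y)" by (simp add: shear_def m(2))
  assume s: "0 \<le> s" "s \<le> 1"
  then have "max (1/2) (min (3/4) ((2 + s) / 4)) = (2 + s) / 4" by (simp add: max_def min_def)
  moreover have "4 * ((2 + s) / 4) - 2 = s" by (simp add: field_simps)
  ultimately show "shear c t ((2 + s) / 4, y) = ((2 + s powr (2 powr (t * c y))) / 4, y)"
    by (simp add: shear_def Let_def)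
qed

lemma shear_cases [case_names left middle right]:
  fixes x :: real
  obtains "x \<le> 1/2" | s where "0 < s" "s \<le> 1" "x = (2 + s) / 4" | "3/4 < x"
proof -
  consider "x \<le> 1/2" | "1/2 < x" "x \<le> 3/4" | "3/4 < x" by linarith
  then show thesis
  proof cases
    case 2
    then show thesis by (intro that(2)[of "4 * x - 2"]) auto
  qed (use that in blast)+
qed

text \<open>The two bounds are used with different \<open>q\<close>: positivity with
  \<open>2 powr r\<close> for \<open>q\<close>, the upper bound with \<open>r\<close> itself, so
  that both speak about \<open>s powr (2 powr r)\<close>.\<close>

lemma powr_unit: "0 < s \<Longrightarrow> s \<le> 1 \<Longrightarrow> 0 < s powr q \<and> s powr (2 powr q) \<le> (1::real)"
  using powr_mono2[of "2 powr q" s 1] by simp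

text \<open>The exponents \<open>2 powr (t * c y)\<close> and \<open>2 powr (- t * c y)\<close>
  multiply to 1, and the height \<open>y\<close> that determines them is unchanged.\<close>

lemma shear_inverse: "shear c (- t) (shear c t p) = p"
proof (cases p)
  case (Pair x y)
  show ?thesis
  proof (cases x rule: shear_cases)
    case (middle s)
    have "2 powr (t * c y) * 2 powr (- (t * c y)) = (2 :: real) powr 0" by (simp only: powr_add[symmetric]) simp
    then have "(s powr (2 powr (t * c y))) powr (2 powr (- t * c y)) = s"
      using middle by (simp add: powr_powr)
    then show ?thesis
      unfolding Pair middle(3)
      using middle(1,2) powr_unit[of s "t * c y"] powr_unit[of s "2 powr (t * c y)"]
      by (simp add: shear_simps(3))
  qed (simp_all add: Pair shear_simps)
qed

lemma shear_strip: "p \<in> strip \<Longrightarrow> shear c t p \<in> strip"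
proof (cases p)
  case (Pair x y)
  assume p: "p \<in> strip"
  show ?thesis
  proof (cases x rule: shear_cases)
    case (middle s)
    then show ?thesis
      unfolding Pair middle(3) using powr_unit[of s "t * c y"] powr_unit[of s "2 powr (t * c y)"]
      by (simp add: shear_simps(3))
  qed (use p Pair in \<open>simp_all add: shear_simps\<close>)
qed

lemma continuous_shear:
  assumes "continuous_on UNIV c"
  shows "continuous_on UNIV (\<lambda>(t, p). shear c t p)"
proof -
  have c: "continuous_on UNIV (\<lambda>z. c (f z))" if "continuous_on UNIV f" for f :: "real \<times> real \<times> real \<Rightarrow> real"
    by (rule continuous_on_compose2[OF assms that]) simp
  have m: "continuous_on UNIV (\<lambda>z :: real \<times> real \<times> real. max (1/2) (min (3/4) (fst (snd z))))"
    by (intro continuous_intros)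
  have e: "continuous_on UNIV (\<lambda>z :: real \<times> real \<times> real. 2 powr (fst z * c (snd (snd z))))"
    by (intro continuous_on_powr continuous_on_mult c continuous_intros) simp
  have "continuous_on UNIV (\<lambda>z :: real \<times> real \<times> real.
      (4 * max (1/2) (min (3/4) (fst (snd z))) - 2) powr (2 powr (fst z * c (snd (snd z)))))"
    by (intro continuous_on_powr' continuous_on_diff continuous_on_mult continuous_on_const m e) auto
  then have "continuous_on UNIV (\<lambda>z :: real \<times> real \<times> real. (fst (snd z) - max (1/2) (min (3/4) (fst (snd z))) +
      (2 + (4 * max (1/2) (min (3/4) (fst (snd z))) - 2) powr (2 powr (fst z * c (snd (snd z))))) / 4, snd (snd z)))"
    by (intro continuous_on_Pair continuous_on_add continuous_on_diff continuous_on_divide m continuous_on_const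
        continuous_on_fst continuous_on_snd continuous_on_id) auto
  then show ?thesis by (simp add: shear_def Let_def split_beta)
qed

lemma homeomorphism_shear:
  assumes "continuous_on UNIV c"
  shows "homeomorphism strip strip (shear c t) (shear c (- t))"
proof -
  have ct: "continuous_on strip (shear c t)" for t
  proof -
    have "continuous_on strip (\<lambda>p. (\<lambda>(t, p). shear c t p) (t, p))"
      by (rule continuous_on_compose2[OF continuous_shear[OF assms]]) (auto intro!: continuous_intros)
    then show ?thesis by simp
  qed
  have inv: "shear c t (shear c (- t) p) = p" for t p using shear_inverse[of c "- t" p] by simp
  show ?thesis
  proof (rule homeomorphismI)
    show "shear c t ` strip \<subseteq> strip" "shear c (- t) ` strip \<subseteq> strip" using shear_strip by blast+
  qed (use ct shear_inverse inv in auto)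
qed

text \<open>Inclusions of arcs in both directions suffice, since \<open>shear c (-1)\<close> inverts
  \<open>shear c 1\<close>.\<close>

lemma planar_isotopic_shear:
  assumes c: "continuous_on UNIV c"
    and arcs: "\<And>k x. k \<in> {1..n} \<Longrightarrow> x \<in> {0..1} \<Longrightarrow> shear c 1 (x, height D k x) \<in> arc_points D' k"
      "\<And>k x. k \<in> {1..n} \<Longrightarrow> x \<in> {0..1} \<Longrightarrow> shear c (-1) (x, height D' k x) \<in> arc_points D k"
    and kind: "\<And>p. kind D' (shear c 1 p) = kind D p"
  shows "planar_isotopic n D D'"
  unfolding planar_isotopic_def
proof (intro exI[of _ "shear c"] conjI ballI)
  show "continuous_on ({0..1} \<times> strip) (\<lambda>(t, p). shear c t p)"
    by (rule continuous_on_subset[OF continuous_shear[OF c]]) simp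
  show "\<exists>G. homeomorphism strip strip (shear c t) G" for t
    using homeomorphism_shear[OF c] by blast
  show "shear c 0 p = p" if "p \<in> strip" for p
  proof (cases p)
    case (Pair x y)
    show ?thesis
    proof (cases x rule: shear_cases)
      case (middle s)
      then show ?thesis unfolding Pair middle(3) by (simp add: shear_simps(3))
    qed (simp_all add: Pair shear_simps)
  qed
  show "shear c t p = p" if "p \<in> {0, 1} \<times> UNIV" for t p
    using that by (auto simp: shear_simps)
  show "shear c 1 ` arc_points D k = arc_points D' k" if "k \<in> {1..n}" for k
  proof (intro equalityI subsetI)
    fix p assume "p \<in> shear c 1 ` arc_points D k"
    then show "p \<in> arc_points D' k" using arcs(1)[OF that] by (auto simp: arc_points_def[of D])
  next
    fix p assume "p \<in> arc_points D' k"
    then have "shear c (- 1) p \<in> arc_points D k" using arcs(2)[OF that] by (auto simp: arc_points_def[of D'])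
    moreover have "shear c 1 (shear c (- 1) p) = p" using shear_inverse[of c "- 1" p] by simp
    ultimately show "p \<in> shear c 1 ` arc_points D k" by (metis imageI)
  qed
qed (rule kind)

lemma height_stack3:
  "x \<le> 1/2 \<Longrightarrow> height (stack U (stack E V)) k x = height U k (2 * x)"
  "0 < s \<Longrightarrow> s \<le> 1 \<Longrightarrow> height (stack U (stack E V)) k ((2 + s) / 4) = height E (strand_end U k) s"
  "3/4 < x \<Longrightarrow> height (stack U (stack E V)) k x = height V (strand_end E (strand_end U k)) (4 * x - 3)"
  by (simp_all add: stack_def add_divide_distrib)

lemma kind_stack3:
  "x \<le> 1/2 \<Longrightarrow> kind (stack U (stack E V)) (x, y) = kind U (2 * x, y)"
  "0 < s \<Longrightarrow> s \<le> 1 \<Longrightarrow> kind (stack U (stack E V)) ((2 + s) / 4, y) = kind E (s, y)"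
  "3/4 < x \<Longrightarrow> kind (stack U (stack E V)) (x, y) = kind V (4 * x - 3, y)"
  by (simp_all add: stack_def add_divide_distrib)

text \<open>Raising \<open>s\<close> to the power \<open>e i / e' i\<close> compensates the change
  of exponent. The arcs \<open>i\<close>, \<open>i + 1\<close> stay at heights up to
  \<open>i + 1\<close> and the arcs \<open>j\<close>, \<open>j + 1\<close> at heights from
  \<open>j\<close> on, so one function \<open>q\<close> of the height serves both pairs.\<close>

lemma elementary_exponents:
  assumes far: "i + 2 \<le> j" and pos: "0 < e' i" "0 < e' j" and s: "0 < s"
    and low: "\<And>y. y \<le> real i + 1 \<Longrightarrow> q y = e i / e' i" and high: "\<And>y. real j \<le> y \<Longrightarrow> q y = e j / e' j"
    and s1: "s powr e i \<le> 1" "s powr e j \<le> 1"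
  shows "height (elementary {i, j} e' \<kappa>) k (s powr q (height (elementary {i, j} e \<kappa>) k s)) =
    height (elementary {i, j} e \<kappa>) k s"
proof -
  have p: "(s powr (e i / e' i)) powr e' i = s powr e i" "(s powr (e j / e' j)) powr e' j = s powr e j"
    using pos by (simp_all add: powr_powr)
  consider "k = i" | "k = j" | "k = Suc i" | "k = Suc j" | "k \<notin> {i, j}" "k - 1 \<notin> {i, j}" by (cases k) auto
  then show ?thesis
  proof cases
    case 1 then show ?thesis using low[of "real i + s powr e i"] s1 p by (simp add: elementary_def)
  next
    case 2 then show ?thesis using high[of "real j + s powr e j"] p far by (simp add: elementary_def)
  next
    case 3 then show ?thesis using low[of "real (Suc i) - s powr e i"] p far by (simp add: elementary_def)
  next
    case 4 then show ?thesis using high[of "real (Suc j) - s powr e j"] s1 p far by (simp add: elementary_def)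
  next
    case 5 then show ?thesis by (simp add: elementary_def)
  qed
qed

lemma far_commute_isotopic:
  assumes far: "i + 2 \<le> j"
  defines "e1 \<equiv> \<lambda>k. if k = i then 1 else 2" and "e2 \<equiv> \<lambda>k. if k = i then 2 else 1"
  shows "planar_isotopic n (stack U (stack (elementary {i, j} e1 \<kappa>) V)) (stack U (stack (elementary {i, j} e2 \<kappa>) V))"
    (is "planar_isotopic n ?D1 ?D2")
proof -
  let ?E1 = "elementary {i, j} e1 \<kappa>" and ?E2 = "elementary {i, j} e2 \<kappa>"
  \<comment> \<open>It is -1 up to height \<open>i + 1\<close>, 1 from height \<open>j\<close> on
    and affine between; \<open>far\<close> leaves a gap of length at least 1. At
    \<open>t = 1\<close> the exponents are therefore 1/2 and 2, the ratios of \<open>e1\<close> to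
    \<open>e2\<close> at the two crossings.\<close>
  define c where "c y = max (-1) (min 1 (2 * (y - (real i + 1)) / (real j - real i - 1) - 1))" for y
  have d: "0 < real j - real i - 1" using far by linarith
  have ij: "i \<noteq> j" using far by auto
  have low: "c y = -1" if "y \<le> real i + 1" for y
  proof -
    have "2 * (y - (real i + 1)) / (real j - real i - 1) \<le> 0"
      using that d by (intro divide_nonpos_pos) auto
    then show ?thesis by (simp add: c_def max_def min_def)
  qed
  have high: "c y = 1" if "real j \<le> y" for y
  proof -
    have "2 \<le> 2 * (y - (real i + 1)) / (real j - real i - 1)"
      using that d by (simp add: le_divide_eq)
    then show ?thesis by (simp add: c_def max_def min_def)
  qed
  have "continuous_on UNIV c" unfolding c_def by (intro continuous_intros) (use d in auto)
  moreover have se: "strand_end ?E1 k = strand_end ?E2 k" for k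
    by (simp add: strand_end_def elementary_def)
  \<comment> \<open>Stated for general exponents, since it is used in both directions, with
    \<open>t = 1\<close> and \<open>t = -1\<close>.\<close>
  have key: "shear c t (x, height (stack U (stack (elementary {i, j} e \<kappa>) V)) k x)
      \<in> arc_points (stack U (stack (elementary {i, j} e' \<kappa>) V)) k"
    if e: "0 < e i" "0 < e j" "0 < e' i" "0 < e' j" "2 powr (- t) = e i / e' i" "2 powr t = e j / e' j" and x: "x \<in> {0..1}"
      and se: "\<And>k. strand_end (elementary {i, j} e \<kappa>) k = strand_end (elementary {i, j} e' \<kappa>) k"
    for e e' t k x
  proof -
    let ?E = "elementary {i, j} e \<kappa>" and ?E' = "elementary {i, j} e' \<kappa>"
    have "(z, height (stack U (stack ?E' V)) k z) \<in> arc_points (stack U (stack ?E' V)) k" if "z \<in> {0..1}" for z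
      using that by (auto simp: arc_points_def)
    note arc = this
    show ?thesis
    proof (cases x rule: shear_cases)
      case left
      then show ?thesis using arc[of x] x by (simp add: shear_simps height_stack3)
    next
      case right
      then show ?thesis using arc[of x] x se by (simp add: shear_simps height_stack3)
    next
      case (middle s)
      let ?k = "strand_end U k"
      let ?y = "height ?E ?k s"
      let ?s = "s powr (2 powr (t * c ?y))"
      have s: "0 < ?s" "?s \<le> 1" using powr_unit[OF middle(1,2), of "t * c ?y"] powr_unit[OF middle(1,2), of "2 powr (t * c ?y)"] by auto
      have "height ?E' ?k ?s = ?y"
      proof (rule elementary_exponents[OF far e(3,4) middle(1), where q = "\<lambda>y. 2 powr (t * c y)"])
        show "2 powr (t * c y) = e i / e' i" if "y \<le> real i + 1" for y using low[OF that] e by simp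
        show "2 powr (t * c y) = e j / e' j" if "real j \<le> y" for y using high[OF that] e by simp
        show "s powr e i \<le> 1" "s powr e j \<le> 1"
          using powr_mono2[of "e i" s 1] powr_mono2[of "e j" s 1] e middle by auto
      qed
      then have "height (stack U (stack ?E' V)) k ((2 + ?s) / 4) = ?y"
        using height_stack3(2)[OF s] by simp
      then have "((2 + ?s) / 4, ?y) \<in> arc_points (stack U (stack ?E' V)) k"
        using arc[of "(2 + ?s) / 4"] s by simp
      then show ?thesis unfolding middle(3) using middle(1,2) by (simp add: shear_simps(3) height_stack3(2))
    qed
  qed
  moreover have "shear c 1 (x, height ?D1 k x) \<in> arc_points ?D2 k" if "x \<in> {0..1}" for k x
    by (rule key) (use that ij se in \<open>auto simp: e1_def e2_def powr_minus_divide\<close>)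
  moreover have "shear c (-1) (x, height ?D2 k x) \<in> arc_points ?D1 k" if "x \<in> {0..1}" for k x
    by (rule key) (use that ij se in \<open>auto simp: e1_def e2_def powr_minus_divide\<close>)
  \<comment> \<open>Inside the window the kind depends on the height only, which the shear
    preserves.\<close>
  moreover have "kind ?D2 (shear c 1 p) = kind ?D1 p" for p
  proof (cases p)
    case (Pair x y)
    show ?thesis
    proof (cases x rule: shear_cases)
      case (middle s)
      then show ?thesis
        unfolding Pair middle(3)
        using powr_unit[OF middle(1,2), of "c y"] powr_unit[OF middle(1,2), of "2 powr (c y)"]
        by (simp add: shear_simps(3) kind_stack3(2)) (simp add: elementary_def)
    qed (use Pair in \<open>simp_all add: shear_simps kind_stack3\<close>)
  qed
  ultimately show ?thesis by (intro planar_isotopic_shear[of c]) auto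
qed

text \<open>A single arc has no double points, so the strip may be moved vertically by multiples of
  the difference of the two arcs, which vanishes at both ends.\<close>

lemma single_strand_isotopic:
  assumes "D \<in> strand_diagrams 1" "D' \<in> strand_diagrams 1"
  shows "planar_isotopic 1 D D'"
proof -
  interpret A: strands 1 D by standard (rule assms(1))
  interpret B: strands 1 D' by standard (rule assms(2))
  define d where "d x = height D' 1 x - height D 1 x" for x
  have cd: "continuous_on {0..1} d"
    unfolding d_def by (intro continuous_on_diff A.continuous_h B.continuous_h) auto
  have "height D 1 0 = 1" "height D' 1 0 = 1" using A.h_0[of 1] B.h_0[of 1] by simp_all
  moreover have "height D 1 1 = 1" "height D' 1 1 = 1" using A.h_1 B.h_1 by (auto simp: bij_betw_def)
  ultimately have d: "d 0 = 0" "d 1 = 0" by (simp_all add: d_def)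
  let ?H = "\<lambda>t (x, y). (x, y + t * d x)"
  have ct: "continuous_on (T \<times> strip) (\<lambda>(t, p). ?H t p)" for T :: "real set"
  proof -
    have "continuous_on (T \<times> strip) (\<lambda>z. d (fst (snd z)))"
      by (rule continuous_on_compose2[OF cd]) (auto intro!: continuous_intros)
    then have "continuous_on (T \<times> strip) (\<lambda>z. (fst (snd z), snd (snd z) + fst z * d (fst (snd z))))"
      by (intro continuous_on_Pair continuous_on_add continuous_on_mult continuous_on_fst continuous_on_snd continuous_on_id)
    then show ?thesis by (simp add: split_beta)
  qed
  have ct': "continuous_on strip (?H t)" for t
  proof -
    have "continuous_on strip (\<lambda>p. (\<lambda>(t, p). ?H t p) (t, p))"
      by (rule continuous_on_compose2[OF ct[of "{t}"]]) (auto intro!: continuous_intros)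
    then show ?thesis by simp
  qed
  show ?thesis
    unfolding planar_isotopic_def
  proof (intro exI[of _ ?H] conjI ballI)
    show "\<exists>G. homeomorphism strip strip (?H t) G" for t
      by (intro exI[of _ "?H (- t)"] homeomorphismI ct') auto
    show "?H 1 ` arc_points D k = arc_points D' k" if "k \<in> {1..1}" for k
    proof -
      have "?H 1 ` arc_points D 1 = {(x, height D' 1 x) | x. x \<in> {0..1}}"
        unfolding arc_points_def d_def by force
      then show ?thesis using that by (simp add: arc_points_def)
    qed
    show "kind D' (?H 1 p) = kind D p" if "p \<in> double_points 1 D" for p
      using that by (auto simp: double_points_def)
  qed (use ct d in auto)
qed


section \<open>Equivalence of words and the main theorem\<close>

definition braid_word_step :: "nat \<Rightarrow> letter list rel" where
  "braid_word_step n = {(x, y). \<exists>u v l r. (local_move n l r \<or> far_move n l r) \<and> x = u @ l @ v \<and> y = u @ r @ v}"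

definition braid_word_eq :: "nat \<Rightarrow> letter list rel" where
  "braid_word_eq n = (braid_word_step n \<union> (braid_word_step n)\<inverse>)\<^sup>*"

lemmas braid_word_eq_rules = equivclp_rel[where r = "braid_word_step n" for n, folded braid_word_eq_def]

lemma move_end_pos: "local_move n l r \<or> far_move n l r \<Longrightarrow> end_pos l = end_pos r"
  using local_move_end_pos far_move_end_pos by blast

lemma move_valid: "local_move n l r \<or> far_move n l r \<Longrightarrow> valid_word n l \<and> valid_word n r"
  using local_move_valid far_move_valid by blast

lemma braid_word_step_context: "(x, y) \<in> braid_word_step n \<Longrightarrow> (a @ x @ b, a @ y @ b) \<in> braid_word_step n"
  unfolding braid_word_step_def by clarify (metis append.assoc)

lemma braid_word_eq_context: "(x, y) \<in> braid_word_eq n \<Longrightarrow> (a @ x @ b, a @ y @ b) \<in> braid_word_eq n"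
  unfolding braid_word_eq_def
proof (induction rule: rtrancl_induct)
  case (step y z)
  then have "(a @ y @ b, a @ z @ b) \<in> braid_word_step n \<union> (braid_word_step n)\<inverse>"
    using braid_word_step_context by blast
  with step.IH show ?case by (rule rtrancl_into_rtrancl)
qed simp

lemma braid_word_step_valid: "(x, y) \<in> braid_word_step n \<Longrightarrow> valid_word n x \<longleftrightarrow> valid_word n y"
  unfolding braid_word_step_def using move_valid by fastforce

lemma braid_word_eq_valid: "(x, y) \<in> braid_word_eq n \<Longrightarrow> valid_word n x \<longleftrightarrow> valid_word n y"
  unfolding braid_word_eq_def
  by (induction rule: rtrancl_induct) (use braid_word_step_valid in blast)+

lemma word_arrows_context:
  assumes "end_pos l = end_pos r"
  obtains Y where "word_arrows (u @ l @ v) = word_arrows u @ relabel (inv_into UNIV (end_pos u)) (word_arrows l) @ Y"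
    "word_arrows (u @ r @ v) = word_arrows u @ relabel (inv_into UNIV (end_pos u)) (word_arrows r) @ Y"
  using assms by (simp add: word_arrows_append)

text \<open>The prefix \<open>u\<close> only relabels the arrows of the move, and the suffix
  contributes the same arrows \<open>Y\<close> on both sides because the two sides of a move have
  the same permutation.\<close>

lemma braid_word_step_gauss:
  assumes "(x, y) \<in> braid_word_step n" "valid_word n x"
  shows "(std_gauss (word_arrows x) (end_pos x), std_gauss (word_arrows y) (end_pos y)) \<in> wReidemeister_eq n"
proof -
  obtain u v l r where m: "local_move n l r \<or> far_move n l r" and xy: "x = u @ l @ v" "y = u @ r @ v"
    using assms(1) by (auto simp: braid_word_step_def)
  have ep: "end_pos l = end_pos r" using m by (rule move_end_pos)
  have valid: "valid_word n u" "valid_word n l" "valid_word n r" "valid_word n v"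
    using move_valid[OF m] assms(2) by (auto simp: xy)
  let ?p = "inv_into UNIV (end_pos u)"
  obtain Y where Y: "word_arrows x = word_arrows u @ relabel ?p (word_arrows l) @ Y"
    "word_arrows y = word_arrows u @ relabel ?p (word_arrows r) @ Y"
    unfolding xy using word_arrows_context[OF ep] by blast
  have "end_pos x = end_pos y" by (simp add: xy ep)
  have "valid_word n x" by fact
  then have types: "set (word_arrows u) \<subseteq> arrow_types n" "set Y \<subseteq> arrow_types n" and perm: "end_pos x permutes {1..n}"
    using word_arrows_types[of n x] word_arrows_types[OF valid(1)] end_pos_permutes by (auto simp: Y)
  have p: "?p permutes {1..n}" by (rule permutes_inv[OF end_pos_permutes[OF valid(1)]])
  have "word_arrows l = word_arrows r \<or> arrow_move n (word_arrows l) (word_arrows r) \<or> arrow_move n (word_arrows r) (word_arrows l)"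
    using m local_move_arrows far_move_arrows by blast
  then consider "word_arrows l = word_arrows r"
    | "arrow_move n (relabel ?p (word_arrows l)) (relabel ?p (word_arrows r))"
    | "arrow_move n (relabel ?p (word_arrows r)) (relabel ?p (word_arrows l))"
    using arrow_move_relabel[OF _ p] by blast
  then show ?thesis
  proof cases
    case 1
    then show ?thesis using Y \<open>end_pos x = end_pos y\<close> wReidemeister_eq_rules(2) by simp
  next
    case 2
    from std_arrow_move[OF this types perm] show ?thesis using Y \<open>end_pos x = end_pos y\<close> by simp
  next
    case 3
    from std_arrow_move[OF this types perm] show ?thesis
      using Y \<open>end_pos x = end_pos y\<close> wReidemeister_eq_rules(3) by simp
  qed
qed

lemma braid_word_eq_gauss:
  assumes "(x, y) \<in> braid_word_eq n" "valid_word n x"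
  shows "(std_gauss (word_arrows x) (end_pos x), std_gauss (word_arrows y) (end_pos y)) \<in> wReidemeister_eq n"
  using assms(1) unfolding braid_word_eq_def
proof (induction rule: rtrancl_induct)
  case base
  show ?case by (rule wReidemeister_eq_rules(2))
next
  case (step y z)
  have y: "valid_word n y"
    using step.hyps(1) assms(2) braid_word_eq_valid unfolding braid_word_eq_def by blast
  then have "(std_gauss (word_arrows y) (end_pos y), std_gauss (word_arrows z) (end_pos z)) \<in> wReidemeister_eq n"
    using step.hyps(2) braid_word_step_gauss braid_word_step_valid wReidemeister_eq_rules(3) by blast
  with step.IH show ?case by (rule wReidemeister_eq_rules(4))
qed

lemmas welded_eq_rules = equivclp_rel[where r = "welded_step n" for n, folded welded_eq_def]

text \<open>For \<open>n \<ge> 2\<close> the diagrams are joined by inserting and deleting two welded crossings; for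
  \<open>n = 1\<close> there are no letters, but a vertical isotopy is available.\<close>

lemma same_word_welded_eq:
  assumes n: "1 \<le> n" and D: "D \<in> strand_diagrams n" "D' \<in> strand_diagrams n"
    and word: "diagram_word n D = diagram_word n D'"
  shows "(D, D') \<in> welded_eq n"
proof (cases "n = 1")
  case True
  then have "planar_isotopic n D D'" using D single_strand_isotopic by simp
  then show ?thesis using D by (intro welded_eq_rules(1)) (simp add: welded_step_def)
next
  case False
  then have n2: "1 < n" using n by simp
  have "valid_word n (diagram_word n D @ [Rho 1, Rho 1])"
    using strands.valid_diagram_word[of n D] D n2 by (simp add: strands_def)
  then obtain F where F: "F \<in> strand_diagrams n" "diagram_word n F = diagram_word n D @ [Rho 1, Rho 1]"
    using ex_diagram by blast
  have "local_move n [Rho 1, Rho 1] []" using n2 by (intro local_move.V2) auto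
  then have "welded_move n F G" if "diagram_word n G = diagram_word n D" for G
    unfolding welded_move_def using F(2) that
    by (intro exI[of _ "diagram_word n D"] exI[of _ "[]"] exI[of _ "[Rho 1, Rho 1]"]) simp
  then have "(F, D) \<in> welded_eq n" "(F, D') \<in> welded_eq n"
    using F D word by (auto intro!: welded_eq_rules(1) simp: welded_step_def)
  then show ?thesis using welded_eq_rules(3,4) by blast
qed

text \<open>Local moves are welded moves. For a distant commutation both diagrams are replaced by
  stacks with the same words, in which the two crossings form an elementary block that the shear can
  exchange.\<close>

lemma braid_word_step_welded_eq:
  assumes n: "1 \<le> n" and D: "D \<in> strand_diagrams n" "D' \<in> strand_diagrams n"
    and step: "(diagram_word n D, diagram_word n D') \<in> braid_word_step n"
  shows "(D, D') \<in> welded_eq n"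
proof -
  obtain u v l r where m: "local_move n l r \<or> far_move n l r" 
    and w: "diagram_word n D = u @ l @ v" "diagram_word n D' = u @ r @ v"
    using step by (auto simp: braid_word_step_def)
  show ?thesis
  proof (cases "local_move n l r")
    case True
    then have "welded_move n D D'" unfolding welded_move_def using w by blast
    then show ?thesis using D by (intro welded_eq_rules(1)) (simp add: welded_step_def)
  next
    case False
    then have "far_move n l r" using m by blast
    then obtain a b where ab: "l = [a, b]" "r = [b, a]" "valid_word n [a, b]" "letter_index a + 2 \<le> letter_index b"
      by (cases rule: far_move.cases) auto
    let ?i = "letter_index a" and ?j = "letter_index b"
    have ij: "1 \<le> ?i" "?i < n" "1 \<le> ?j" "?j < n" "?i \<noteq> ?j" using ab by auto
    obtain s t where st: "a = letter_of s ?i" "b = letter_of t ?j" by (metis letter_of_cases)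
    define \<kappa> where "\<kappa> k = (if k = ?i then s else t)" for k
    have "valid_word n (u @ l @ v)"
      using strands.valid_diagram_word[of n D] D w by (simp add: strands_def)
    then obtain U V where U: "U \<in> strand_diagrams n" "diagram_word n U = u" and V: "V \<in> strand_diagrams n" "diagram_word n V = v"
      using ex_diagram by (metis valid_word_simps(3))
    let ?e1 = "\<lambda>k. if k = ?i then 1 else 2 :: real" and ?e2 = "\<lambda>k. if k = ?i then 2 else 1 :: real"
    let ?E1 = "elementary {?i, ?j} ?e1 \<kappa>" and ?E2 = "elementary {?i, ?j} ?e2 \<kappa>"
    have E1: "?E1 \<in> strand_diagrams n" "diagram_word n ?E1 = [a, b]"
      using elementary_word_pair[of ?i n ?j ?e1 \<kappa>] ij ab(4) st by (auto simp: \<kappa>_def)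
    have E2: "?E2 \<in> strand_diagrams n" "diagram_word n ?E2 = [b, a]"
      using elementary_word_pair[of ?j n ?i ?e2 \<kappa>] ij ab(4) st by (auto simp: \<kappa>_def insert_commute[of ?j])
    let ?S1 = "stack U (stack ?E1 V)" and ?S2 = "stack U (stack ?E2 V)"
    have S1: "?S1 \<in> strand_diagrams n" "diagram_word n ?S1 = diagram_word n D"
      using stack_diagrams U V E1 w ab by simp_all
    have S2: "?S2 \<in> strand_diagrams n" "diagram_word n ?S2 = diagram_word n D'"
      using stack_diagrams U V E2 w ab by simp_all
    have "planar_isotopic n ?S1 ?S2" by (rule far_commute_isotopic[OF ab(4)])
    then have "(?S1, ?S2) \<in> welded_eq n"
      using S1 S2 by (intro welded_eq_rules(1)) (simp add: welded_step_def)
    moreover have "(D, ?S1) \<in> welded_eq n" "(?S2, D') \<in> welded_eq n"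
      using same_word_welded_eq[OF n] D S1 S2 by simp_all
    ultimately show ?thesis using welded_eq_rules(4) by blast
  qed
qed

text \<open>Every intermediate word is valid and therefore the word of some diagram, so the steps
  can be lifted one by one.\<close>

lemma braid_word_eq_welded_eq:
  assumes n: "1 \<le> n" and "(x, y) \<in> braid_word_eq n"
    and "D \<in> strand_diagrams n" "D' \<in> strand_diagrams n" "diagram_word n D = x" "diagram_word n D' = y"
  shows "(D, D') \<in> welded_eq n"
  using assms(2,4,6) unfolding braid_word_eq_def
proof (induction arbitrary: D' rule: rtrancl_induct)
  case base
  then show ?case using same_word_welded_eq[OF n assms(3)] assms(5) by simp
next
  case (step y z)
  have "valid_word n x" using strands.valid_diagram_word[of n D] assms by (simp add: strands_def)
  then have "valid_word n y"
    using step.hyps(1) braid_word_eq_valid unfolding braid_word_eq_def by blast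
  then obtain F where F: "F \<in> strand_diagrams n" "diagram_word n F = y" using ex_diagram by blast
  have "(F, D') \<in> welded_eq n"
    using step.hyps(2) braid_word_step_welded_eq[OF n] F step.prems welded_eq_rules(3) by blast
  with step.IH[OF F] show ?case by (rule welded_eq_rules(4))
qed

text \<open>A type cannot depend on \<open>n\<close>, whereas the presented group does. The
  bijections of the fixed type \<open>letter list set\<close> contain a copy of it for each
  \<open>n\<close>.\<close>

typedef 'a self_bijection = "{f :: 'a \<Rightarrow> 'a. bij f}"
  by (rule exI[of _ id]) simp

setup_lifting type_definition_self_bijection

instantiation self_bijection :: (type) group_add
begin

lift_definition zero_self_bijection :: "'a self_bijection" is id by simp

lift_definition plus_self_bijection :: "'a self_bijection \<Rightarrow> 'a self_bijection \<Rightarrow> 'a self_bijection"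
  is "\<lambda>f g. f \<circ> g" by (rule bij_comp)

lift_definition uminus_self_bijection :: "'a self_bijection \<Rightarrow> 'a self_bijection"
  is "inv_into UNIV" by (rule bij_imp_bij_inv)

definition minus_self_bijection :: "'a self_bijection \<Rightarrow> 'a self_bijection \<Rightarrow> 'a self_bijection" where
  "minus_self_bijection f g = f + - g"

instance
proof
  fix a b c :: "'a self_bijection"
  show "a + b + c = a + (b + c)" by transfer (simp only: o_assoc)
  show "0 + a = a" "a + 0 = a" by (transfer, simp)+
  show "- a + a = 0" by transfer (simp add: bij_is_inj)
  show "a + - b = a - b" by (simp add: minus_self_bijection_def)
qed

end

text \<open>Cayley's theorem: words act on the equivalence classes of words by concatenation.  It embeds the
  group presented by the moves into an instance of the class \<open>group_add\<close>.\<close>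

definition word_class :: "nat \<Rightarrow> letter list \<Rightarrow> letter list set" where
  "word_class n x = braid_word_eq n `` {x}"

text \<open>Extended by the identity off the classes, so that letters act bijectively on the whole
  type.\<close>

definition word_action :: "nat \<Rightarrow> letter list \<Rightarrow> letter list set \<Rightarrow> letter list set" where
  "word_action n w X = (if X \<in> range (word_class n) then braid_word_eq n `` ((@) w ` X) else X)"

text \<open>A letter whose index is out of range has no inverse among words, so its action cannot be
  taken for a bijection; it gets the neutral value.\<close>

definition cayley_gen :: "nat \<Rightarrow> letter \<Rightarrow> letter list set self_bijection" where
  "cayley_gen n l = (if valid_word n [l] then Abs_self_bijection (word_action n [l]) else 0)"

lemma word_class_eq_iff: "word_class n x = word_class n y \<longleftrightarrow> (x, y) \<in> braid_word_eq n"
proof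
  assume "word_class n x = word_class n y"
  moreover have "y \<in> word_class n y" by (simp add: word_class_def braid_word_eq_rules(2))
  ultimately have "y \<in> word_class n x" by simp
  then show "(x, y) \<in> braid_word_eq n" by (simp add: word_class_def)
next
  assume xy: "(x, y) \<in> braid_word_eq n"
  have "(x, z) \<in> braid_word_eq n \<longleftrightarrow> (y, z) \<in> braid_word_eq n" for z
    using braid_word_eq_rules(4)[OF xy, of z] braid_word_eq_rules(4)[OF braid_word_eq_rules(3)[OF xy], of z] by auto
  then show "word_class n x = word_class n y" by (simp add: word_class_def set_eq_iff)
qed

lemma word_action_class: "word_action n w (word_class n x) = word_class n (w @ x)"
proof -
  have "braid_word_eq n `` ((@) w ` word_class n x) = word_class n (w @ x)"
  proof (intro equalityI subsetI)
    fix y assume "y \<in> braid_word_eq n `` ((@) w ` word_class n x)"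
    then obtain z where "(x, z) \<in> braid_word_eq n" "(w @ z, y) \<in> braid_word_eq n" by (auto simp: word_class_def)
    moreover from this have "(w @ x, w @ z) \<in> braid_word_eq n" using braid_word_eq_context[of x z n w "[]"] by simp
    ultimately show "y \<in> word_class n (w @ x)" using braid_word_eq_rules(4) by (auto simp: word_class_def)
  next
    fix y assume "y \<in> word_class n (w @ x)"
    moreover have "x \<in> word_class n x" using braid_word_eq_rules(2) by (auto simp: word_class_def)
    ultimately show "y \<in> braid_word_eq n `` ((@) w ` word_class n x)" by (auto simp: word_class_def)
  qed
  then show ?thesis by (simp add: word_action_def)
qed

lemma word_action_eqI:
  assumes "\<And>x. f (word_class n x) = g (word_class n x)" "\<And>X. X \<notin> range (word_class n) \<Longrightarrow> f X = g X"
  shows "f = g"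
proof
  fix X show "f X = g X"
    by (cases "X \<in> range (word_class n)") (use assms in auto)
qed

lemma word_action_append: "word_action n (u @ v) = word_action n u \<circ> word_action n v"
proof (rule word_action_eqI)
  show "word_action n (u @ v) (word_class n x) = (word_action n u \<circ> word_action n v) (word_class n x)" for x
    by (simp add: word_action_class)
  show "word_action n (u @ v) X = (word_action n u \<circ> word_action n v) X" if "X \<notin> range (word_class n)" for X
    using that by (simp add: word_action_def)
qed

lemma word_action_Nil: "word_action n [] = id"
proof (rule word_action_eqI)
  show "word_action n [] (word_class n x) = id (word_class n x)" for x
    by (simp add: word_action_class)
  show "word_action n [] X = id X" if "X \<notin> range (word_class n)" for X
    using that by (simp add: word_action_def)
qed

lemma word_action_cong: "(u, v) \<in> braid_word_eq n \<Longrightarrow> word_action n u = word_action n v"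
proof (rule word_action_eqI)
  fix x assume "(u, v) \<in> braid_word_eq n"
  from braid_word_eq_context[OF this, of "[]" x]
  show "word_action n u (word_class n x) = word_action n v (word_class n x)"
    by (simp add: word_action_class word_class_eq_iff)
qed (simp add: word_action_def)

lemma braid_word_eqI: "local_move n l r \<or> far_move n l r \<Longrightarrow> (l, r) \<in> braid_word_eq n"
proof (rule braid_word_eq_rules(1))
  assume m: "local_move n l r \<or> far_move n l r"
  have "\<exists>u v l' r'. (local_move n l' r' \<or> far_move n l' r') \<and> l = u @ l' @ v \<and> r = u @ r' @ v"
    by (rule exI[of _ "[]"], rule exI[of _ "[]"], rule exI[of _ l], rule exI[of _ r]) (simp add: m)
  then show "(l, r) \<in> braid_word_step n" by (simp add: braid_word_step_def)
qed

primrec inverse_letter :: "letter \<Rightarrow> letter" where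
  "inverse_letter (Sigma i) = Sigma_inv i"
| "inverse_letter (Sigma_inv i) = Sigma i"
| "inverse_letter (Rho i) = Rho i"

lemma bij_word_action_letter:
  assumes "valid_word n [l]"
  shows "bij (word_action n [l])"
proof -
  have "local_move n [inverse_letter l, l] []" "local_move n [l, inverse_letter l] []"
    using assms by (cases l; simp add: local_move.R2_left local_move.R2_right local_move.V2)+
  then have "word_action n [inverse_letter l, l] = id" "word_action n [l, inverse_letter l] = id"
    using word_action_cong[OF braid_word_eqI] word_action_Nil by metis+
  then have "word_action n ([inverse_letter l] @ [l]) = id" "word_action n ([l] @ [inverse_letter l]) = id"
    by simp_all
  then show ?thesis unfolding word_action_append by (rule o_bij)
qed

lemma cayley_val:
  assumes "valid_word n w"
  shows "bij (word_action n w) \<and> sum_list (map (cayley_gen n) w) = Abs_self_bijection (word_action n w)"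
  using assms
proof (induction w)
  case Nil
  show ?case
    unfolding word_action_Nil by (simp only: list.map sum_list.Nil zero_self_bijection_def bij_id simp_thms)
next
  case (Cons l w)
  then have IH: "bij (word_action n w)" "sum_list (map (cayley_gen n) w) = Abs_self_bijection (word_action n w)"
    and l: "valid_word n [l]" by auto
  have split: "word_action n (l # w) = word_action n [l] \<circ> word_action n w"
    using word_action_append[of n "[l]" w] by simp
  have "bij (word_action n (l # w))"
    unfolding split by (rule bij_comp[OF IH(1) bij_word_action_letter[OF l]])
  moreover have "sum_list (map (cayley_gen n) (l # w)) = Abs_self_bijection (word_action n (l # w))"
    using IH l bij_word_action_letter[OF l] unfolding split
    by (simp add: cayley_gen_def plus_self_bijection.abs_eq eq_onp_def del: valid_word_simps)
  ultimately show ?case ..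
qed

locale faithful_representation = welded_representation +
  assumes faithful: "valid_word n u \<Longrightarrow> valid_word n v \<Longrightarrow> val u = val v \<Longrightarrow> (u, v) \<in> braid_word_eq n"
    and n_pos: "1 \<le> n"

lemma cayley_representation:
  assumes "1 \<le> n"
  shows "faithful_representation n (cayley_gen n)"
proof
  have *: "sum_list (map (cayley_gen n) u) = sum_list (map (cayley_gen n) v)" if "local_move n u v \<or> far_move n u v" for u v
    using cayley_val[of n u] cayley_val[of n v] move_valid[OF that] word_action_cong[OF braid_word_eqI[OF that]] by simp
  show "local_move n u v \<Longrightarrow> sum_list (map (cayley_gen n) u) = sum_list (map (cayley_gen n) v)"
    "far_move n u v \<Longrightarrow> sum_list (map (cayley_gen n) u) = sum_list (map (cayley_gen n) v)" for u v
    using * by blast+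
  fix u v assume uv: "valid_word n u" "valid_word n v" "sum_list (map (cayley_gen n) u) = sum_list (map (cayley_gen n) v)"
  then have "word_action n u = word_action n v"
    using cayley_val[OF uv(1)] cayley_val[OF uv(2)] by (simp add: Abs_self_bijection_inject)
  \<comment> \<open>The actions are compared at the class of the empty word.\<close>
  then have "word_class n u = word_class n v" using word_action_class[of n _ "[]"] by (metis append_Nil2)
  then show "(u, v) \<in> braid_word_eq n" by (simp add: word_class_eq_iff)
qed (rule assms)

section \<open>Words, diagrams and Gauss diagrams with a prescribed value\<close>

context welded_representation
begin

lemma ex_inverse_word:
  assumes "valid_word n w"
  shows "\<exists>w'. valid_word n w' \<and> val w' = - val w"
  using assms
proof (induction w)
  case (Cons l w)
  then obtain w' where w': "valid_word n w'" "val w' = - val w" by auto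
  have "gen (inverse_letter l) = - gen l"
    using Cons.prems by (cases l) (simp_all add: gen_Sigma_inv minus_r)
  with w' have "val (w' @ [inverse_letter l]) = - val (l # w)" by (simp add: minus_add)
  moreover have "valid_word n (w' @ [inverse_letter l])" using w' Cons.prems by (cases l) auto
  ultimately show ?case by blast
qed (intro exI[of _ "[]"], simp)

lemma gauss_val_std:
  assumes "valid_word n w"
  shows "gauss_val (std_gauss (word_arrows w) (end_pos w)) = val w"
proof -
  have "std_gauss (word_arrows w) (end_pos w) \<in> bGD n"
    using assms by (intro std_bGD word_arrows_types end_pos_permutes)
  from gauss_val_eq[OF this linearization_std] show ?thesis
    using val_eq[OF assms] by (simp add: std_gauss_def)
qed

lemma gauss_val_gauss_of:
  assumes "D \<in> strand_diagrams n"
  shows "gauss_val (gauss_of n D) = val (diagram_word n D)"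
proof -
  interpret strands n D by standard (rule assms)
  show ?thesis
    unfolding gauss_val_eq[OF gauss_of_bGD linearization_diagram_arrows] map_arrow_type_diagram_arrows label_gauss_of
    by (rule val_eq[OF valid_diagram_word, symmetric])
qed

end

text \<open>Letters \<open>Rho\<close> bring \<open>a\<close> and \<open>b\<close> to the positions
  1 and 2, in the order demanded by the sign; the pair \<open>l\<close>, \<open>Rho 1\<close>
  inserts the arrow without moving strands, and the reversed \<open>Rho\<close> word leads
  back.\<close>

lemma ex_word_arrow:
  assumes "t \<in> arrow_types n"
  shows "\<exists>u. valid_word n u \<and> word_arrows u = [t] \<and> end_pos u = id"
proof -
  obtain a b e where t: "t = (a, b, e)" by (cases t)
  have ab: "a \<in> {1..n}" "b \<in> {1..n}" "a \<noteq> b" "e = 1 \<or> e = -1" using assms by (auto simp: t arrow_types_def)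
  define l where "l = (if e = 1 then Sigma 1 else Sigma_inv 1)"
  obtain x y where xy: "letter_arrows l = [(x, y, e)]" "{x, y} \<subseteq> {1, 2}" "x \<noteq> y"
    using ab(4) by (auto simp: l_def numeral_2_eq_2)
  have n: "2 \<le> n" using ab by auto
  obtain p where p: "p permutes {1..n}" "map p [a, b] = [x, y]"
    using ex_permutes_map[of "[a, b]" "[x, y]" "{1..n}"] ab xy n by auto
  obtain "is" where is': "set is \<subseteq> {1..<n}" "rho_pos is = p" using permutes_rho_pos[OF p(1)] by blast
  have no: "word_arrows (map Rho js) = []" for js by (induction js) auto
  have inv: "inv_into UNIV p x = a" "inv_into UNIV p y = b"
    using p permutes_inv_eq[OF p(1)] by auto
  let ?u = "map Rho is @ [l, Rho 1] @ map Rho (rev is)"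
  have "letter_index l = 1" by (simp add: l_def)
  have "valid_word n (map Rho js)" if "set js \<subseteq> {1..<n}" for js using that by (induction js) auto
  then have "valid_word n ?u" using is' n \<open>letter_index l = 1\<close> by simp
  moreover have "word_arrows ?u = [t]"
    unfolding word_arrows_append is'(2) using xy(1) no inv by (simp add: t)
  moreover have "end_pos ?u = id"
  proof -
    have "end_pos [l, Rho 1] = id" using \<open>letter_index l = 1\<close> by simp
    then have "end_pos ?u = rho_pos (rev is) \<circ> rho_pos is"
      by (simp only: end_pos_append comp_id id_comp)
    then show ?thesis by (simp only: rho_pos_rev(1))
  qed
  ultimately show ?thesis by blast
qed

lemma ex_word_gauss:
  assumes "set A \<subseteq> arrow_types n" "p permutes {1..n}"
  shows "\<exists>w. valid_word n w \<and> word_arrows w = A \<and> end_pos w = p"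
  using assms(1)
proof (induction A)
  case Nil
  obtain "is" where is': "set is \<subseteq> {1..<n}" "rho_pos is = p" using permutes_rho_pos[OF assms(2)] by blast
  have "word_arrows (map Rho js) = []" for js by (induction js) auto
  moreover have "valid_word n (map Rho js)" if "set js \<subseteq> {1..<n}" for js using that by (induction js) auto
  ultimately show ?case using is' by blast
next
  case (Cons t A)
  then obtain u w where "valid_word n u" "word_arrows u = [t]" "end_pos u = id"
    "valid_word n w" "word_arrows w = A" "end_pos w = p" using ex_word_arrow[of t n] by auto
  then show ?case by (intro exI[of _ "u @ w"]) (simp add: word_arrows_append)
qed

lemma bGD_word:
  assumes "G \<in> bGD n"
  shows "\<exists>w. valid_word n w \<and> (G, std_gauss (word_arrows w) (end_pos w)) \<in> wReidemeister_eq n"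
proof -
  obtain L where L: "linearization G L" using bGD_linearization[OF assms] by blast
  obtain w where w: "valid_word n w" "word_arrows w = map arrow_type L" "end_pos w = label G"
    using ex_word_gauss[OF bGD_types[OF assms L] bGD_properties(2)[OF assms]] by blast
  with wReidemeister_eq_std[OF assms L] show ?thesis by metis
qed

context faithful_representation
begin

text \<open>Both diagrams are equivalent to standard diagrams of words. Equal values make these
  words equivalent by faithfulness, and \<open>braid_word_eq_gauss\<close> turns this into an
  equivalence of the diagrams.\<close>

lemma wReidemeister_eq_iff:
  assumes "G \<in> bGD n" "G' \<in> bGD n"
  shows "(G, G') \<in> wReidemeister_eq n \<longleftrightarrow> gauss_val G = gauss_val G'"
proof
  assume eq: "gauss_val G = gauss_val G'"
  obtain w where w: "valid_word n w" "(G, std_gauss (word_arrows w) (end_pos w)) \<in> wReidemeister_eq n"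
    using bGD_word[OF assms(1)] by blast
  obtain w' where w': "valid_word n w'" "(G', std_gauss (word_arrows w') (end_pos w')) \<in> wReidemeister_eq n"
    using bGD_word[OF assms(2)] by blast
  have "val w = val w'"
    using wReidemeister_eq_val[OF w(2)] wReidemeister_eq_val[OF w'(2)] eq gauss_val_std w(1) w'(1) by simp
  from braid_word_eq_gauss[OF faithful[OF w(1) w'(1) this] w(1)] w(2) w'(2)
  show "(G, G') \<in> wReidemeister_eq n" using wReidemeister_eq_rules(3,4) by blast
qed (rule wReidemeister_eq_val)

text \<open>An isotopy may change the word in an uncontrolled way. But the value of the word is that
  of the Gauss diagram, which is only reparametrized.\<close>

lemma welded_eq_iff:
  assumes "D \<in> strand_diagrams n" "D' \<in> strand_diagrams n"
  shows "(D, D') \<in> welded_eq n \<longleftrightarrow> val (diagram_word n D) = val (diagram_word n D')"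
proof
  assume "(D, D') \<in> welded_eq n"
  then show "val (diagram_word n D) = val (diagram_word n D')"
    unfolding welded_eq_def
  proof (induction rule: rtrancl_induct)
    case (step E F)
    have "val (diagram_word n E) = val (diagram_word n F)" if "(E, F) \<in> welded_step n" for E F
    proof -
      have EF: "E \<in> strand_diagrams n" "F \<in> strand_diagrams n" "planar_isotopic n E F \<or> welded_move n E F"
        using that by (auto simp: welded_step_def)
      from EF(3) show ?thesis
      proof
        assume "planar_isotopic n E F"
        from isotopic_reparametrize[OF EF(1,2) this] obtain \<phi> where
          \<phi>: "reparametrization \<phi>" "gauss_of n F = reparametrize \<phi> (gauss_of n E)" by blast
        have "gauss_of n E \<in> bGD n" "gauss_of n F \<in> bGD n"
          using strands.gauss_of_bGD EF by (auto simp: strands_def)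
        then have "gauss_val (gauss_of n F) = gauss_val (gauss_of n E)"
          unfolding \<phi>(2) by (intro reparametrize_val \<phi>(1))
        then show ?thesis using gauss_val_gauss_of EF by simp
      next
        assume "welded_move n E F"
        then obtain u v l r where "local_move n l r" "diagram_word n E = u @ l @ v" "diagram_word n F = u @ r @ v"
          by (auto simp: welded_move_def)
        then show ?thesis using local_move_val[of l r] by simp
      qed
    qed
    from this[of E F] this[of F E] step.hyps(2) step.IH show ?case by auto
  qed simp
next
  assume "val (diagram_word n D) = val (diagram_word n D')"
  then have "(diagram_word n D, diagram_word n D') \<in> braid_word_eq n"
    using strands.valid_diagram_word assms by (intro faithful) (auto simp: strands_def)
  then show "(D, D') \<in> welded_eq n"
    using braid_word_eq_welded_eq[OF n_pos] assms by blast
qed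

end

section \<open>Quotients whose classes are the fibres of a value\<close>

lemma equivclp_closed:
  assumes "r \<subseteq> X \<times> X" "(x, y) \<in> (r \<union> r\<inverse>)\<^sup>*" "x \<in> X"
  shows "y \<in> X"
  using assms(2,3,1) by (induction rule: rtrancl_induct) auto

text \<open>Both groups have this shape: the classes are the fibres of \<open>v\<close>, so
  \<open>Q\<close> is a copy of the image of \<open>v\<close>. The group axioms for \<open>f\<close>
  hold up to \<open>E\<close> and are inherited from the group of values.\<close>

locale valued_quotient =
  fixes X :: "'a set" and E :: "'a rel" and f :: "'a \<Rightarrow> 'a \<Rightarrow> 'a" and e :: 'a and v :: "'a \<Rightarrow> 'g::group_add"
  assumes E_iff: "x \<in> X \<Longrightarrow> y \<in> X \<Longrightarrow> (x, y) \<in> E \<longleftrightarrow> v x = v y"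
    and E_closed: "(x, y) \<in> E \<Longrightarrow> x \<in> X \<Longrightarrow> y \<in> X"
    and f_closed: "x \<in> X \<Longrightarrow> y \<in> X \<Longrightarrow> f x y \<in> X"
    and f_val: "x \<in> X \<Longrightarrow> y \<in> X \<Longrightarrow> v (f x y) = v x + v y"
    and e: "e \<in> X" "v e = 0"
    and ex_inverse: "x \<in> X \<Longrightarrow> \<exists>y\<in>X. v y = - v x"
begin

definition Q :: "'a set monoid" where
  "Q = \<lparr>carrier = X // E, mult = (\<lambda>A B. E `` {f x y | x y. x \<in> A \<and> y \<in> B}), one = E `` {e}\<rparr>"

lemma class_eq: "x \<in> X \<Longrightarrow> E `` {x} = {y \<in> X. v y = v x}"
proof (rule Set.set_eqI)
  fix y assume "x \<in> X"
  then show "y \<in> E `` {x} \<longleftrightarrow> y \<in> {y \<in> X. v y = v x}"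
    using E_iff[of x y] E_closed[of x y] by auto
qed

lemma class_eq_iff: "x \<in> X \<Longrightarrow> y \<in> X \<Longrightarrow> E `` {x} = E `` {y} \<longleftrightarrow> v x = v y"
proof
  assume xy: "x \<in> X" "y \<in> X" "E `` {x} = E `` {y}"
  have "x \<in> E `` {x}" unfolding class_eq[OF xy(1)] using xy(1) by simp
  then have "x \<in> E `` {y}" by (simp only: xy(3))
  then show "v x = v y" unfolding class_eq[OF xy(2)] by simp
qed (simp only: class_eq)

lemma carrier_Q: "carrier Q = (\<lambda>x. E `` {x}) ` X"
  by (auto simp: Q_def quotient_def)

text \<open>Products of representatives need not fill a class, whence the closure under
  \<open>E\<close> in the multiplication. All of them have the value \<open>v x + v y\<close>, so
  the closure is one fibre.\<close>

lemma mult_Q: "x \<in> X \<Longrightarrow> y \<in> X \<Longrightarrow> E `` {x} \<otimes>\<^bsub>Q\<^esub> E `` {y} = E `` {f x y}"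
proof -
  assume xy: "x \<in> X" "y \<in> X"
  have "E `` {f a b | a b. a \<in> E `` {x} \<and> b \<in> E `` {y}} = {z \<in> X. v z = v x + v y}"
  proof (intro equalityI subsetI)
    fix z assume "z \<in> E `` {f a b | a b. a \<in> E `` {x} \<and> b \<in> E `` {y}}"
    then obtain a b where ab: "a \<in> E `` {x}" "b \<in> E `` {y}" "(f a b, z) \<in> E" by auto
    then have a: "a \<in> X" "v a = v x" and b: "b \<in> X" "v b = v y"
      unfolding class_eq[OF xy(1)] class_eq[OF xy(2)] by simp_all
    have "z \<in> X" using E_closed[OF ab(3) f_closed[OF a(1) b(1)]] .
    then show "z \<in> {z \<in> X. v z = v x + v y}"
      using E_iff[OF f_closed[OF a(1) b(1)], of z] ab(3) f_val[OF a(1) b(1)] a(2) b(2) by simp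
  next
    fix z assume "z \<in> {z \<in> X. v z = v x + v y}"
    then have "(f x y, z) \<in> E" using E_iff[OF f_closed[OF xy], of z] f_val[OF xy] by simp
    moreover have "x \<in> E `` {x}" "y \<in> E `` {y}"
      unfolding class_eq[OF xy(1)] class_eq[OF xy(2)] using xy by simp_all
    ultimately show "z \<in> E `` {f a b | a b. a \<in> E `` {x} \<and> b \<in> E `` {y}}" by blast
  qed
  then show ?thesis using class_eq[OF f_closed[OF xy]] f_val[OF xy] by (simp add: Q_def)
qed

lemma group_Q: "group Q"
proof (rule groupI)
  have one: "\<one>\<^bsub>Q\<^esub> = E `` {e}" by (simp add: Q_def)
  show "\<one>\<^bsub>Q\<^esub> \<in> carrier Q" using e by (auto simp: one carrier_Q)
  fix x assume "x \<in> carrier Q"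
  then obtain a where a: "a \<in> X" "x = E `` {a}" by (auto simp: carrier_Q)
  show "\<one>\<^bsub>Q\<^esub> \<otimes>\<^bsub>Q\<^esub> x = x"
    using a e f_closed f_val by (simp add: one mult_Q class_eq_iff)
  obtain b where b: "b \<in> X" "v b = - v a" using ex_inverse[OF a(1)] by blast
  have "E `` {b} \<otimes>\<^bsub>Q\<^esub> x = \<one>\<^bsub>Q\<^esub>" using a b e f_closed f_val by (simp add: one mult_Q class_eq_iff)
  moreover have "E `` {b} \<in> carrier Q" using b by (auto simp: carrier_Q)
  ultimately show "\<exists>y\<in>carrier Q. y \<otimes>\<^bsub>Q\<^esub> x = \<one>\<^bsub>Q\<^esub>" by blast
  fix y assume "y \<in> carrier Q"
  then obtain c where c: "c \<in> X" "y = E `` {c}" by (auto simp: carrier_Q)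
  show "x \<otimes>\<^bsub>Q\<^esub> y \<in> carrier Q" using a c f_closed by (auto simp: mult_Q carrier_Q)
  fix z assume "z \<in> carrier Q"
  then obtain d where d: "d \<in> X" "z = E `` {d}" by (auto simp: carrier_Q)
  show "x \<otimes>\<^bsub>Q\<^esub> y \<otimes>\<^bsub>Q\<^esub> z = x \<otimes>\<^bsub>Q\<^esub> (y \<otimes>\<^bsub>Q\<^esub> z)"
    using a c d f_closed f_val by (simp add: mult_Q class_eq_iff add.assoc)
qed

end

theorem theorem7p12:
  fixes n :: nat
  assumes "n \<ge> 1"
  shows "group (welded_gauss_group n) \<and> group (welded_braid_group n) \<and>
    (\<exists>\<Phi> \<in> hom (welded_braid_group n) (welded_gauss_group n).
       bij_betw \<Phi> (carrier (welded_braid_group n)) (carrier (welded_gauss_group n)) \<and>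
       (\<forall>D\<in>strand_diagrams n. \<Phi> (welded_braid n D) = welded_gauss_class n (gauss_of n D)))"
proof -
  interpret faithful_representation n "cayley_gen n" by (rule cayley_representation[OF assms])
  interpret B: valued_quotient "strand_diagrams n" "welded_eq n" stack trivial_strands "\<lambda>D. val (diagram_word n D)"
  proof
    show "(x, y) \<in> welded_eq n \<Longrightarrow> x \<in> strand_diagrams n \<Longrightarrow> y \<in> strand_diagrams n" for x y
      unfolding welded_eq_def by (rule equivclp_closed[rotated]) (auto simp: welded_step_def)
    fix D assume D: "D \<in> strand_diagrams n"
    then have "valid_word n (diagram_word n D)" using strands.valid_diagram_word by (auto simp: strands_def)
    then obtain w where w: "valid_word n w" "val w = - val (diagram_word n D)" using ex_inverse_word by blast
    from ex_diagram[OF w(1)] w(2) show "\<exists>y\<in>strand_diagrams n. val (diagram_word n y) = - val (diagram_word n D)" by metis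
  qed (use welded_eq_iff stack_diagrams trivial_strands_word in auto)
  interpret G: valued_quotient "bGD n" "wReidemeister_eq n" concat_gauss trivial_gauss gauss_val
  proof
    show "(x, y) \<in> wReidemeister_eq n \<Longrightarrow> x \<in> bGD n \<Longrightarrow> y \<in> bGD n" for x y
      unfolding wReidemeister_eq_def by (rule equivclp_closed[rotated]) (auto simp: wReidemeister_step_def)
    show "concat_gauss x y \<in> bGD n" if "x \<in> bGD n" "y \<in> bGD n" for x y
      using concat_gauss_linearization(1) bGD_linearization that by blast
    have lin: "linearization trivial_gauss []" by (simp add: linearization_def trivial_gauss_def)
    then show t: "trivial_gauss \<in> bGD n" by (rule bGD_I) (simp_all add: trivial_gauss_def permutes_id[unfolded id_def] permutes_id)
    show "gauss_val trivial_gauss = 0"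
      unfolding gauss_val_eq[OF t lin] by (simp add: trivial_gauss_def)
    fix G assume G: "G \<in> bGD n"
    obtain w where w: "valid_word n w" "(G, std_gauss (word_arrows w) (end_pos w)) \<in> wReidemeister_eq n"
      using bGD_word[OF G] by blast
    obtain w' where w': "valid_word n w'" "val w' = - val w" using ex_inverse_word[OF w(1)] by blast
    have "gauss_val (std_gauss (word_arrows w') (end_pos w')) = - gauss_val G"
      using gauss_val_std[OF w'(1)] gauss_val_std[OF w(1)] wReidemeister_eq_val[OF w(2)] w'(2) by simp
    moreover have "std_gauss (word_arrows w') (end_pos w') \<in> bGD n"
      using w'(1) by (intro std_bGD word_arrows_types end_pos_permutes)
    ultimately show "\<exists>y\<in>bGD n. gauss_val y = - gauss_val G" by blast
  qed (use wReidemeister_eq_iff concat_gauss_val in auto)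
  have BQ: "welded_braid_group n = B.Q" and GQ: "welded_gauss_group n = G.Q"
    by (simp_all add: welded_braid_group_def welded_braid_def B.Q_def
        welded_gauss_group_def welded_gauss_class_def G.Q_def)
  have gauss: "gauss_of n D \<in> bGD n" if "D \<in> strand_diagrams n" for D
    using strands.gauss_of_bGD that by (auto simp: strands_def)
  \<comment> \<open>Closing the image under equivalence defines a map on classes without choosing
    representatives.\<close>
  define \<Phi> where "\<Phi> A = wReidemeister_eq n `` (gauss_of n ` A)" for A
  have \<Phi>: "\<Phi> (welded_eq n `` {D}) = wReidemeister_eq n `` {gauss_of n D}" if D: "D \<in> strand_diagrams n" for D
  proof -
    have "wReidemeister_eq n `` {gauss_of n E} = wReidemeister_eq n `` {gauss_of n D}" if "E \<in> welded_eq n `` {D}" for E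
    proof -
      have "E \<in> strand_diagrams n" "val (diagram_word n E) = val (diagram_word n D)" using that B.class_eq[OF D] by auto
      then show ?thesis using D by (simp add: G.class_eq_iff gauss gauss_val_gauss_of)
    qed
    moreover have "D \<in> welded_eq n `` {D}" using B.class_eq[OF D] D by simp
    ultimately show ?thesis unfolding \<Phi>_def by fastforce
  qed
  have "\<Phi> \<in> hom B.Q G.Q"
  proof (rule homI)
    fix x assume "x \<in> carrier B.Q"
    then obtain D where D: "D \<in> strand_diagrams n" "x = welded_eq n `` {D}" by (auto simp: B.carrier_Q)
    then show "\<Phi> x \<in> carrier G.Q" using \<Phi> gauss by (auto simp: G.carrier_Q)
    fix y assume "y \<in> carrier B.Q"
    then obtain E where E: "E \<in> strand_diagrams n" "y = welded_eq n `` {E}" by (auto simp: B.carrier_Q)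
    show "\<Phi> (x \<otimes>\<^bsub>B.Q\<^esub> y) = \<Phi> x \<otimes>\<^bsub>G.Q\<^esub> \<Phi> y"
      using D E by (simp add: B.mult_Q \<Phi> G.mult_Q gauss B.f_closed G.f_closed G.class_eq_iff G.f_val
          gauss_val_gauss_of stack_diagrams)
  qed
  moreover have "bij_betw \<Phi> (carrier B.Q) (carrier G.Q)"
    unfolding bij_betw_def
  proof
    \<comment> \<open>On both sides equality of classes means equality of the same value in
      W.\<close>
    show "inj_on \<Phi> (carrier B.Q)"
    proof (rule inj_onI)
      fix x y assume "x \<in> carrier B.Q" "y \<in> carrier B.Q" and eq: "\<Phi> x = \<Phi> y"
      then obtain D E where DE: "D \<in> strand_diagrams n" "x = welded_eq n `` {D}"
        "E \<in> strand_diagrams n" "y = welded_eq n `` {E}" by (auto simp: B.carrier_Q)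
      with eq show "x = y" by (simp add: \<Phi> G.class_eq_iff B.class_eq_iff gauss gauss_val_gauss_of)
    qed
    show "\<Phi> ` carrier B.Q = carrier G.Q"
    proof (intro equalityI subsetI)
      fix x assume "x \<in> \<Phi> ` carrier B.Q"
      then show "x \<in> carrier G.Q" using \<Phi> gauss by (auto simp: B.carrier_Q G.carrier_Q)
    next
      fix x assume "x \<in> carrier G.Q"
      then obtain G where G: "G \<in> bGD n" "x = wReidemeister_eq n `` {G}" by (auto simp: G.carrier_Q)
      obtain w where w: "valid_word n w" "(G, std_gauss (word_arrows w) (end_pos w)) \<in> wReidemeister_eq n"
        using bGD_word[OF G(1)] by blast
      obtain D where D: "D \<in> strand_diagrams n" "diagram_word n D = w" using ex_diagram[OF w(1)] by blast
      have "gauss_val (gauss_of n D) = gauss_val G"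
        using gauss_val_gauss_of[OF D(1)] D(2) gauss_val_std[OF w(1)] wReidemeister_eq_val[OF w(2)] by simp
      then have "x = \<Phi> (welded_eq n `` {D})" using G D(1) by (simp add: \<Phi> G.class_eq_iff gauss)
      then show "x \<in> \<Phi> ` carrier B.Q" using D(1) by (auto simp: B.carrier_Q)
    qed
  qed
  moreover have "\<forall>D\<in>strand_diagrams n. \<Phi> (welded_braid n D) = welded_gauss_class n (gauss_of n D)"
    using \<Phi> by (simp add: welded_braid_def welded_gauss_class_def)
  ultimately show ?thesis
    unfolding BQ GQ using B.group_Q G.group_Q by blast
qed

end
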